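(* Let $c_1,c_2\in\mathbb C$ and let $W$ be a simple $\mathfrak g$-module in $\mathcal R_{\mathfrak g}(c_1,c_2)$ such that $M_0+\frac1{24}(n^2-1)\mathbf c_2$ acts injectively on $W$ for every nonzero integer $n$. Then there exist $q\in\mathbb N$ and a simple $\mathfrak g^{(0,-q)}$-module $V$ of central charge $(c_1,c_2)$ such that $W\cong\mathrm{Ind}_q(V)=U(\mathfrak g)\otimes_{U(\mathfrak g^{(0,-q)})}V$, where $V$ satisfies, for some $t\in\mathbb N$, the following two conditions: (a) if $t>0$, the action of $M_t$ on $V$ is injective; if $t=0$, the action of $M_0+\frac1{24}(n^2-1)\mathbf c_2$ on $V$ is injective for all nonzero integers $n$; (b) $M_iV=0$ for all $i>t$, and $L_jV=0$ for all $j>t+q$.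
   Context: $\mathbb N$ denotes nonnegative integers. The N=1 BMS superalgebra $\mathfrak g$ is the complex Lie superalgebra with even basis $L_n,M_n$ ($n\in\mathbb Z$), $\mathbf c_1,\mathbf c_2$, odd basis $Q_r$ ($r\in\mathbb Z+\frac12$), and brackets $[L_m,L_n]=(m-n)L_{m+n}+\frac1{12}\delta_{m+n,0}(m^3-m)\mathbf c_1$, $[L_m,M_n]=(m-n)M_{m+n}+\frac1{12}\delta_{m+n,0}(m^3-m)\mathbf c_2$, $[Q_r,Q_s]=2M_{r+s}+\frac13\delta_{r+s,0}(r^2-\frac14)\mathbf c_2$, $[L_m,Q_r]=(\frac m2-r)Q_{m+r}$, $[M_m,M_n]=[M_n,Q_r]=0$, with $\mathbf c_1,\mathbf c_2$ central. For $q\in\mathbb N$, $\mathfrak g^{(0,-q)}$ is the subalgebra $\bigoplus_{i\ge0}\mathbb CL_i\oplus\bigoplus_{j\ge-q}\mathbb CM_j\oplus\bigoplus_{k\ge1}\mathbb CQ_{k-\frac12}\oplus\mathbb C\mathbf c_1\oplus\mathbb C\mathbf c_2$. A module has central charge $(c_1,c_2)$ if $\mathbf c_1,\mathbf c_2$ act as the scalars $c_1,c_2$. A $\mathfrak g$-module $W$ is smooth if for every $w\in W$ one has $L_iw=M_iw=Q_{i-\frac12}w=0$ for all sufficiently large $i$. $\mathcal R_{\mathfrak g}(c_1,c_2)$ is the category of smooth $\mathfrak g$-modules of central charge $(c_1,c_2)$. *)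

theory Defs
  imports Complex_Main "HOL-Library.Poly_Mapping" "HOL-Library.Z2" "HOL-Algebra.Module"
    "HOL-Algebra.QuotRing" "HOL-Algebra.Generated_Groups" "HOL-Algebra.Free_Abelian_Groups"
begin

section \<open>The N=1 BMS superalgebra\<close>

text \<open>
  \<open>QB k\<close> stands for the odd basis vector \<open>Q\<^sub>r\<close> with \<open>r = k - 1/2\<close>, so that \<open>k\<close> ranges over
  all integers as \<open>r\<close> ranges over the half-integers.
\<close>

datatype bms_basis = LB int | MB int | QB int | C1B | C2B

text \<open>Finite complex linear combinations of the basis.\<close>

type_synonym bms = "bms_basis \<Rightarrow>\<^sub>0 complex"

definition cscale :: "complex \<Rightarrow> bms \<Rightarrow> bms" where
  "cscale c x = Poly_Mapping.map ((*) c) x"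

definition bL :: "int \<Rightarrow> bms" where "bL n = Poly_Mapping.single (LB n) 1"
definition bM :: "int \<Rightarrow> bms" where "bM n = Poly_Mapping.single (MB n) 1"
definition bQ :: "int \<Rightarrow> bms" where "bQ k = Poly_Mapping.single (QB k) 1"
definition bC1 :: bms where "bC1 = Poly_Mapping.single C1B 1"
definition bC2 :: bms where "bC2 = Poly_Mapping.single C2B 1"

definition half_idx :: "int \<Rightarrow> complex" where
  "half_idx k = of_int k - 1/2"

text \<open>
  Note that \<open>Q\<^sub>r\<close>, \<open>Q\<^sub>s\<close> with \<open>r = k - 1/2\<close>, \<open>s = l - 1/2\<close> have \<open>r + s = k + l - 1\<close>.
\<close>

fun basis_bracket :: "bms_basis \<Rightarrow> bms_basis \<Rightarrow> bms" where
  "basis_bracket (LB m) (LB n) =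
     cscale (of_int (m - n)) (bL (m + n))
     + (if m + n = 0 then cscale (of_int (m^3 - m) / 12) bC1 else 0)"
| "basis_bracket (LB m) (MB n) =
     cscale (of_int (m - n)) (bM (m + n))
     + (if m + n = 0 then cscale (of_int (m^3 - m) / 12) bC2 else 0)"
| "basis_bracket (MB n) (LB m) =
     - (cscale (of_int (m - n)) (bM (m + n))
        + (if m + n = 0 then cscale (of_int (m^3 - m) / 12) bC2 else 0))"
| "basis_bracket (QB k) (QB l) =
     cscale 2 (bM (k + l - 1))
     + (if k + l - 1 = 0 then cscale (1/3 * ((half_idx k)^2 - 1/4)) bC2 else 0)"
| "basis_bracket (LB m) (QB k) = cscale (of_int m / 2 - half_idx k) (bQ (m + k))"
| "basis_bracket (QB k) (LB m) = - cscale (of_int m / 2 - half_idx k) (bQ (m + k))"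
| "basis_bracket _ _ = 0"

definition bms_bracket :: "bms \<Rightarrow> bms \<Rightarrow> bms" where
  "bms_bracket x y =
     (\<Sum>a\<in>Poly_Mapping.keys x. \<Sum>b\<in>Poly_Mapping.keys y.
        cscale (Poly_Mapping.lookup x a * Poly_Mapping.lookup y b) (basis_bracket a b))"

lemma cscale_lookup [simp]:
  "Poly_Mapping.lookup (cscale c x) a = c * Poly_Mapping.lookup x a"
  by (simp add: cscale_def map.rep_eq when_def)

lemma bms_bracket_basis:
  "bms_bracket (Poly_Mapping.single a 1) (Poly_Mapping.single b 1) = basis_bracket a b"
  by (rule poly_mapping_eqI) (simp add: bms_bracket_def)

fun basis_parity :: "bms_basis \<Rightarrow> bit" where
  "basis_parity (QB k) = 1"
| "basis_parity _ = 0"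

definition bms_part :: "bit \<Rightarrow> bms set" where
  "bms_part i = {x. \<forall>a\<in>Poly_Mapping.keys x. basis_parity a = i}"

text \<open>The sign \<open>(-1)\<^sup>i\<^sup>j\<close>.\<close>

definition parity_sign :: "bit \<Rightarrow> bit \<Rightarrow> complex" where
  "parity_sign i j = (if i = 1 \<and> j = 1 then -1 else 1)"

definition sub_basis :: "nat \<Rightarrow> bms_basis set" where
  "sub_basis q = {LB i |i. i \<ge> 0} \<union> {MB j |j. j \<ge> - int q} \<union> {QB k |k. k \<ge> 1} \<union> {C1B, C2B}"

text \<open>The subalgebra \<open>\<gg>\<^sup>(\<^sup>0\<^sup>,\<^sup>-\<^sup>q\<^sup>)\<close>.\<close>

definition bms_sub :: "nat \<Rightarrow> bms set" where
  "bms_sub q = {x. Poly_Mapping.keys x \<subseteq> sub_basis q}"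

lemma keys_basis_bracket_sub:
  assumes "a \<in> sub_basis q" "b \<in> sub_basis q"
  shows "Poly_Mapping.keys (basis_bracket a b) \<subseteq> sub_basis q"
  using assms
  by (cases "(a, b)" rule: basis_bracket.cases)
    (auto simp: sub_basis_def in_keys_iff lookup_add lookup_minus bL_def bM_def bQ_def bC1_def bC2_def
      lookup_single when_def split: if_splits)

lemma bms_sub_bracket_closed:
  assumes "x \<in> bms_sub q" "y \<in> bms_sub q"
  shows "bms_bracket x y \<in> bms_sub q"
proof -
  have "Poly_Mapping.lookup (bms_bracket x y) c = 0" if "c \<notin> sub_basis q" for c
  proof -
    have "Poly_Mapping.lookup (basis_bracket a b) c = 0"
      if "a \<in> Poly_Mapping.keys x" "b \<in> Poly_Mapping.keys y" for a b
      using keys_basis_bracket_sub[of a q b] assms that \<open>c \<notin> sub_basis q\<close>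
      by (force simp: bms_sub_def in_keys_iff)
    then show ?thesis by (simp add: bms_bracket_def lookup_sum)
  qed
  then show ?thesis by (auto simp: bms_sub_def in_keys_iff)
qed


section \<open>Modules over subalgebras of the BMS superalgebra\<close>

definition complex_ring :: "complex ring" where
  "complex_ring = \<lparr>carrier = UNIV, monoid.mult = (*), one = 1, ring.zero = 0, add = (+)\<rparr>"

text \<open>
  A module has its own carrier and vector space structure (the multiplicative fields that
  the record type inherits from rings play no role), a \<open>\<int>\<^sub>2\<close>-grading and an action. The action
  of a subalgebra \<open>\<aa>\<close> is only meaningful on \<open>\<aa>\<close>.
\<close>

record 'v supermod = "(complex, 'v) module" +
  part :: "bit \<Rightarrow> 'v set"
  act :: "bms \<Rightarrow> 'v \<Rightarrow> 'v"

definition supermodule :: "bms set \<Rightarrow> 'v supermod \<Rightarrow> bool" where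
  "supermodule \<aa> V \<longleftrightarrow>
     Module.module complex_ring V \<and>
     (\<forall>i. submodule (part V i) complex_ring V) \<and>
     (\<forall>v\<in>carrier V. \<exists>!p. p \<in> part V 0 \<times> part V 1 \<and> v = fst p \<oplus>\<^bsub>V\<^esub> snd p) \<and>
     (\<forall>x\<in>\<aa>. \<forall>v\<in>carrier V. act V x v \<in> carrier V) \<and>
     (\<forall>x\<in>\<aa>. \<forall>v\<in>carrier V. \<forall>w\<in>carrier V. act V x (v \<oplus>\<^bsub>V\<^esub> w) = act V x v \<oplus>\<^bsub>V\<^esub> act V x w) \<and>
     (\<forall>x\<in>\<aa>. \<forall>c. \<forall>v\<in>carrier V. act V x (c \<odot>\<^bsub>V\<^esub> v) = c \<odot>\<^bsub>V\<^esub> act V x v) \<and>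
     (\<forall>x\<in>\<aa>. \<forall>y\<in>\<aa>. \<forall>v\<in>carrier V. act V (x + y) v = act V x v \<oplus>\<^bsub>V\<^esub> act V y v) \<and>
     (\<forall>x\<in>\<aa>. \<forall>c. \<forall>v\<in>carrier V. act V (cscale c x) v = c \<odot>\<^bsub>V\<^esub> act V x v) \<and>
     (\<forall>i j. \<forall>x\<in>\<aa> \<inter> bms_part i. \<forall>v\<in>part V j. act V x v \<in> part V (i + j)) \<and>
     (\<forall>i j. \<forall>x\<in>\<aa> \<inter> bms_part i. \<forall>y\<in>\<aa> \<inter> bms_part j. \<forall>v\<in>carrier V.
        act V (bms_bracket x y) v =
          act V x (act V y v) \<ominus>\<^bsub>V\<^esub> parity_sign i j \<odot>\<^bsub>V\<^esub> act V y (act V x v))"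

definition sub_supermodule :: "bms set \<Rightarrow> 'v supermod \<Rightarrow> 'v set \<Rightarrow> bool" where
  "sub_supermodule \<aa> V N \<longleftrightarrow>
     submodule N complex_ring V \<and>
     (\<forall>v\<in>N. \<exists>v0\<in>N \<inter> part V 0. \<exists>v1\<in>N \<inter> part V 1. v = v0 \<oplus>\<^bsub>V\<^esub> v1) \<and>
     (\<forall>x\<in>\<aa>. \<forall>v\<in>N. act V x v \<in> N)"

definition simple_supermodule :: "bms set \<Rightarrow> 'v supermod \<Rightarrow> bool" where
  "simple_supermodule \<aa> V \<longleftrightarrow>
     supermodule \<aa> V \<and> carrier V \<noteq> {\<zero>\<^bsub>V\<^esub>} \<and>
     (\<forall>N. sub_supermodule \<aa> V N \<longrightarrow> N = {\<zero>\<^bsub>V\<^esub>} \<or> N = carrier V)"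

definition central_charge :: "complex \<Rightarrow> complex \<Rightarrow> 'v supermod \<Rightarrow> bool" where
  "central_charge c1 c2 V \<longleftrightarrow>
     (\<forall>v\<in>carrier V. act V bC1 v = c1 \<odot>\<^bsub>V\<^esub> v \<and> act V bC2 v = c2 \<odot>\<^bsub>V\<^esub> v)"

definition smooth :: "'v supermod \<Rightarrow> bool" where
  "smooth W \<longleftrightarrow>
     (\<forall>w\<in>carrier W. \<exists>N. \<forall>i\<ge>N.
        act W (bL i) w = \<zero>\<^bsub>W\<^esub> \<and> act W (bM i) w = \<zero>\<^bsub>W\<^esub> \<and> act W (bQ i) w = \<zero>\<^bsub>W\<^esub>)"

text \<open>The objects of the category \<open>\<R>\<^sub>\<gg>(c\<^sub>1, c\<^sub>2)\<close>.\<close>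

definition smooth_modules :: "complex \<Rightarrow> complex \<Rightarrow> 'v supermod set" where
  "smooth_modules c1 c2 = {W. supermodule UNIV W \<and> smooth W \<and> central_charge c1 c2 W}"

definition supermodule_iso :: "bms set \<Rightarrow> 'v supermod \<Rightarrow> 'w supermod \<Rightarrow> ('v \<Rightarrow> 'w) \<Rightarrow> bool" where
  "supermodule_iso \<aa> V W \<phi> \<longleftrightarrow>
     bij_betw \<phi> (carrier V) (carrier W) \<and>
     (\<forall>v\<in>carrier V. \<forall>v'\<in>carrier V. \<phi> (v \<oplus>\<^bsub>V\<^esub> v') = \<phi> v \<oplus>\<^bsub>W\<^esub> \<phi> v') \<and>
     (\<forall>c. \<forall>v\<in>carrier V. \<phi> (c \<odot>\<^bsub>V\<^esub> v) = c \<odot>\<^bsub>W\<^esub> \<phi> v) \<and>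
     (\<forall>i. \<phi> ` part V i = part W i) \<and>
     (\<forall>x\<in>\<aa>. \<forall>v\<in>carrier V. \<phi> (act V x v) = act W x (\<phi> v))"


section \<open>Universal enveloping algebras\<close>

text \<open>The free unital associative complex algebra on a set of letters.\<close>

definition free_algebra :: "'x set \<Rightarrow> ('x list \<Rightarrow>\<^sub>0 complex) ring" where
  "free_algebra X =
     \<lparr>carrier = {f. Poly_Mapping.keys f \<subseteq> lists X},
      monoid.mult = (\<lambda>f g. \<Sum>u\<in>Poly_Mapping.keys f. \<Sum>w\<in>Poly_Mapping.keys g.
                Poly_Mapping.single (u @ w) (Poly_Mapping.lookup f u * Poly_Mapping.lookup g w)),
      one = Poly_Mapping.single [] 1,
      ring.zero = 0,
      add = (+)\<rparr>"

text \<open>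
  The enveloping algebra of a subalgebra \<open>\<aa>\<close> is the free algebra on the underlying set of \<open>\<aa>\<close>
  modulo the relations making the inclusion of \<open>\<aa>\<close> linear (this quotient is the tensor
  algebra of \<open>\<aa>\<close>) together with \<open>xy - (-1)\<^sup>i\<^sup>jyx = [x, y]\<close> for homogeneous \<open>x, y\<close> of degrees \<open>i, j\<close>.
\<close>

definition env_relations :: "bms set \<Rightarrow> (bms list \<Rightarrow>\<^sub>0 complex) set" where
  "env_relations \<aa> =
     {Poly_Mapping.single [x + y] 1 - Poly_Mapping.single [x] 1 - Poly_Mapping.single [y] 1
        | x y. x \<in> \<aa> \<and> y \<in> \<aa>} \<union>
     {Poly_Mapping.single [cscale c x] 1 - Poly_Mapping.single [x] c | c x. x \<in> \<aa>} \<union>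
     {Poly_Mapping.single [x, y] 1 - Poly_Mapping.single [y, x] (parity_sign i j)
        - Poly_Mapping.single [bms_bracket x y] 1
        | x y i j. x \<in> \<aa> \<inter> bms_part i \<and> y \<in> \<aa> \<inter> bms_part j}"

definition env_ideal :: "bms set \<Rightarrow> (bms list \<Rightarrow>\<^sub>0 complex) set" where
  "env_ideal \<aa> = genideal (free_algebra \<aa>) (env_relations \<aa>)"

definition env_algebra :: "bms set \<Rightarrow> (bms list \<Rightarrow>\<^sub>0 complex) set ring" where
  "env_algebra \<aa> = free_algebra \<aa> Quot env_ideal \<aa>"

definition env_class :: "bms set \<Rightarrow> (bms list \<Rightarrow>\<^sub>0 complex) \<Rightarrow> (bms list \<Rightarrow>\<^sub>0 complex) set" where
  "env_class \<aa> f = env_ideal \<aa> +>\<^bsub>free_algebra \<aa>\<^esub> f"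

definition env_part :: "bms set \<Rightarrow> bit \<Rightarrow> (bms list \<Rightarrow>\<^sub>0 complex) set set" where
  "env_part \<aa> i =
     {env_class \<aa> f | f. f \<in> carrier (free_algebra \<aa>) \<and>
        (\<forall>xs\<in>Poly_Mapping.keys f. \<exists>js. list_all2 (\<lambda>x j. x \<in> bms_part j) xs js \<and> sum_list js = i)}"

text \<open>
  For \<open>\<bb> \<subseteq> \<aa>\<close>, the canonical homomorphism \<open>U(\<bb>) \<rightarrow> U(\<aa>)\<close>: it sends a coset of the ideal of \<open>\<bb>\<close>
  to the coset of the (larger) ideal of \<open>\<aa>\<close> containing it.
\<close>

definition env_map :: "bms set \<Rightarrow> (bms list \<Rightarrow>\<^sub>0 complex) set \<Rightarrow> (bms list \<Rightarrow>\<^sub>0 complex) set" where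
  "env_map \<aa> u = env_ideal \<aa> <+>\<^bsub>free_algebra \<aa>\<^esub> u"

text \<open>
  The action of the enveloping algebra on a module: a word \<open>x\<^sub>1\<dots>x\<^sub>n\<close> acts by
  \<open>x\<^sub>1(x\<^sub>2(\<dots>(x\<^sub>nv)))\<close>, and all representatives of a class act in the same way.
\<close>

definition free_act :: "'v supermod \<Rightarrow> (bms list \<Rightarrow>\<^sub>0 complex) \<Rightarrow> 'v \<Rightarrow> 'v" where
  "free_act V f v =
     (\<Oplus>\<^bsub>V\<^esub>xs\<in>Poly_Mapping.keys f. Poly_Mapping.lookup f xs \<odot>\<^bsub>V\<^esub> foldr (act V) xs v)"

definition env_act :: "'v supermod \<Rightarrow> (bms list \<Rightarrow>\<^sub>0 complex) set \<Rightarrow> 'v \<Rightarrow> 'v" where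
  "env_act V u v = the_elem ((\<lambda>f. free_act V f v) ` u)"


section \<open>Tensor products over a ring\<close>

text \<open>
  The tensor product over \<open>R\<close> of a right module \<open>M\<close> (with action \<open>ra\<close>) and a left module \<open>N\<close>
  (with action \<open>la\<close>) is the free abelian group on \<open>M \<times> N\<close> modulo the usual relations.
\<close>

definition tensor_relations ::
  "('r, 'a) ring_scheme \<Rightarrow> ('m, 'b) ring_scheme \<Rightarrow> ('m \<Rightarrow> 'r \<Rightarrow> 'm) \<Rightarrow>
   ('n, 'c) ring_scheme \<Rightarrow> ('r \<Rightarrow> 'n \<Rightarrow> 'n) \<Rightarrow> ('m \<times> 'n \<Rightarrow>\<^sub>0 int) set" where
  "tensor_relations R M ra N la =
     generate (free_Abelian_group (carrier M \<times> carrier N))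
      ({frag_of (m \<oplus>\<^bsub>M\<^esub> m', n) - frag_of (m, n) - frag_of (m', n)
          | m m' n. m \<in> carrier M \<and> m' \<in> carrier M \<and> n \<in> carrier N} \<union>
       {frag_of (m, n \<oplus>\<^bsub>N\<^esub> n') - frag_of (m, n) - frag_of (m, n')
          | m n n'. m \<in> carrier M \<and> n \<in> carrier N \<and> n' \<in> carrier N} \<union>
       {frag_of (ra m r, n) - frag_of (m, la r n)
          | m r n. m \<in> carrier M \<and> r \<in> carrier R \<and> n \<in> carrier N})"

definition tensor_product ::
  "('r, 'a) ring_scheme \<Rightarrow> ('m, 'b) ring_scheme \<Rightarrow> ('m \<Rightarrow> 'r \<Rightarrow> 'm) \<Rightarrow>
   ('n, 'c) ring_scheme \<Rightarrow> ('r \<Rightarrow> 'n \<Rightarrow> 'n) \<Rightarrow> ('m \<times> 'n \<Rightarrow>\<^sub>0 int) set monoid" where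
  "tensor_product R M ra N la =
     free_Abelian_group (carrier M \<times> carrier N) Mod tensor_relations R M ra N la"


section \<open>Induced modules\<close>

type_synonym 'v ind = "((bms list \<Rightarrow>\<^sub>0 complex) set \<times> 'v \<Rightarrow>\<^sub>0 int) set"

definition ind_relations :: "bms set \<Rightarrow> 'v supermod \<Rightarrow> 'v ind" where
  "ind_relations \<bb> V =
     tensor_relations (env_algebra \<bb>)
       (env_algebra UNIV) (\<lambda>u b. u \<otimes>\<^bsub>env_algebra UNIV\<^esub> env_map UNIV b)
       V (env_act V)"

definition ind_group :: "bms set \<Rightarrow> 'v supermod \<Rightarrow> 'v ind monoid" where
  "ind_group \<bb> V =
     tensor_product (env_algebra \<bb>)
       (env_algebra UNIV) (\<lambda>u b. u \<otimes>\<^bsub>env_algebra UNIV\<^esub> env_map UNIV b)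
       V (env_act V)"

definition ind_tensor ::
  "bms set \<Rightarrow> 'v supermod \<Rightarrow> (bms list \<Rightarrow>\<^sub>0 complex) set \<Rightarrow> 'v \<Rightarrow> 'v ind" where
  "ind_tensor \<bb> V u v =
     ind_relations \<bb> V #>\<^bsub>free_Abelian_group (carrier (env_algebra UNIV) \<times> carrier V)\<^esub> frag_of (u, v)"

text \<open>
  Left multiplication by an element \<open>a\<close> of the enveloping algebra, \<open>a(u \<otimes> v) = au \<otimes> v\<close>, as the map
  induced on cosets by the additive extension of \<open>(u, v) \<mapsto> (au, v)\<close> to the free abelian group.
\<close>

definition ind_env_act ::
  "bms set \<Rightarrow> 'v supermod \<Rightarrow> (bms list \<Rightarrow>\<^sub>0 complex) set \<Rightarrow> 'v ind \<Rightarrow> 'v ind" where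
  "ind_env_act \<bb> V a T =
     ind_relations \<bb> V
       <#>\<^bsub>free_Abelian_group (carrier (env_algebra UNIV) \<times> carrier V)\<^esub>
     frag_extend (\<lambda>(u, v). frag_of (a \<otimes>\<^bsub>env_algebra UNIV\<^esub> u, v)) ` T"

text \<open>The induced module \<open>U(\<gg>) \<otimes>\<^bsub>U(\<bb>)\<^esub> V\<close>.\<close>

definition induced :: "bms set \<Rightarrow> 'v supermod \<Rightarrow> 'v ind supermod" where
  "induced \<bb> V =
     \<lparr>carrier = carrier (ind_group \<bb> V),
      monoid.mult = undefined,
      one = undefined,
      ring.zero = \<one>\<^bsub>ind_group \<bb> V\<^esub>,
      add = (\<lambda>S T. S \<otimes>\<^bsub>ind_group \<bb> V\<^esub> T),
      smult = (\<lambda>c. ind_env_act \<bb> V (env_class UNIV (Poly_Mapping.single [] c))),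
      part = (\<lambda>k. generate (ind_group \<bb> V)
                {ind_tensor \<bb> V u v | u v i j. u \<in> env_part UNIV i \<and> v \<in> part V j \<and> i + j = k}),
      act = (\<lambda>x. ind_env_act \<bb> V (env_class UNIV (Poly_Mapping.single [x] 1)))\<rparr>"

definition Ind :: "nat \<Rightarrow> 'v supermod \<Rightarrow> 'v ind supermod" where
  "Ind q V = induced (bms_sub q) V"

text \<open>The element \<open>M\<^sub>0 + (n\<^sup>2 - 1)/24 \<cdot> c\<^sub>2\<close>.\<close>

definition shiftM0 :: "int \<Rightarrow> bms" where
  "shiftM0 n = bM 0 + cscale (of_int (n^2 - 1) / 24) bC2"

end

theory Submission
  imports Defs "HOL-Library.Multiset"
begin

text \<open>
  Let \<open>t\<close> be minimal such that some nonzero vector is killed by all \<open>M\<^sub>i\<close> with \<open>i > t\<close>. Among these vectors the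
  operators \<open>Q\<^sub>r\<close> with \<open>r > t\<close> anticommute and square to zero, so some nonzero vector is killed by all of them,
  and by smoothness also by all \<open>L\<^sub>j\<close> with \<open>j > t + q\<close>, for some \<open>q\<close>. Let \<open>V\<close> be the space of all such vectors; it
  is stable under \<open>\<gg>\<^sup>(\<^sup>0\<^sup>,\<^sup>-\<^sup>q\<^sup>)\<close>.

  The canonical map \<open>Ind\<^sub>q(V) \<rightarrow> W\<close> is onto because \<open>W\<close> is simple. For injectivity, the induced module is spanned by
  ordered monomials in \<open>L\<^sub>-\<^sub>i\<close>, \<open>Q\<^sub>-\<^sub>i\<^sub>+\<^sub>1\<^sub>/\<^sub>2\<close>, \<open>M\<^sub>-\<^sub>q\<^sub>-\<^sub>i\<close> (\<open>i \<ge> 1\<close>) applied to \<open>V\<close>, and in \<open>W\<close> these are independent: the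
  lowering operators \<open>M\<^sub>t\<^sub>+\<^sub>i\<close>, \<open>Q\<^sub>t\<^sub>+\<^sub>i\<^sub>-\<^sub>1\<^sub>/\<^sub>2\<close>, \<open>L\<^sub>t\<^sub>+\<^sub>q\<^sub>+\<^sub>i\<close> kill \<open>V\<close>, and their brackets with the raising operators are nonzero
  multiples of \<open>M\<^sub>t\<close> (of \<open>M\<^sub>0 + (n\<^sup>2 - 1)/24 \<cdot> c\<^sub>2\<close> with \<open>n \<noteq> 0\<close> if \<open>t = 0\<close>), which is injective on \<open>V\<close>. So the linear
  independence of the Poincare-Birkhoff-Witt basis of \<open>U(\<gg>)\<close> is not needed. Independence also shows that a
  nonzero submodule of \<open>V\<close>, which generates \<open>W\<close>, must be \<open>V\<close>.
\<close>

section \<open>Finitely supported functions and the free algebra\<close>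

text \<open>Two obstacles shape the proof. First, the three families of raising operators are
  lowered by operators of three different kinds, and V is not stable under any of the families.
  Independence is therefore proved one family at a time over a growing coefficient space: M-words
  over V, Q-words over the larger space on which only the conditions on M and Q are kept, L-words
  over the still larger space on which only the condition on M is kept. Injectivity of the top
  bracket is needed on the last of these spaces, and this is what the minimal choice of t gives.
  Only the L-words require a filtration by length; for the other two families the lowering is exact.

  Second, W is a record with a carrier, while spans, bases and sums are those of vector spaces on
  types. A linear section embeds W into a space of finitely supported functions, all computations
  with operators take place there, and only the results are carried back to W.\<close>

lemma poly_mapping_induct_keys [consumes 1, case_names zero single add]:
  assumes "Poly_Mapping.keys f \<subseteq> S" "P 0" "\<And>k c. k \<in> S \<Longrightarrow> P (Poly_Mapping.single k c)"
    "\<And>f g. Poly_Mapping.keys f \<subseteq> S \<Longrightarrow> Poly_Mapping.keys g \<subseteq> S \<Longrightarrow> P f \<Longrightarrow> P g \<Longrightarrow> P (f + g)"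
  shows "P (f :: 'a \<Rightarrow>\<^sub>0 'b::monoid_add)"
  using assms(1)
proof (induction f rule: update_induct)
  case (update f a b)
  have *: "Poly_Mapping.update a b f = f + Poly_Mapping.single a b"
    using update(1) by (intro poly_mapping_eqI) (auto simp: lookup_update lookup_add lookup_single in_keys_iff when_def)
  have "Poly_Mapping.keys f \<subseteq> Poly_Mapping.keys (Poly_Mapping.update a b f)"
    using update(1) by (auto simp: in_keys_iff lookup_update)
  moreover have "a \<in> Poly_Mapping.keys (Poly_Mapping.update a b f)"
    using update(2) by (simp add: in_keys_iff lookup_update)
  ultimately have "Poly_Mapping.keys f \<subseteq> S" "a \<in> S" using update.prems by auto
  then show ?case
    unfolding * using update.IH by (intro assms(3,4)) auto
qed (rule assms(2))

lemma poly_mapping_induct_add [case_names single add]: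
  assumes "\<And>k c. P (Poly_Mapping.single k c)" "\<And>f g. P f \<Longrightarrow> P g \<Longrightarrow> P (f + g)"
  shows "P (f :: 'a \<Rightarrow>\<^sub>0 'b::monoid_add)"
proof (rule poly_mapping_induct_keys[of f UNIV])
  show "P 0" using assms(1)[of undefined 0] by simp
qed (simp_all add: assms)

text \<open>\<open>cscale\<close> at an arbitrary index type. The same scaling serves the
  superalgebra, the free algebra and the space into which modules are embedded.\<close>

definition pscale :: "complex \<Rightarrow> ('a \<Rightarrow>\<^sub>0 complex) \<Rightarrow> ('a \<Rightarrow>\<^sub>0 complex)" where
  "pscale c f = Poly_Mapping.map ((*) c) f"

lemma lookup_pscale [simp]: "Poly_Mapping.lookup (pscale c x) a = c * Poly_Mapping.lookup x a"
  by (simp add: pscale_def map.rep_eq when_def)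

lemma pscale_single [simp]: "pscale c (Poly_Mapping.single k d) = Poly_Mapping.single k (c * d)"
  by (rule poly_mapping_eqI) (simp add: lookup_single when_def)

lemma cscale_eq_pscale: "cscale = pscale"
  by (intro ext poly_mapping_eqI) simp

interpretation pm: vector_space pscale
  by unfold_locales (rule poly_mapping_eqI, simp add: lookup_add algebra_simps)+

lemma keys_pscale: "Poly_Mapping.keys (pscale c f) \<subseteq> Poly_Mapping.keys f"
  by (auto simp: in_keys_iff)

text \<open>The product of \<open>free_algebra X\<close> does not depend on \<open>X\<close>. One
  name for it lets the free algebras over the superalgebra and over its subalgebras share their
  rules.\<close>

definition fmul :: "('x list \<Rightarrow>\<^sub>0 complex) \<Rightarrow> ('x list \<Rightarrow>\<^sub>0 complex) \<Rightarrow> ('x list \<Rightarrow>\<^sub>0 complex)" where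
  "fmul f g = (\<Sum>u\<in>Poly_Mapping.keys f. \<Sum>w\<in>Poly_Mapping.keys g.
                Poly_Mapping.single (u @ w) (Poly_Mapping.lookup f u * Poly_Mapping.lookup g w))"

lemma fmul_add_left: "fmul (f + f') g = fmul f g + fmul f' g"
  unfolding fmul_def
  by (rule setsum_keys_plus_distrib)
     (simp_all add: distrib_right single_add sum.distrib)

lemma fmul_add_right: "fmul f (g + g') = fmul f g + fmul f g'"
  unfolding fmul_def sum.distrib[symmetric]
  by (intro sum.cong refl setsum_keys_plus_distrib) (simp_all add: distrib_left single_add)

lemma fmul_single [simp]:
  "fmul (Poly_Mapping.single u a) (Poly_Mapping.single w b) = Poly_Mapping.single (u @ w) (a * b)"
  by (simp add: fmul_def)

lemma fmul_assoc: "fmul (fmul f g) h = fmul f (fmul g h)"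
proof (induction f rule: poly_mapping_induct_add)
  case (single u a)
  show ?case
  proof (induction g rule: poly_mapping_induct_add)
    case (single v b)
    show ?case
      by (induction h rule: poly_mapping_induct_add) (simp_all add: fmul_add_right mult.assoc)
  qed (simp add: fmul_add_left fmul_add_right)
qed (simp add: fmul_add_left)

lemma fmul_zero [simp]: "fmul 0 f = 0" "fmul f 0 = 0"
  by (simp_all add: fmul_def)

lemma fmul_one [simp]: "fmul (Poly_Mapping.single [] 1) f = f" "fmul f (Poly_Mapping.single [] 1) = f"
  by (induction f rule: poly_mapping_induct_add) (simp_all add: fmul_add_left fmul_add_right)

lemma fmul_scalar [simp]:
  "fmul (Poly_Mapping.single [] c) f = pscale c f" "fmul f (Poly_Mapping.single [] c) = pscale c f"
  by (induction f rule: poly_mapping_induct_add)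
     (simp_all add: fmul_add_left fmul_add_right pm.scale_right_distrib mult.commute)

lemma fmul_uminus [simp]: "fmul (- f) g = - fmul f g" "fmul f (- g) = - fmul f g"
  by (metis add.right_inverse fmul_add_left fmul_zero(1) minus_unique)
     (metis add.right_inverse fmul_add_right fmul_zero(2) minus_unique)

lemma fmul_diff: "fmul (f - f') g = fmul f g - fmul f' g" "fmul f (g - g') = fmul f g - fmul f g'"
  by (simp_all add: fmul_add_left fmul_add_right flip: add_uminus_conv_diff)

lemma keys_fmul:
  "Poly_Mapping.keys (fmul f g) \<subseteq> {u @ w | u w. u \<in> Poly_Mapping.keys f \<and> w \<in> Poly_Mapping.keys g}"
proof
  fix x assume "x \<in> Poly_Mapping.keys (fmul f g)"
  then obtain u where u: "u \<in> Poly_Mapping.keys f"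
    "x \<in> Poly_Mapping.keys (\<Sum>w\<in>Poly_Mapping.keys g.
                Poly_Mapping.single (u @ w) (Poly_Mapping.lookup f u * Poly_Mapping.lookup g w))"
    unfolding fmul_def using keys_sum by fastforce
  then obtain w where "w \<in> Poly_Mapping.keys g"
    "x \<in> Poly_Mapping.keys (Poly_Mapping.single (u @ w) (Poly_Mapping.lookup f u * Poly_Mapping.lookup g w))"
    using keys_sum by fastforce
  then show "x \<in> {u @ w | u w. u \<in> Poly_Mapping.keys f \<and> w \<in> Poly_Mapping.keys g}"
    using u by (auto split: if_splits)
qed

lemma free_algebra_simps [simp]:
  "carrier (free_algebra X) = {f. Poly_Mapping.keys f \<subseteq> lists X}"
  "monoid.mult (free_algebra X) = fmul"
  "one (free_algebra X) = Poly_Mapping.single [] 1"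
  "ring.zero (free_algebra X) = 0"
  "add (free_algebra X) = (+)"
  by (simp_all add: free_algebra_def fmul_def[abs_def])

lemma ring_free_algebra: "ring (free_algebra X)"
proof (intro ringI abelian_groupI monoidI)
  show "\<exists>y\<in>carrier (free_algebra X). y \<oplus>\<^bsub>free_algebra X\<^esub> x = \<zero>\<^bsub>free_algebra X\<^esub>"
    if "x \<in> carrier (free_algebra X)" for x
    using that by (intro bexI[of _ "- x"]) auto
qed (use keys_fmul in \<open>fastforce simp: fmul_assoc fmul_add_left fmul_add_right add_ac dest: subsetD[OF keys_add]\<close>)+

interpretation fa: ring "free_algebra X" for X
  by (rule ring_free_algebra)

section \<open>Spanning by ordered monomials\<close>

abbreviation basis_elt :: "bms_basis \<Rightarrow> bms" where
  "basis_elt a \<equiv> Poly_Mapping.single a 1"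

abbreviation word :: "'x list \<Rightarrow> ('x list \<Rightarrow>\<^sub>0 complex)" where
  "word xs \<equiv> Poly_Mapping.single xs 1"

lemma basis_elt_part: "basis_elt a \<in> bms_part (basis_parity a)"
  by (simp add: bms_part_def)

lemma bms_induct [case_names add scale basis]:
  assumes "\<And>x y. P x \<Longrightarrow> P y \<Longrightarrow> P (x + y)" "\<And>c x. P x \<Longrightarrow> P (cscale c x)" "\<And>a. P (basis_elt a)"
  shows "P x"
proof (induction x rule: poly_mapping_induct_add)
  case (single k c)
  then show ?case using assms(2)[of "basis_elt k" c] assms(3) by (simp add: cscale_eq_pscale)
qed (rule assms(1))

lemma env_relations_carrier:
  assumes "\<And>x y. x \<in> \<aa> \<Longrightarrow> y \<in> \<aa> \<Longrightarrow> x + y \<in> \<aa>" "\<And>c x. x \<in> \<aa> \<Longrightarrow> cscale c x \<in> \<aa>"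
    "\<And>x y. x \<in> \<aa> \<Longrightarrow> y \<in> \<aa> \<Longrightarrow> bms_bracket x y \<in> \<aa>"
  shows "env_relations \<aa> \<subseteq> carrier (free_algebra \<aa>)"
  using assms unfolding env_relations_def
  by (auto 0 3 dest!: subsetD[OF keys_diff] split: if_splits)

lemma env_ideal_ideal:
  assumes "env_relations \<aa> \<subseteq> carrier (free_algebra \<aa>)"
  shows "ideal (env_ideal \<aa>) (free_algebra \<aa>)"
  unfolding env_ideal_def by (rule fa.genideal_ideal[OF assms])

lemma ideal_env_UNIV: "ideal (env_ideal UNIV) (free_algebra UNIV)"
  by (rule env_ideal_ideal) simp

section \<open>Rewriting inside a word modulo the enveloping ideal\<close>

lemma env_ideal_mult:
  assumes "r \<in> env_relations UNIV"
  shows "fmul (fmul f r) g \<in> env_ideal UNIV"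
proof -
  interpret ideal "env_ideal UNIV" "free_algebra UNIV" by (rule ideal_env_UNIV)
  have "r \<in> env_ideal UNIV"
    using assms fa.genideal_self[of "env_relations UNIV" UNIV] by (auto simp: env_ideal_def)
  then show ?thesis using I_l_closed[of r f] I_r_closed[of "fmul f r" g] by simp
qed

lemma env_ideal_subspace: "pm.subspace (env_ideal UNIV)"
proof -
  interpret ideal "env_ideal UNIV" "free_algebra UNIV" by (rule ideal_env_UNIV)
  show ?thesis
    using a_closed zero_closed I_l_closed[of _ "Poly_Mapping.single [] c" for c] by (auto simp: pm.subspace_def)
qed

lemma word_add:
  "word (u @ (x + y) # w) - word (u @ x # w) - word (u @ y # w) \<in> env_ideal UNIV"
  using env_ideal_mult[of "word [x + y] - word [x] - word [y]" "word u" "word w"]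
  by (force simp: env_relations_def fmul_diff)

lemma word_cscale:
  "word (u @ cscale c x # w) - pscale c (word (u @ x # w)) \<in> env_ideal UNIV"
  using env_ideal_mult[of "word [cscale c x] - Poly_Mapping.single [x] c" "word u" "word w"]
  by (force simp: env_relations_def fmul_diff)

lemma word_commute:
  assumes "x \<in> bms_part i" "y \<in> bms_part j"
  shows "word (u @ x # y # w) - pscale (parity_sign i j) (word (u @ y # x # w))
     - word (u @ bms_bracket x y # w) \<in> env_ideal UNIV"
  using env_ideal_mult[of "word [x, y] - Poly_Mapping.single [y, x] (parity_sign i j)
        - word [bms_bracket x y]" "word u" "word w"] assms
  by (force simp: env_relations_def fmul_diff)

text \<open>An entry i stands for L_(-i-1), Q_(-i-1/2) or M_(-q-i-1), so each family of letters
  outside the subalgebra is numbered from 0. The odd list is strictly decreasing because the square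
  of an odd letter reduces to a bracket.\<close>

definition pbw_index :: "(nat list \<times> nat list \<times> nat list) set" where
  "pbw_index = {(c, b, a). sorted_wrt (\<ge>) c \<and> sorted_wrt (>) b \<and> sorted_wrt (\<ge>) a}"

fun pbw_word :: "nat \<Rightarrow> nat list \<times> nat list \<times> nat list \<Rightarrow> bms_basis list" where
  "pbw_word q (c, b, a) = map (\<lambda>i. LB (- int i - 1)) c @ map (\<lambda>i. QB (- int i)) b
     @ map (\<lambda>i. MB (- int q - int i - 1)) a"

abbreviation bword :: "bms_basis list \<Rightarrow> (bms list \<Rightarrow>\<^sub>0 complex)" where
  "bword w \<equiv> word (map basis_elt w)"

lemma outside_sub_basis:
  "a \<notin> sub_basis q \<longleftrightarrow> (\<exists>i. a = LB (- int i - 1)) \<or> (\<exists>i. a = QB (- int i))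
     \<or> (\<exists>i. a = MB (- int q - int i - 1))"
proof (cases a)
  case (LB n)
  have "n < 0 \<longleftrightarrow> (\<exists>i. n = - int i - 1)" by presburger
  then show ?thesis using LB by (auto simp: sub_basis_def)
next
  case (MB n)
  have "n < - int q \<longleftrightarrow> (\<exists>i. n = - int q - int i - 1)" by presburger
  then show ?thesis using MB by (auto simp: sub_basis_def)
next
  case (QB n)
  have "n < 1 \<longleftrightarrow> (\<exists>i. n = - int i)" by presburger
  then show ?thesis using QB by (auto simp: sub_basis_def)
qed (auto simp: sub_basis_def)

lemma ex_sorted_wrt_ge: "\<exists>ys::nat list. mset ys = mset xs \<and> sorted_wrt (\<ge>) ys"
  by (rule exI[of _ "rev (sort xs)"]) (simp add: sorted_wrt_rev)

text \<open>This only rearranges letters, so odd ones may still repeat. Repetitions are removed in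
  \<open>G_eq_UNIV\<close>, where words can be rewritten modulo the ideal.\<close>

lemma negative_word_normal_form:
  assumes "set w \<inter> sub_basis q = {}"
  shows "\<exists>c b a. mset w = mset (pbw_word q (c, b, a)) \<and> sorted_wrt (\<ge>) c \<and> sorted_wrt (\<ge>) b
    \<and> sorted_wrt (\<ge>) a"
proof -
  have "\<exists>c b a. mset w = mset (pbw_word q (c, b, a))"
    using assms
  proof (induction w)
    case Nil
    then show ?case by (intro exI[of _ "[]"]) simp
  next
    case (Cons x w)
    then obtain c b a where w: "mset w = mset (pbw_word q (c, b, a))" by auto
    have "x \<notin> sub_basis q" using Cons.prems by auto
    then consider i where "x = LB (- int i - 1)" | i where "x = QB (- int i)"
      | i where "x = MB (- int q - int i - 1)"
      unfolding outside_sub_basis by blast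
    then show ?case
    proof cases
      case (1 i)
      then show ?thesis using w by (intro exI[of _ "i # c"] exI[of _ b] exI[of _ a]) simp
    next
      case (2 i)
      then show ?thesis using w by (intro exI[of _ c] exI[of _ "i # b"] exI[of _ a]) simp
    next
      case (3 i)
      then show ?thesis using w by (intro exI[of _ c] exI[of _ b] exI[of _ "i # a"]) simp
    qed
  qed
  then obtain c b a where w: "mset w = mset (pbw_word q (c, b, a))" by blast
  obtain c' b' a' where "mset c' = mset c" "sorted_wrt (\<ge>) c'" "mset b' = mset b" "sorted_wrt (\<ge>) b'"
    "mset a' = mset a" "sorted_wrt (\<ge>) a'" using ex_sorted_wrt_ge by metis
  then show ?thesis using w by (intro exI[of _ c'] exI[of _ b'] exI[of _ a']) simp
qed

text \<open>In a sorted list equal entries are neighbours.\<close>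

lemma sorted_wrt_ge_imp_gt_or_dup:
  "sorted_wrt (\<ge>) (b :: nat list) \<Longrightarrow> sorted_wrt (>) b \<or> (\<exists>u x w. b = u @ x # x # w)"
proof (induction b)
  case (Cons y b)
  then consider "sorted_wrt (>) b" | "\<exists>u x w. b = u @ x # x # w" by auto
  then show ?case
  proof cases
    case 1
    show ?thesis
    proof (cases b)
      case (Cons z b')
      then show ?thesis using 1 \<open>sorted_wrt (\<ge>) (y # b)\<close>
        by (cases "y = z") (auto intro: exI[of _ "[]"])
    qed auto
  next
    case 2
    then show ?thesis by (metis append_Cons)
  qed
qed simp

text \<open>Such a subspace is everything. By induction on the length, adjacent letters of a word may be exchanged modulo
  shorter words, so the letters from the subalgebra can be moved to the right end and split off, and a repeated odd
  letter can be replaced by half its bracket with itself.\<close>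

locale pbw_closed =
  fixes G :: "(bms list \<Rightarrow>\<^sub>0 complex) set" and q :: nat
  assumes subspace_G: "pm.subspace G"
    and ideal_G: "env_ideal UNIV \<subseteq> G"
    and right_G: "f \<in> G \<Longrightarrow> y \<in> sub_basis q \<Longrightarrow> fmul f (word [basis_elt y]) \<in> G"
    and pbw_G: "p \<in> pbw_index \<Longrightarrow> bword (pbw_word q p) \<in> G"
begin

lemma cong_G: "f - g \<in> env_ideal UNIV \<Longrightarrow> g \<in> G \<Longrightarrow> f \<in> G"
  using pm.subspace_add[OF subspace_G, of "f - g" g] ideal_G by auto

text \<open>Letters of a word are arbitrary elements of the superalgebra. They are expanded in the
  basis one at a time from the left; \<open>ws\<close> is the part already expanded.\<close>

lemma words_from_basis_words:
  assumes "\<And>w. length w = n \<Longrightarrow> bword w \<in> G" and "length (map basis_elt ws @ xs) = n"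
  shows "word (map basis_elt ws @ xs) \<in> G"
  using assms(2)
proof (induction xs arbitrary: ws)
  case Nil
  then show ?case using assms(1) by simp
next
  case (Cons x xs)
  show ?case
  proof (induction x rule: bms_induct)
    case (add x y)
    then have "word (map basis_elt ws @ x # xs) + word (map basis_elt ws @ y # xs) \<in> G"
      by (rule pm.subspace_add[OF subspace_G])
    then show ?case
      using cong_G[OF word_add[of "map basis_elt ws" x y xs, unfolded diff_diff_add]] by simp
  next
    case (scale c x)
    then show ?case
      using cong_G[OF word_cscale] pm.subspace_scale[OF subspace_G] by blast
  next
    case (basis a)
    show ?case using Cons.IH[of "ws @ [a]"] Cons.prems by simp
  qed
qed

lemma swap_G:
  assumes shorter: "\<And>xs. length xs < n \<Longrightarrow> word xs \<in> G"
    and "length (u @ x # y # w) = n" and "bword (u @ y # x # w) \<in> G"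
  shows "bword (u @ x # y # w) \<in> G"
proof -
  let ?u = "map basis_elt u" and ?w = "map basis_elt w"
  \<comment> \<open>The bracket fills a single letter, whatever its expansion in the basis, so this
    word is shorter by one.\<close>
  have "word (?u @ bms_bracket (basis_elt x) (basis_elt y) # ?w) \<in> G"
    using assms by auto
  moreover have "pscale (parity_sign (basis_parity x) (basis_parity y)) (bword (u @ y # x # w)) \<in> G"
    by (rule pm.subspace_scale[OF subspace_G assms(3)])
  ultimately show ?thesis
    using cong_G word_commute[OF basis_elt_part basis_elt_part, of ?u x y ?w] pm.subspace_add[OF subspace_G]
    by (simp add: diff_diff_add)
qed

lemma move_front_G:
  assumes shorter: "\<And>xs. length xs < n \<Longrightarrow> word xs \<in> G"
    and "length (u @ xs @ x # w) = n" and "bword (u @ x # xs @ w) \<in> G"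
  shows "bword (u @ xs @ x # w) \<in> G"
  using assms(2,3)
proof (induction xs arbitrary: u)
  case (Cons y xs)
  have "bword (u @ y # x # xs @ w) \<in> G"
    using swap_G[OF shorter, where u = u and x = y and y = x and w = "xs @ w" and n = n] Cons.prems by simp
  then show ?case using Cons.IH[of "u @ [y]"] Cons.prems by simp
qed simp

lemma perm_G:
  assumes shorter: "\<And>xs. length xs < n \<Longrightarrow> word xs \<in> G"
    and "length (u @ w) = n" and "mset w = mset w'" and "bword (u @ w') \<in> G"
  shows "bword (u @ w) \<in> G"
  using assms(2-)
proof (induction w' arbitrary: u w)
  case (Cons x w')
  then obtain xs ys where w: "w = xs @ x # ys"
    by (metis list.set_intros(1) mset_eq_setD split_list)
  have "bword ((u @ [x]) @ (xs @ ys)) \<in> G"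
    by (rule Cons.IH) (use Cons.prems w in auto)
  then show ?case using move_front_G[OF shorter, of n u xs x ys] Cons.prems w by simp
qed simp

theorem G_eq_UNIV: "G = UNIV"
proof -
  have words: "word xs \<in> G" for xs
  proof (induction "length xs" arbitrary: xs rule: less_induct)
    case less
    let ?n = "length xs"
    have shorter: "\<And>ys. length ys < ?n \<Longrightarrow> word ys \<in> G" using less by blast
    have "bword w \<in> G" if w: "length w = ?n" for w
    proof (cases "set w \<inter> sub_basis q = {}")
      case False
      then obtain w1 y w2 where y: "w = w1 @ y # w2" "y \<in> sub_basis q" by (meson disjoint_iff split_list)
      have "bword ((w1 @ w2) @ [y]) \<in> G"
        using right_G[of "bword (w1 @ w2)" y] y w shorter by auto
      then show ?thesis
        using perm_G[OF shorter, of ?n "[]" w "(w1 @ w2) @ [y]"] w y by simp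
    next
      case True
      from negative_word_normal_form[OF this] obtain c b a
        where cba: "mset w = mset (pbw_word q (c, b, a))" "sorted_wrt (\<ge>) c" "sorted_wrt (\<ge>) b"
          "sorted_wrt (\<ge>) a" by blast
      have "bword (pbw_word q (c, b, a)) \<in> G"
      proof (cases "sorted_wrt (>) b")
        case True
        then show ?thesis using cba pbw_G[of "(c, b, a)"] by (auto simp: pbw_index_def)
      next
        case False
        then obtain u x v where b: "b = u @ x # x # v"
          using sorted_wrt_ge_imp_gt_or_dup[OF cba(3)] by blast
        define u' where "u' = map (\<lambda>i. LB (- int i - 1)) c @ map (\<lambda>i. QB (- int i)) u"
        define v' where "v' = map (\<lambda>i. QB (- int i)) v @ map (\<lambda>i. MB (- int q - int i - 1)) a"
        let ?x = "basis_elt (QB (- int x))"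
        let ?f = "word (map basis_elt u' @ ?x # ?x # map basis_elt v')"
        have e: "pbw_word q (c, b, a) = u' @ QB (- int x) # QB (- int x) # v'"
          by (simp add: b u'_def v'_def)
        have "length (u' @ QB (- int x) # QB (- int x) # v') = ?n"
          using w mset_eq_length[OF cba(1)] e by metis
        then have "word (map basis_elt u' @ bms_bracket ?x ?x # map basis_elt v') \<in> G"
          using shorter by simp
        \<comment> \<open>For an odd letter x paired with itself the sign is -1, and the relation
          reads xx + xx = [x, x].\<close>
        moreover have "?f + ?f - word (map basis_elt u' @ bms_bracket ?x ?x # map basis_elt v') \<in> env_ideal UNIV"
          using word_commute[OF basis_elt_part basis_elt_part, of "map basis_elt u'" "QB (- int x)" "QB (- int x)"]
          by (simp add: parity_sign_def single_uminus)
        ultimately have "?f + ?f \<in> G" by (rule cong_G[rotated])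
        then have "pscale (1/2) (?f + ?f) \<in> G" by (rule pm.subspace_scale[OF subspace_G])
        then show ?thesis
          using e by (simp flip: single_add)
      qed
      then show ?thesis
        using perm_G[OF shorter, of ?n "[]" w "pbw_word q (c, b, a)"] w cba by simp
    qed
    then show ?case using words_from_basis_words[of ?n "[]" xs] by simp
  qed
  have "f \<in> G" for f
  proof (induction f rule: poly_mapping_induct_add)
    case (single k c)
    then show ?case using pm.subspace_scale[OF subspace_G words, of c k] by simp
  qed (rule pm.subspace_add[OF subspace_G])
  then show ?thesis by blast
qed

end

section \<open>Linear independence by lowering operators\<close>

text \<open>Apply the lowering operator belonging to the largest letter \<open>p\<close> that occurs: it strips one \<open>p\<close> from the words
  starting with \<open>p\<close> and maps all other words into the next smaller part of the filtration.\<close>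

lemma words_independent:
  fixes x y :: "nat \<Rightarrow> 'e \<Rightarrow> 'e::ab_group_add" and F :: "nat \<Rightarrow> 'e set"
    and C :: "nat \<Rightarrow> nat list set" and V :: "'e set"
  assumes x_add: "\<And>i u v. x i (u + v) = x i u + x i v"
    and y_add: "\<And>i u v. y i (u + v) = y i u + y i v"
    and F_0: "\<And>k. 0 \<in> F k" and F_diff: "\<And>k u v. u \<in> F k \<Longrightarrow> v \<in> F k \<Longrightarrow> u - v \<in> F k"
    and y_F: "\<And>k p u. u \<in> F (Suc k) \<Longrightarrow> y p u \<in> F k"
    and C_0: "C 0 \<subseteq> {[]}" and C_Nil: "\<And>k. [] \<in> C k \<Longrightarrow> F k = {0}"
    and C_sorted: "\<And>k c. c \<in> C k \<Longrightarrow> sorted_wrt (\<ge>) c"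
    and C_tl: "\<And>k p c. p # c \<in> C (Suc k) \<Longrightarrow> c \<in> C k"
    and y_head: "\<And>k p c v. p # c \<in> C (Suc k) \<Longrightarrow> v \<in> V \<Longrightarrow>
      \<exists>v'\<in>V. (v' = 0 \<longrightarrow> v = 0) \<and> y p (foldr x (p # c) v) - foldr x c v' \<in> F k"
    and y_other: "\<And>k p c v. c \<in> C (Suc k) \<Longrightarrow> \<forall>i\<in>set c. i < p \<Longrightarrow> v \<in> V \<Longrightarrow> y p (foldr x c v) \<in> F k"
  shows "finite A \<Longrightarrow> A \<subseteq> C k \<Longrightarrow> \<forall>c\<in>A. v c \<in> V \<Longrightarrow> (\<Sum>c\<in>A. foldr x c (v c)) \<in> F k \<Longrightarrow> \<forall>c\<in>A. v c = 0"
proof -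
  have F_add: "u + v \<in> F k" if "u \<in> F k" "v \<in> F k" for u v k
    using F_diff[OF that(1) F_diff[OF F_0 that(2)]] by simp
  have F_sum: "sum f B \<in> F k" if "\<And>b. b \<in> B \<Longrightarrow> f b \<in> F k" for f B k
    using that by (induction B rule: infinite_finite_induct) (auto intro: F_0 F_add)
  have x_0: "x i 0 = 0" and y_0: "y i 0 = 0" for i
    using x_add[of i 0 0] y_add[of i 0 0] by simp_all
  have y_sum: "y p (sum f B) = (\<Sum>b\<in>B. y p (f b))" for p f B
    by (induction B rule: infinite_finite_induct) (simp_all add: y_0 y_add)
  have word_0: "foldr x c 0 = 0" for c by (induction c) (simp_all add: x_0)
  have only_Nil: "v [] = 0" if "[] \<in> C k" "v [] \<in> F k" for k and v :: "nat list \<Rightarrow> 'e"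
    using C_Nil[OF that(1)] that(2) by simp
  show "finite A \<Longrightarrow> A \<subseteq> C k \<Longrightarrow> \<forall>c\<in>A. v c \<in> V \<Longrightarrow> (\<Sum>c\<in>A. foldr x c (v c)) \<in> F k \<Longrightarrow> \<forall>c\<in>A. v c = 0"
  proof (induction k arbitrary: A v)
    case 0
    then have "A = {} \<or> A = {[]}" using C_0 by auto
    then show ?case using 0 only_Nil by auto
  next
    case (Suc k)
    \<comment> \<open>With zero coefficients dropped, it suffices to find one word whose coefficient
      vanishes, and the largest letter p below really occurs.\<close>
    define A' where "A' = {c \<in> A. v c \<noteq> 0}"
    have A': "finite A'" "A' \<subseteq> C (Suc k)" "\<forall>c\<in>A'. v c \<in> V"
      using Suc.prems by (auto simp: A'_def)
    have sum_A': "(\<Sum>c\<in>A'. foldr x c (v c)) \<in> F (Suc k)"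
    proof -
      have "(\<Sum>c\<in>A'. foldr x c (v c)) = (\<Sum>c\<in>A. foldr x c (v c))"
        using Suc.prems(1) by (intro sum.mono_neutral_left) (auto simp: A'_def word_0)
      then show ?thesis using Suc.prems by simp
    qed
    have "A' = {}"
    proof (rule ccontr)
      assume "A' \<noteq> {}"
      define S where "S = (\<Union>c\<in>A'. set c)"
      have finS: "finite S" using A' by (simp add: S_def)
      show False
      proof (cases "S = {}")
        case True
        \<comment> \<open>No letter occurs. By \<open>C_Nil\<close> the filtration is zero at every
          stage that admits the empty word, so the remaining coefficient vanishes outright.\<close>
        then have "A' = {[]}" using \<open>A' \<noteq> {}\<close> by (auto simp: S_def)
        then have "v [] = 0" using only_Nil A' sum_A' by simp
        then show False using \<open>A' = {[]}\<close> by (auto simp: A'_def)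
      next
        case False
        define p where "p = Max S"
        have p: "p \<in> S" "\<And>i. i \<in> S \<Longrightarrow> i \<le> p" using finS False by (auto simp: p_def)
        define B where "B = {c. p # c \<in> A'}"
        have B_image: "(#) p ` B \<subseteq> A'" by (auto simp: B_def)
        have finB: "finite B" using finite_subset[OF B_image A'(1)] by (simp add: finite_image_iff)
        \<comment> \<open>Words are decreasing, so a word that contains the largest letter p begins
          with it.\<close>
        have others: "\<forall>i\<in>set c. i < p" if "c \<in> A' - (#) p ` B" for c
        proof (cases c)
          case (Cons h c')
          have "h \<noteq> p" using that Cons by (auto simp: B_def)
          moreover have "h \<le> p" using that Cons by (intro p(2)) (auto simp: S_def intro!: bexI[of _ c])
          moreover have "\<forall>i\<in>set c'. i \<le> h" using C_sorted[of c "Suc k"] that A'(2) Cons by auto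
          ultimately show ?thesis using Cons by auto
        qed simp
        have "B \<noteq> {}"
        proof -
          obtain c where "c \<in> A'" "p \<in> set c" using p(1) by (auto simp: S_def)
          then show ?thesis using others[of c] by blast
        qed
        have "\<forall>c\<in>B. \<exists>v'\<in>V. (v' = 0 \<longrightarrow> v (p # c) = 0) \<and> y p (foldr x (p # c) (v (p # c))) - foldr x c v' \<in> F k"
          using A' y_head by (auto simp: B_def)
        then obtain v' where v': "\<And>c. c \<in> B \<Longrightarrow> v' c \<in> V" "\<And>c. c \<in> B \<Longrightarrow> v' c = 0 \<Longrightarrow> v (p # c) = 0"
          "\<And>c. c \<in> B \<Longrightarrow> y p (foldr x (p # c) (v (p # c))) - foldr x c (v' c) \<in> F k" by metis
        \<comment> \<open>s is the lowered sum, r the contribution of the words without p, and d the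
          total error of the stripping. All three lie in \<open>F k\<close>, so the combination s -
          r - d of the stripped words does too, and the induction hypothesis applies to it.\<close>
        define s where "s = (\<Sum>c\<in>A'. y p (foldr x c (v c)))"
        define r where "r = (\<Sum>c\<in>A' - (#) p ` B. y p (foldr x c (v c)))"
        define h where "h = (\<Sum>c\<in>B. y p (foldr x (p # c) (v (p # c))))"
        define d where "d = (\<Sum>c\<in>B. y p (foldr x (p # c) (v (p # c))) - foldr x c (v' c))"
        have "r \<in> F k" unfolding r_def using A' others by (intro F_sum y_other) auto
        moreover have "s \<in> F k" using y_F[OF sum_A', of p] by (simp add: y_sum s_def)
        moreover have "s = r + h"
          unfolding s_def r_def h_def by (subst sum.subset_diff[OF B_image A'(1)]) (simp add: sum.reindex)
        moreover have "d \<in> F k" unfolding d_def using v' by (intro F_sum) auto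
        ultimately have "s - r - d \<in> F k" by (intro F_diff)
        moreover have "s - r - d = (\<Sum>c\<in>B. foldr x c (v' c))"
          using \<open>s = r + h\<close> by (simp add: h_def d_def sum_subtractf)
        ultimately have "(\<Sum>c\<in>B. foldr x c (v' c)) \<in> F k" by simp
        moreover have "B \<subseteq> C k" using C_tl A'(2) unfolding B_def by blast
        ultimately have "\<forall>c\<in>B. v' c = 0" by (intro Suc.IH finB ballI v'(1))
        moreover obtain c where "c \<in> B" using \<open>B \<noteq> {}\<close> by blast
        ultimately have "v (p # c) = 0" "p # c \<in> A'" using v'(2) by (auto simp: B_def)
        then show False by (simp add: A'_def)
      qed
    qed
    then show ?case by (auto simp: A'_def)
  qed
qed

lemma foldr_commute_op:
  assumes "\<And>i e. f (x i e) = x i (f e)"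
  shows "f (foldr x c e) = foldr x c (f e)"
  using assms by (induction c) simp_all

section \<open>Representations on a vector space\<close>

text \<open>The superalgebra acting on a vector space that is a type. \<open>U\<close> is the image
  of the module; vectors are always taken from it, because elsewhere the operators may have a kernel
  unrelated to the module. \<open>LL\<close> covers m + n \<noteq> 0, where no central term occurs,
  so \<open>Z2\<close> is the only central operator carried along.\<close>

locale bms_rep = vector_space scale
  for scale :: "complex \<Rightarrow> 'e::ab_group_add \<Rightarrow> 'e" (infixr "*s" 75) +
  fixes L M Q :: "int \<Rightarrow> 'e \<Rightarrow> 'e" and Z2 :: "'e \<Rightarrow> 'e" and U :: "'e set"
  assumes linear_L: "Vector_Spaces.linear (*s) (*s) (L n)" and linear_M: "Vector_Spaces.linear (*s) (*s) (M n)"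
    and linear_Q: "Vector_Spaces.linear (*s) (*s) (Q n)" and linear_Z2: "Vector_Spaces.linear (*s) (*s) Z2"
    and LL: "m + n \<noteq> 0 \<Longrightarrow> L m (L n e) = L n (L m e) + of_int (m - n) *s L (m + n) e"
    and LM: "L m (M n e) = M n (L m e) + of_int (m - n) *s M (m + n) e
        + (if m + n = 0 then (of_int (m^3 - m) / 12) *s Z2 e else 0)"
    and MM: "M m (M n e) = M n (M m e)"
    and QQ: "Q k (Q l e) = - Q l (Q k e) + 2 *s M (k + l - 1) e
        + (if k + l - 1 = 0 then (1/3 * ((half_idx k)^2 - 1/4)) *s Z2 e else 0)"
    and LQ: "L m (Q k e) = Q k (L m e) + (of_int m / 2 - half_idx k) *s Q (m + k) e"
    and MQ: "M m (Q k e) = Q k (M m e)"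
    and Z2L: "Z2 (L n e) = L n (Z2 e)" and Z2M: "Z2 (M n e) = M n (Z2 e)" and Z2Q: "Z2 (Q n e) = Q n (Z2 e)"
    and subspace_U: "subspace U"
    and U_closed: "e \<in> U \<Longrightarrow> L n e \<in> U" "e \<in> U \<Longrightarrow> M n e \<in> U" "e \<in> U \<Longrightarrow> Q n e \<in> U" "e \<in> U \<Longrightarrow> Z2 e \<in> U"
begin

sublocale L: Vector_Spaces.linear scale scale "L n" for n by (rule linear_L)
sublocale M: Vector_Spaces.linear scale scale "M n" for n by (rule linear_M)
sublocale Q: Vector_Spaces.linear scale scale "Q n" for n by (rule linear_Q)
sublocale Z2: Vector_Spaces.linear scale scale Z2 by (rule linear_Z2)

text \<open>The conditions that define V, imposed in three steps. The larger spaces receive the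
  coefficients of partial monomials: M-words keep \<open>level2\<close> stable and Q-words keep
  \<open>level1\<close> stable.\<close>

definition level1 :: "nat \<Rightarrow> 'e set" where
  "level1 t = {e \<in> U. \<forall>i > int t. M i e = 0}"

definition level2 :: "nat \<Rightarrow> 'e set" where
  "level2 t = {e \<in> level1 t. \<forall>k > int t. Q k e = 0}"

definition level3 :: "nat \<Rightarrow> nat \<Rightarrow> 'e set" where
  "level3 t q = {e \<in> level2 t. \<forall>j > int t + int q. L j e = 0}"

text \<open>Up to a nonzero scalar, this is the bracket of a lowering operator with the raising operator it is
  paired with.\<close>

definition top_M :: "nat \<Rightarrow> int \<Rightarrow> 'e \<Rightarrow> 'e" where
  "top_M t n e = M (int t) e + (if t = 0 then (of_int (n^2 - 1) / 24) *s Z2 e else 0)"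

lemmas lin_simps = L.add L.scale L.zero L.diff M.add M.scale M.zero M.diff Q.add Q.scale Q.zero Q.diff
  Z2.add Z2.scale Z2.zero Z2.diff

lemma subspace_levels: "subspace (level1 t)" "subspace (level2 t)" "subspace (level3 t q)"
  using subspace_U unfolding level1_def level2_def level3_def subspace_def
  by (auto simp: lin_simps)

lemma level1_closed:
  assumes "e \<in> level1 t"
  shows "M n e \<in> level1 t" "Q n e \<in> level1 t" "Z2 e \<in> level1 t" "n \<ge> 0 \<Longrightarrow> L n e \<in> level1 t"
proof -
  have "M i (L n e) = 0" if "n \<ge> 0" "i > int t" for i
    using LM[of n i e] assms that by (simp add: level1_def lin_simps)
  then show "n \<ge> 0 \<Longrightarrow> L n e \<in> level1 t" using assms U_closed by (auto simp: level1_def)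
qed (use assms in \<open>auto simp: level1_def U_closed MM[of _ n] MQ lin_simps simp flip: Z2M\<close>)

text \<open>For k > t and n \<ge> 1 the bracket of \<open>Q k\<close> with \<open>Q n\<close> is 2M
  with index k + n - 1 > t, which kills the vector; the index is positive, so there is no central
  term.\<close>

lemma level2_closed:
  assumes "e \<in> level2 t"
  shows "M n e \<in> level2 t" "n \<ge> 1 \<Longrightarrow> Q n e \<in> level2 t" "Z2 e \<in> level2 t" "n \<ge> 0 \<Longrightarrow> L n e \<in> level2 t"
proof -
  note e1 = level1_closed[of e t]
  have e: "e \<in> level1 t" "\<And>k. k > int t \<Longrightarrow> Q k e = 0" "\<And>k. k > int t \<Longrightarrow> M k e = 0"
    using assms by (auto simp: level2_def level1_def)
  show "M n e \<in> level2 t" "Z2 e \<in> level2 t"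
    using e e1 by (auto simp: level2_def lin_simps simp flip: MQ Z2Q)
  show "Q n e \<in> level2 t" if "n \<ge> 1"
    using e e1 that QQ[of _ n e] by (auto simp: level2_def lin_simps)
  show "L n e \<in> level2 t" if "n \<ge> 0"
  proof -
    have "Q k (L n e) = 0" if "k > int t" for k
      using LQ[of n k e] e that \<open>n \<ge> 0\<close> by (simp add: lin_simps)
    then show ?thesis using e1 e that by (auto simp: level2_def)
  qed
qed

text \<open>Here q is tied to the subalgebra: the bracket of L_k with M_n is a multiple of M_(k+n),
  and k > t + q together with n \<ge> -q forces k + n > t.\<close>

lemma level3_closed:
  assumes "e \<in> level3 t q"
  shows "n \<ge> - int q \<Longrightarrow> M n e \<in> level3 t q" "n \<ge> 1 \<Longrightarrow> Q n e \<in> level3 t q"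
    "Z2 e \<in> level3 t q" "n \<ge> 0 \<Longrightarrow> L n e \<in> level3 t q"
proof -
  note e2 = level2_closed[of e t]
  have e: "e \<in> level2 t" "\<And>k. k > int t + int q \<Longrightarrow> L k e = 0" "\<And>k. k > int t \<Longrightarrow> Q k e = 0" "\<And>k. k > int t \<Longrightarrow> M k e = 0"
    using assms by (auto simp: level3_def level2_def level1_def)
  show "M n e \<in> level3 t q" if "n \<ge> - int q"
    using e e2 that LM[of _ n e] by (auto simp: level3_def lin_simps)
  show "Z2 e \<in> level3 t q"
    using e e2 by (auto simp: level3_def lin_simps simp flip: Z2L)
  show "Q n e \<in> level3 t q" if "n \<ge> 1"
    using e e2 that LQ[of _ n e] by (auto simp: level3_def lin_simps)
  show "L n e \<in> level3 t q" if "n \<ge> 0"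
    using e e2 that LL[of _ n e] by (auto simp: level3_def lin_simps)
qed

abbreviation Lword :: "nat list \<Rightarrow> 'e \<Rightarrow> 'e" where "Lword \<equiv> foldr (\<lambda>i. L (- int i - 1))"
abbreviation Qword :: "nat list \<Rightarrow> 'e \<Rightarrow> 'e" where "Qword \<equiv> foldr (\<lambda>i. Q (- int i))"
abbreviation Mword :: "nat \<Rightarrow> nat list \<Rightarrow> 'e \<Rightarrow> 'e" where "Mword q \<equiv> foldr (\<lambda>i. M (- int q - int i - 1))"

lemma word_linear:
  "Lword c (u + v) = Lword c u + Lword c v" "Lword c (a *s u) = a *s Lword c u" "Lword c 0 = 0"
  "Qword c (u + v) = Qword c u + Qword c v" "Qword c (a *s u) = a *s Qword c u" "Qword c 0 = 0"
  "Mword q c (u + v) = Mword q c u + Mword q c v" "Mword q c (a *s u) = a *s Mword q c u" "Mword q c 0 = 0"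
  by (induction c) (simp_all add: lin_simps)

lemma scale_Suc: "of_nat (Suc k) *s w = of_nat k *s w + w"
  by (simp add: scale_left_distrib add.commute)

lemma word_diff: "Lword c (u - v) = Lword c u - Lword c v"
  by (induction c) (simp_all add: lin_simps)

end

text \<open>Injectivity is required on \<open>level1 t\<close> and not only on
  \<open>level3 t q\<close>, because the coefficients of L-words lie in
  \<open>level1 t\<close>.\<close>

locale bms_rep_level = bms_rep scale L M Q Z2 U
  for scale :: "complex \<Rightarrow> 'e::ab_group_add \<Rightarrow> 'e" (infixr "*s" 75)
    and L M Q :: "int \<Rightarrow> 'e \<Rightarrow> 'e" and Z2 :: "'e \<Rightarrow> 'e" and U :: "'e set" +
  fixes t q :: nat
  assumes top_M_inj: "n \<noteq> 0 \<Longrightarrow> e \<in> level1 t \<Longrightarrow> top_M t n e = 0 \<Longrightarrow> e = 0"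
begin

text \<open>The anticommutator of the lowering operator \<open>Q (int t + int p + 1)\<close> with
  the raising operator \<open>Q (- int i)\<close>. Its index t + p - i exceeds t for i < p and
  equals t for i = p, which is why lowering and raising operators with the same number are
  paired.\<close>

definition brQ :: "nat \<Rightarrow> nat \<Rightarrow> 'e \<Rightarrow> 'e" where
  "brQ p i e = 2 *s M (int t + int p - int i) e
     + (if int t + int p - int i = 0 then (1/3 * ((half_idx (int t + int p + 1))^2 - 1/4)) *s Z2 e else 0)"

lemma Q_lower: "Q (int t + int p + 1) (Q (- int i) e) = - Q (- int i) (Q (int t + int p + 1) e) + brQ p i e"
proof -
  have "int t + int p + 1 + - int i - 1 = int t + int p - int i" by simp
  then show ?thesis
    unfolding brQ_def QQ[of "int t + int p + 1" "- int i" e] by (simp only: add.assoc)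
qed

text \<open>For t = 0 put r = p + 1/2 and n = 2r; then (r^2 - 1/4)/3 = 2 (n^2 - 1)/24. The odd
  brackets use the shifts of M_0 with odd n.\<close>

lemma brQ_top: "brQ p p e = 2 *s top_M t (2 * int p + 1) e"
proof -
  have "1/3 * ((half_idx (int t + int p + 1))\<^sup>2 - 1/4) = 2 * (of_int ((2 * int p + 1)^2 - 1) / 24)" if "t = 0"
    using that by (simp add: half_idx_def power2_eq_square field_simps)
  then have *: "(if int t + int p - int p = 0 then (1/3 * ((half_idx (int t + int p + 1))^2 - 1/4)) *s Z2 e else 0)
    = 2 *s (if t = 0 then (of_int ((2 * int p + 1)^2 - 1) / 24) *s Z2 e else 0)"
    by (simp del: of_int_diff)
  show ?thesis
    unfolding brQ_def top_M_def * by (simp add: scale_right_distrib)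
qed

lemma level2_level1: "v \<in> level2 t \<Longrightarrow> v \<in> level1 t"
  by (simp add: level2_def)

lemma brQ_level2:
  assumes "v \<in> level2 t"
  shows "brQ p i v \<in> level2 t" "i < p \<Longrightarrow> brQ p i v = 0" "brQ p p v = 0 \<Longrightarrow> v = 0"
proof -
  show "brQ p i v \<in> level2 t"
    using level2_closed[OF assms] subspace_levels[of t]
    by (auto simp: brQ_def intro!: subspace_add subspace_scale subspace_0)
  show "i < p \<Longrightarrow> brQ p i v = 0"
    using assms by (auto simp: brQ_def level2_def level1_def)
  show "brQ p p v = 0 \<Longrightarrow> v = 0"
    using assms top_M_inj[of "2 * int p + 1" v] by (auto simp: brQ_top level2_def)
qed

lemma brQ_Qword: "brQ p i (Qword c e) = Qword c (brQ p i e)"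
  by (rule foldr_commute_op) (simp add: brQ_def lin_simps MQ Z2Q)

lemma Q_lower_Qword:
  assumes "\<forall>i\<in>set c. i < p" "v \<in> level2 t"
  shows "Q (int t + int p + 1) (Qword c v) = 0"
  using assms
proof (induction c)
  case (Cons i c)
  then show ?case using brQ_level2 by (simp add: Q_lower brQ_Qword lin_simps word_linear)
qed (simp add: level2_def)

text \<open>In a strictly decreasing word only letters below p follow the first letter p. The
  lowering operator passes these with a sign and then kills the vector, so stripping p leaves no
  error and the filtration can be zero.\<close>

lemma Qword_independent:
  assumes "finite A" "\<forall>c\<in>A. sorted_wrt (>) c" "\<forall>c\<in>A. v c \<in> level2 t" "(\<Sum>c\<in>A. Qword c (v c)) = 0"
  shows "\<forall>c\<in>A. v c = 0"
proof -
  define k where "k = Max (insert 0 (length ` A))"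
  have len: "length c \<le> k" if "c \<in> A" for c using that assms(1) by (auto simp: k_def)
  show ?thesis
  proof (rule words_independent[where x = "\<lambda>i. Q (- int i)" and y = "\<lambda>p. Q (int t + int p + 1)"
        and F = "\<lambda>k. {0}" and C = "\<lambda>k. {c. length c \<le> k \<and> sorted_wrt (>) c}" and V = "level2 t" and k = k])
    fix k p :: nat and c v assume *: "p # c \<in> {c. length c \<le> Suc k \<and> sorted_wrt (>) c}" "v \<in> level2 t"
    then show "\<exists>v'\<in>level2 t. (v' = 0 \<longrightarrow> v = 0) \<and>
            Q (int t + int p + 1) (Qword (p # c) v) - Qword c v' \<in> {0}"
      using brQ_level2[OF *(2), of p] Q_lower_Qword[of c p v]
      by (intro bexI[of _ "brQ p p v"]) (auto simp: Q_lower brQ_Qword lin_simps)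
  qed (use assms len Q_lower_Qword in \<open>auto simp: lin_simps intro: sorted_wrt_mono_rel[of _ "(>)"]\<close>)
qed

text \<open>For \<open>r = q\<close> this is the bracket of \<open>L (t + q + p + 1)\<close> with \<open>M (- q - i - 1)\<close>. For \<open>r = 0\<close> it is also the
  bracket of \<open>M (t + p + 1)\<close> with \<open>L (- i - 1)\<close>: the central terms agree because they only occur for \<open>i = t + p\<close>.\<close>

definition brM :: "nat \<Rightarrow> nat \<Rightarrow> nat \<Rightarrow> 'e \<Rightarrow> 'e" where
  "brM r p i e = of_int (int t + 2 * int r + int p + int i + 2) *s M (int t + int p - int i) e
     + (if int t + int p - int i = 0
        then (of_int ((int t + int r + int p + 1)^3 - (int t + int r + int p + 1)) / 12) *s Z2 e else 0)"

lemma L_lower: "L (int t + int q + int p + 1) (M (- int q - int i - 1) e)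
    = M (- int q - int i - 1) (L (int t + int q + int p + 1) e) + brM q p i e"
proof -
  have "int t + int q + int p + 1 + (- int q - int i - 1) = int t + int p - int i"
    "int t + int q + int p + 1 - (- int q - int i - 1) = int t + 2 * int q + int p + int i + 2" by simp_all
  then show ?thesis
    unfolding brM_def LM[of "int t + int q + int p + 1" "- int q - int i - 1" e] by (simp only: add.assoc)
qed

lemma M_lower: "M (int t + int p + 1) (L (- int i - 1) e) = L (- int i - 1) (M (int t + int p + 1) e) + brM 0 p i e"
proof -
  have *: "- int i - 1 + (int t + int p + 1) = int t + int p - int i"
    "- int i - 1 - (int t + int p + 1) = - (int t + 2 * int 0 + int p + int i + 2)" by simp_all
  \<comment> \<open>The polynomial m^3 - m is odd, and here \<open>- int i - 1\<close> is the
    negative of \<open>int t + int p + 1\<close>.\<close>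
  have c: "(of_int ((- int i - 1)^3 - (- int i - 1)) / 12 :: complex)
      = - (of_int ((int t + int 0 + int p + 1)^3 - (int t + int 0 + int p + 1)) / 12)"
    if "int t + int p - int i = 0"
  proof -
    have "- int i - 1 = - (int t + int p + 1)" using that by simp
    then show ?thesis by (simp only: power3_eq_cube) (simp add: field_simps)
  qed
  show ?thesis
    unfolding LM[of "- int i - 1" "int t + int p + 1" e] brM_def *
    by (cases "int t + int p - int i = 0") (simp_all only: c if_True if_False of_int_minus scale_minus_left, simp_all)
qed

text \<open>For t = 0 and n = r + p + 1 this is (n^3 - n)/12 = 2n (n^2 - 1)/24, the origin of the
  shift of M_0 in the hypothesis of the theorem. The factor t + 2n is positive, so the bracket is
  injective wherever \<open>top_M\<close> is.\<close>

lemma brM_top: "brM r p p e = of_int (int t + 2 * (int r + int p + 1)) *s top_M t (int r + int p + 1) e"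
proof -
  have "(of_int ((int t + int r + int p + 1)^3 - (int t + int r + int p + 1)) / 12 :: complex)
     = of_int (int t + 2 * (int r + int p + 1)) * (of_int ((int r + int p + 1)^2 - 1) / 24)" if "t = 0"
    using that by (simp add: power2_eq_square power3_eq_cube field_simps)
  then have *: "(if int t + int p - int p = 0
        then (of_int ((int t + int r + int p + 1)^3 - (int t + int r + int p + 1)) / 12) *s Z2 e else 0)
    = of_int (int t + 2 * (int r + int p + 1)) *s (if t = 0 then (of_int ((int r + int p + 1)^2 - 1) / 24) *s Z2 e else 0)"
    by (simp del: of_int_diff of_int_add)
  have "int t + 2 * int r + int p + int p + 2 = int t + 2 * (int r + int p + 1)" by simp
  then show ?thesis
    unfolding brM_def top_M_def * by (simp only: scale_right_distrib) simp
qed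

lemma brM_level1:
  assumes "v \<in> level1 t"
  shows "brM r p i v \<in> level1 t" "i < p \<Longrightarrow> brM r p i v = 0" "brM r p p v = 0 \<Longrightarrow> v = 0"
proof -
  show "brM r p i v \<in> level1 t"
    using level1_closed[OF assms] subspace_levels[of t]
    by (auto simp: brM_def intro!: subspace_add subspace_scale subspace_0)
  show "i < p \<Longrightarrow> brM r p i v = 0"
    using assms by (auto simp: brM_def level1_def)
  have "(of_int (int t + 2 * (int r + int p + 1)) :: complex) \<noteq> 0" unfolding of_int_eq_0_iff by simp
  then show "brM r p p v = 0 \<Longrightarrow> v = 0"
    using assms top_M_inj[of "int r + int p + 1" v] by (simp add: brM_top del: of_int_add of_int_mult)
qed

lemma brM_Mword: "brM r p i (Mword q c e) = Mword q c (brM r p i e)"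
  by (rule foldr_commute_op) (auto simp: brM_def lin_simps Z2M MM[of "int t + int p - int i"])

lemma level3_level1: "v \<in> level3 t q \<Longrightarrow> v \<in> level1 t"
  by (simp add: level3_def level2_def)

lemma brM_level3:
  assumes "v \<in> level3 t q"
  shows "brM r p p v \<in> level3 t q"
  using level3_closed[OF assms] subspace_levels(3)[of t q]
  by (auto simp: brM_def intro!: subspace_add subspace_scale subspace_0)

lemma L_lower_Mword:
  assumes "\<forall>i\<in>set c. i < p" "v \<in> level3 t q"
  shows "L (int t + int q + int p + 1) (Mword q c v) = 0"
  using assms
proof (induction c)
  case (Cons i c)
  then show ?case using brM_level1(2)[OF level3_level1] by (simp add: L_lower brM_Mword lin_simps word_linear)
qed (simp add: level3_def)

text \<open>Leibniz rule: every copy of p at the front contributes one bracket, and brackets commute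
  with the other letters. The factor \<open>Suc k\<close> counts the copies of p; it is nonzero in
  characteristic 0.\<close>

lemma L_lower_Mword_head:
  assumes "sorted_wrt (\<ge>) (p # c)" "v \<in> level3 t q"
  shows "\<exists>k::nat. L (int t + int q + int p + 1) (Mword q (p # c) v) = Mword q c (of_nat (Suc k) *s brM q p p v)"
  using assms(1)
proof (induction c)
  case Nil
  then show ?case using L_lower_Mword[OF _ assms(2), of "[]"]
    by (intro exI[of _ 0]) (simp add: L_lower lin_simps)
next
  case (Cons i c)
  let ?L = "L (int t + int q + int p + 1)" and ?M = "M (- int q - int p - 1)"
  have *: "?L (Mword q (p # i # c) v) = ?M (?L (Mword q (i # c) v)) + Mword q (i # c) (brM q p p v)"
    using L_lower[of p p "Mword q (i # c) v"] brM_Mword[of q p p "i # c" v] by simp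
  show ?case
  proof (cases "i = p")
    case True
    then obtain k where k: "?L (Mword q (p # c) v) = Mword q c (of_nat (Suc k) *s brM q p p v)"
      using Cons by auto
    have "?L (Mword q (p # i # c) v) = Mword q (i # c) (of_nat (Suc (Suc k)) *s brM q p p v)"
      unfolding * scale_Suc[of "Suc k"] using True k by (simp add: word_linear lin_simps del: of_nat_Suc)
    then show ?thesis by blast
  next
    case False
    then have "\<forall>j\<in>set (i # c). j < p" using Cons.prems by force
    from L_lower_Mword[OF this assms(2)] show ?thesis
      unfolding * by (intro exI[of _ 0]) (simp add: lin_simps)
  qed
qed

lemma Mword_independent:
  assumes "finite A" "\<forall>c\<in>A. sorted_wrt (\<ge>) c" "\<forall>c\<in>A. v c \<in> level3 t q" "(\<Sum>c\<in>A. Mword q c (v c)) = 0"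
  shows "\<forall>c\<in>A. v c = 0"
proof -
  define k where "k = Max (insert 0 (length ` A))"
  have len: "length c \<le> k" if "c \<in> A" for c using that assms(1) by (auto simp: k_def)
  show ?thesis
  proof (rule words_independent[where x = "\<lambda>i. M (- int q - int i - 1)" and y = "\<lambda>p. L (int t + int q + int p + 1)"
        and F = "\<lambda>k. {0}" and C = "\<lambda>k. {c. length c \<le> k \<and> sorted_wrt (\<ge>) c}" and V = "level3 t q" and k = k])
    fix k p :: nat and c v assume *: "p # c \<in> {c. length c \<le> Suc k \<and> sorted_wrt (\<ge>) c}" "v \<in> level3 t q"
    then obtain l where l: "L (int t + int q + int p + 1) (Mword q (p # c) v) = Mword q c (of_nat (Suc l) *s brM q p p v)"
      using L_lower_Mword_head by blast
    have "(of_nat (Suc l) :: complex) \<noteq> 0" by (simp del: of_nat_Suc)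
    then show "\<exists>v'\<in>level3 t q. (v' = 0 \<longrightarrow> v = 0) \<and>
            L (int t + int q + int p + 1) (Mword q (p # c) v) - Mword q c v' \<in> {0}"
      using l brM_level1(3)[OF level3_level1[OF *(2)], of q p] subspace_scale[OF subspace_levels(3) brM_level3[OF *(2)]]
      by (intro bexI[of _ "of_nat (Suc l) *s brM q p p v"]) (auto simp del: of_nat_Suc)
  qed (use assms len L_lower_Mword in \<open>auto simp: lin_simps\<close>)
qed

text \<open>Unlike the two other kinds of raising operators, the \<open>L (- i - 1)\<close> do not commute with the brackets \<^const>\<open>brM\<close>,
  but they do so up to words of smaller length.\<close>

definition Lfilt :: "nat \<Rightarrow> 'e set" where
  "Lfilt k = span {Lword c v | c v. length c < k \<and> v \<in> level1 t}"

lemma subspace_Lfilt: "subspace (Lfilt k)"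
  by (simp add: Lfilt_def)

lemma Lfilt_word: "length c < k \<Longrightarrow> v \<in> level1 t \<Longrightarrow> Lword c v \<in> Lfilt k"
  unfolding Lfilt_def by (intro span_base) blast

lemma Lfilt_0: "Lfilt 0 = {0}"
  by (simp add: Lfilt_def)

lemma Lfilt_mono: "j \<le> k \<Longrightarrow> Lfilt j \<subseteq> Lfilt k"
  unfolding Lfilt_def by (rule span_mono) (use order_less_le_trans in blast)

lemma linear_Lfilt:
  assumes "Vector_Spaces.linear (*s) (*s) f"
    and "\<And>c v. length c < k \<Longrightarrow> v \<in> level1 t \<Longrightarrow> f (Lword c v) \<in> S" and "subspace S" and "e \<in> Lfilt k"
  shows "f e \<in> S"
proof -
  interpret f: Vector_Spaces.linear scale scale f by (rule assms(1))
  have "Lfilt k \<subseteq> f -` S"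
    unfolding Lfilt_def using assms(2) by (intro span_minimal f.subspace_vimage assms(3)) auto
  then show ?thesis using assms(4) by auto
qed

lemma L_Lfilt: "e \<in> Lfilt k \<Longrightarrow> L (- int i - 1) e \<in> Lfilt (Suc k)"
  by (rule linear_Lfilt[OF linear_L _ subspace_Lfilt])
     (use Lfilt_word[of "i # c" "Suc k" for c] in auto)

lemma L_neg_word: "M n (L (- int i - 1) e) = L (- int i - 1) (M n e) + of_int (int i + 1 + n) *s M (n - int i - 1) e
    - (if n = int i + 1 then (of_int ((- int i - 1)^3 - (- int i - 1)) / 12) *s Z2 e else 0)"
proof -
  have "- int i - 1 + n = n - int i - 1" "- int i - 1 - n = - (int i + 1 + n)" "n - int i - 1 = 0 \<longleftrightarrow> n = int i + 1"
    by linarith+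
  then show ?thesis
    unfolding LM[of "- int i - 1" n e] by (simp only: of_int_minus scale_minus_left) simp
qed

text \<open>Commuting \<open>M n\<close> past a letter replaces that letter by another M or by a
  central operator, so a letter is lost. The index shifts on the way, hence the induction over all
  \<open>n\<close>; \<open>level1 t\<close> is stable under every operator that arises.\<close>

lemma M_Lword:
  assumes "v \<in> level1 t"
  shows "M n (Lword c v) - Lword c (M n v) \<in> Lfilt (length c)"
proof (induction c arbitrary: n)
  case Nil
  then show ?case by (simp add: Lfilt_0)
next
  case (Cons i c)
  have M_in: "M m (Lword c v) \<in> Lfilt (Suc (length c))" for m
  proof -
    have "M m (Lword c v) - Lword c (M m v) \<in> Lfilt (Suc (length c))"
      using Cons.IH Lfilt_mono[of "length c" "Suc (length c)"] by auto
    moreover have "Lword c (M m v) \<in> Lfilt (Suc (length c))"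
      using assms by (intro Lfilt_word level1_closed) auto
    ultimately show ?thesis using subspace_add[OF subspace_Lfilt] by fastforce
  qed
  have Z2_in: "Z2 (Lword c v) \<in> Lfilt (Suc (length c))"
    using assms by (subst foldr_commute_op) (auto intro: Lfilt_word level1_closed simp: Z2L)
  let ?z = "if n = int i + 1 then (of_int ((- int i - 1)^3 - (- int i - 1)) / 12) *s Z2 (Lword c v) else 0"
  have "M n (Lword (i # c) v) - Lword (i # c) (M n v) = L (- int i - 1) (M n (Lword c v) - Lword c (M n v))
      + of_int (int i + 1 + n) *s M (n - int i - 1) (Lword c v) - ?z"
    by (simp only: foldr.simps o_apply L_neg_word L.diff) simp
  moreover have "L (- int i - 1) (M n (Lword c v) - Lword c (M n v)) \<in> Lfilt (Suc (length c))"
    using Cons.IH by (rule L_Lfilt)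
  moreover have "?z \<in> Lfilt (Suc (length c))"
    using Z2_in subspace_scale[OF subspace_Lfilt] subspace_0[OF subspace_Lfilt] by auto
  ultimately show ?case
    using M_in subspace_add[OF subspace_Lfilt] subspace_diff[OF subspace_Lfilt] subspace_scale[OF subspace_Lfilt]
    by (simp only: length_Cons)
qed

text \<open>The main term of \<open>M_Lword\<close> vanishes, because M_(t+p+1) kills
  \<open>level1 t\<close>.\<close>

lemma M_lower_Lfilt:
  assumes "e \<in> Lfilt (Suc k)"
  shows "M (int t + int p + 1) e \<in> Lfilt k"
proof (rule linear_Lfilt[OF linear_M _ subspace_Lfilt assms])
  fix c :: "nat list" and v assume *: "length c < Suc k" "v \<in> level1 t"
  then have "M (int t + int p + 1) (Lword c v) \<in> Lfilt (length c)"
    using M_Lword[OF *(2), of "int t + int p + 1" c] by (simp add: level1_def word_linear)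
  then show "M (int t + int p + 1) (Lword c v) \<in> Lfilt k"
    using Lfilt_mono[of "length c" k] * by auto
qed

lemma brM_Lword:
  assumes "v \<in> level1 t" "i \<le> p"
  shows "brM 0 p i (Lword c v) - Lword c (brM 0 p i v) \<in> Lfilt (length c)"
proof -
  have "brM 0 p i (Lword c v) - Lword c (brM 0 p i v)
    = of_int (int t + int p + int i + 2) *s (M (int t + int p - int i) (Lword c v) - Lword c (M (int t + int p - int i) v))"
    by (simp add: brM_def word_linear scale_right_diff_distrib foldr_commute_op[of Z2] Z2L)
  then show ?thesis using M_Lword[OF assms(1)] subspace_scale[OF subspace_Lfilt] by auto
qed

text \<open>\<open>Lfilt k\<close> is spanned by the words of length less than k, so two letters are
  lost here: one to the commutator, and one more because for i < p the main term of the bracket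
  vanishes on \<open>level1 t\<close>. For the empty word \<open>length c - 1\<close> is 0, and
  \<open>Lfilt 0\<close> is zero.\<close>

lemma M_lower_Lword:
  assumes "\<forall>i\<in>set c. i < p" "v \<in> level1 t"
  shows "M (int t + int p + 1) (Lword c v) \<in> Lfilt (length c - 1)"
  using assms(1)
proof (induction c)
  case Nil
  then show ?case using assms by (auto simp: level1_def subspace_0[OF subspace_Lfilt])
next
  case (Cons i c)
  have "L (- int i - 1) (M (int t + int p + 1) (Lword c v)) \<in> Lfilt (length c)"
  proof (cases c)
    case Nil
    then show ?thesis using assms by (auto simp: level1_def lin_simps subspace_0[OF subspace_Lfilt])
  next
    case Cons': (Cons j c')
    then show ?thesis using L_Lfilt[OF Cons.IH, of i] Cons.prems by auto
  qed
  moreover have "brM 0 p i (Lword c v) \<in> Lfilt (length c)"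
    using brM_Lword[OF assms(2), of i p c] brM_level1(2)[OF assms(2), of i p 0] Cons.prems by (auto simp: word_linear)
  ultimately show ?case using subspace_add[OF subspace_Lfilt] by (auto simp: M_lower)
qed

text \<open>The count of leading copies of p from \<open>L_lower_Mword_head\<close>, now with an
  error, since the bracket passes the remaining letters only up to shorter words.\<close>

lemma M_lower_Lword_head:
  assumes "sorted_wrt (\<ge>) (p # c)" "v \<in> level1 t"
  shows "\<exists>k::nat. M (int t + int p + 1) (Lword (p # c) v) - Lword c (of_nat (Suc k) *s brM 0 p p v) \<in> Lfilt (length c)"
  using assms(1)
proof (induction c)
  case Nil
  have "M (int t + int p + 1) v = 0" using assms by (simp add: level1_def)
  then show ?case
    by (intro exI[of _ 0]) (simp add: M_lower lin_simps subspace_0[OF subspace_Lfilt])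
next
  case (Cons i c)
  let ?M = "M (int t + int p + 1)" and ?L = "L (- int p - 1)"
  have br: "brM 0 p p (Lword (i # c) v) - Lword (i # c) (brM 0 p p v) \<in> Lfilt (length (i # c))"
    by (rule brM_Lword[OF assms(2) order.refl])
  have *: "?M (Lword (p # i # c) v) = ?L (?M (Lword (i # c) v)) + brM 0 p p (Lword (i # c) v)"
    using M_lower[of p p "Lword (i # c) v"] by simp
  show ?case
  proof (cases "i = p")
    case True
    then obtain k where k: "?M (Lword (p # c) v) - Lword c (of_nat (Suc k) *s brM 0 p p v) \<in> Lfilt (length c)"
      using Cons by auto
    have "?M (Lword (p # i # c) v) - Lword (i # c) (of_nat (Suc (Suc k)) *s brM 0 p p v)
       = ?L (?M (Lword (p # c) v) - Lword c (of_nat (Suc k) *s brM 0 p p v))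
         + (brM 0 p p (Lword (i # c) v) - Lword (i # c) (brM 0 p p v))"
      unfolding * scale_Suc[of "Suc k"] using True by (simp add: lin_simps word_linear word_diff del: of_nat_Suc)
    moreover have "?L (?M (Lword (p # c) v) - Lword c (of_nat (Suc k) *s brM 0 p p v)) \<in> Lfilt (length (i # c))"
      unfolding length_Cons by (rule L_Lfilt[OF k])
    ultimately show ?thesis using subspace_add[OF subspace_Lfilt _ br] by (intro exI[of _ "Suc k"]) (simp only:)
  next
    case False
    then have "\<forall>j\<in>set (i # c). j < p" using Cons.prems by force
    from M_lower_Lword[OF this assms(2)] have "?L (?M (Lword (i # c) v)) \<in> Lfilt (length (i # c))"
      using L_Lfilt[of _ "length c" p] by simp
    from subspace_add[OF subspace_Lfilt this br] show ?thesis
      unfolding * by (intro exI[of _ 0]) (simp add: add_diff_eq)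
  qed
qed

lemma Lword_independent:
  assumes "finite A" "\<forall>c\<in>A. sorted_wrt (\<ge>) c" "\<forall>c\<in>A. v c \<in> level1 t" "(\<Sum>c\<in>A. Lword c (v c)) = 0"
  shows "\<forall>c\<in>A. v c = 0"
proof -
  \<comment> \<open>Lowering is controlled only modulo shorter words, so a single length k is
    treated first, with \<open>Lfilt k\<close> as the space of errors.\<close>
  have top: "\<forall>c\<in>B. v c = 0" if B: "finite B" "B \<subseteq> {c. length c = k \<and> sorted_wrt (\<ge>) c}" "\<forall>c\<in>B. v c \<in> level1 t"
    "(\<Sum>c\<in>B. Lword c (v c)) \<in> Lfilt k" for B k
  proof (rule words_independent[where x = "\<lambda>i. L (- int i - 1)" and y = "\<lambda>p. M (int t + int p + 1)"
        and F = Lfilt and C = "\<lambda>k. {c. length c = k \<and> sorted_wrt (\<ge>) c}" and V = "level1 t" and k = k])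
    fix k p :: nat and c v assume *: "p # c \<in> {c. length c = Suc k \<and> sorted_wrt (\<ge>) c}" "v \<in> level1 t"
    then obtain l where l: "M (int t + int p + 1) (Lword (p # c) v) - Lword c (of_nat (Suc l) *s brM 0 p p v) \<in> Lfilt (length c)"
      using M_lower_Lword_head by blast
    have "(of_nat (Suc l) :: complex) \<noteq> 0" by (simp del: of_nat_Suc)
    then show "\<exists>v'\<in>level1 t. (v' = 0 \<longrightarrow> v = 0) \<and>
            M (int t + int p + 1) (Lword (p # c) v) - Lword c v' \<in> Lfilt k"
      using l * brM_level1(3)[OF *(2), of 0 p] subspace_scale[OF subspace_levels(1) brM_level1(1)[OF *(2)]]
      by (intro bexI[of _ "of_nat (Suc l) *s brM 0 p p v"]) (auto simp del: of_nat_Suc)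
  next
    fix k p :: nat and c v
    assume "c \<in> {c. length c = Suc k \<and> sorted_wrt (\<ge>) c}" "\<forall>i\<in>set c. i < p" "v \<in> level1 t"
    then show "M (int t + int p + 1) (Lword c v) \<in> Lfilt k"
      using M_lower_Lword[of c p v] by auto
  qed (use B M_lower_Lfilt subspace_0[OF subspace_Lfilt] subspace_diff[OF subspace_Lfilt] in \<open>auto simp: lin_simps Lfilt_0\<close>)
  \<comment> \<open>The longest words are removed first: their sum is minus a sum of shorter words
    and hence lies in \<open>Lfilt k\<close>.\<close>
  have "\<forall>c\<in>B. v c = 0" if "finite B" "B \<subseteq> A" "(\<Sum>c\<in>B. Lword c (v c)) = 0" "\<forall>c\<in>B. length c < k" for B k
    using that
  proof (induction k arbitrary: B)
    case (Suc k)
    define T where "T = {c \<in> B. length c = k}"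
    have rest: "(\<Sum>c\<in>B - T. Lword c (v c)) \<in> Lfilt k"
      using Suc.prems assms by (intro subspace_sum[OF subspace_Lfilt] Lfilt_word) (auto simp: T_def less_Suc_eq)
    have "T \<subseteq> B" by (auto simp: T_def)
    then have split: "(\<Sum>c\<in>B. Lword c (v c)) = (\<Sum>c\<in>B - T. Lword c (v c)) + (\<Sum>c\<in>T. Lword c (v c))"
      using Suc.prems by (intro sum.subset_diff)
    then have "(\<Sum>c\<in>T. Lword c (v c)) = - (\<Sum>c\<in>B - T. Lword c (v c))"
      using Suc.prems by (simp add: eq_neg_iff_add_eq_0 add.commute)
    then have "(\<Sum>c\<in>T. Lword c (v c)) \<in> Lfilt k"
      using subspace_neg[OF subspace_Lfilt rest] by simp
    then have T0: "\<forall>c\<in>T. v c = 0"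
      using Suc.prems assms by (intro top) (auto simp: T_def)
    then have "(\<Sum>c\<in>B - T. Lword c (v c)) = 0" using split Suc.prems by (simp add: word_linear)
    then have "\<forall>c\<in>B - T. v c = 0"
      using Suc.prems by (intro Suc.IH) (auto simp: T_def less_Suc_eq)
    then show ?case using T0 by auto
  qed simp
  from this[OF assms(1) order.refl assms(4), of "Suc (Max (length ` A))"] show ?thesis
    using assms(1) by (simp add: less_Suc_eq_le)
qed

section \<open>Independence of the ordered monomials\<close>

fun pbw_op :: "nat list \<times> nat list \<times> nat list \<Rightarrow> 'e \<Rightarrow> 'e" where
  "pbw_op (c, b, a) e = Lword c (Qword b (Mword q a e))"

lemma Mword_level2: "v \<in> level2 t \<Longrightarrow> Mword q a v \<in> level2 t"
  by (induction a) (auto intro: level2_closed)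

lemma Qword_level1: "v \<in> level1 t \<Longrightarrow> Qword a v \<in> level1 t"
  by (induction a) (auto intro: level1_closed)

text \<open>The sum is read from the outside in. The coefficients of the L-words are sums of Q-words
  over M-words and lie in \<open>level1 t\<close>; once they vanish, the coefficients of the Q-words
  lie in \<open>level2 t\<close>, and finally those of the M-words lie in
  \<open>level3 t q\<close>.\<close>

theorem pbw_independent:
  assumes A: "finite A" "A \<subseteq> pbw_index" and v: "\<forall>p\<in>A. v p \<in> level3 t q"
    and sum: "(\<Sum>p\<in>A. pbw_op p (v p)) = 0"
  shows "\<forall>p\<in>A. v p = 0"
proof -
  define C where "C = fst ` A"
  define B where "B = (fst \<circ> snd) ` A"
  define D where "D = (snd \<circ> snd) ` A"
  \<comment> \<open>Extension by zero, so that the sum runs over a full product of index sets and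
    becomes a nested sum.\<close>
  define w where "w p = (if p \<in> A then v p else 0)" for p
  have fin: "finite C" "finite B" "finite D" using A by (simp_all add: C_def B_def D_def)
  have sorted: "\<forall>c\<in>C. sorted_wrt (\<ge>) c" "\<forall>b\<in>B. sorted_wrt (>) b" "\<forall>a\<in>D. sorted_wrt (\<ge>) a"
    using A by (auto simp: C_def B_def D_def pbw_index_def)
  have w: "w p \<in> level3 t q" for p
    using v subspace_0[OF subspace_levels(3)] by (auto simp: w_def)
  then have w2: "w p \<in> level2 t" for p by (simp add: level3_def)
  have "A \<subseteq> C \<times> B \<times> D" by (force simp: C_def B_def D_def)
  then have "(\<Sum>p\<in>A. pbw_op p (v p)) = (\<Sum>p\<in>C \<times> B \<times> D. pbw_op p (w p))"
    using fin by (intro sum.mono_neutral_cong_left) (auto simp: w_def word_linear)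
  also have "\<dots> = (\<Sum>c\<in>C. \<Sum>b\<in>B. \<Sum>a\<in>D. pbw_op (c, b, a) (w (c, b, a)))"
    unfolding sum.cartesian_product by (rule sum.cong) auto
  also have "\<dots> = (\<Sum>c\<in>C. Lword c (\<Sum>b\<in>B. Qword b (\<Sum>a\<in>D. Mword q a (w (c, b, a)))))"
  proof -
    have "Lword c (sum f S) = (\<Sum>s\<in>S. Lword c (f s))" for c and f :: "nat list \<Rightarrow> 'e" and S
      by (induction S rule: infinite_finite_induct) (simp_all add: word_linear)
    moreover have "Qword c (sum f S) = (\<Sum>s\<in>S. Qword c (f s))" for c and f :: "nat list \<Rightarrow> 'e" and S
      by (induction S rule: infinite_finite_induct) (simp_all add: word_linear)
    ultimately show ?thesis by simp
  qed
  finally have "(\<Sum>c\<in>C. Lword c (\<Sum>b\<in>B. Qword b (\<Sum>a\<in>D. Mword q a (w (c, b, a))))) = 0"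
    using sum by simp
  moreover have M2: "(\<Sum>a\<in>D. Mword q a (w (c, b, a))) \<in> level2 t" for c b
    using w2 by (intro subspace_sum subspace_levels Mword_level2)
  moreover have "(\<Sum>b\<in>B. Qword b (\<Sum>a\<in>D. Mword q a (w (c, b, a)))) \<in> level1 t" for c
    using M2 by (intro subspace_sum[OF subspace_levels(1)] Qword_level1[OF level2_level1])
  ultimately have "\<forall>c\<in>C. (\<Sum>b\<in>B. Qword b (\<Sum>a\<in>D. Mword q a (w (c, b, a)))) = 0"
    using fin sorted by (intro Lword_independent) auto
  then have "\<forall>b\<in>B. (\<Sum>a\<in>D. Mword q a (w (c, b, a))) = 0" if "c \<in> C" for c
    using fin sorted M2 that by (intro Qword_independent) auto
  then have "\<forall>a\<in>D. w (c, b, a) = 0" if "c \<in> C" "b \<in> B" for c b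
    using fin sorted w that by (intro Mword_independent) auto
  then have "w p = 0" if "p \<in> A" for p
    using that by (cases p) (force simp: C_def B_def D_def)
  then show ?thesis by (auto simp: w_def)
qed

end

section \<open>Modules over the superalgebra\<close>

lemma complex_ring_simps [simp]:
  "carrier complex_ring = UNIV" "monoid.mult complex_ring = (*)" "one complex_ring = 1"
  "ring.zero complex_ring = 0" "add complex_ring = (+)"
  by (simp_all add: complex_ring_def)

locale bms_module =
  fixes W :: "'w supermod"
  assumes W: "supermodule UNIV W"
begin

sublocale W: Module.module complex_ring W
  using W by (simp add: supermodule_def)

lemma part_submodule: "submodule (part W i) complex_ring W"
  using W by (simp add: supermodule_def)

lemma part_decomp: "v \<in> carrier W \<Longrightarrow> \<exists>!p. p \<in> part W 0 \<times> part W 1 \<and> v = fst p \<oplus>\<^bsub>W\<^esub> snd p"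
  using W unfolding supermodule_def by (elim conjE) (rule bspec)

lemma act_closed [simp]: "v \<in> carrier W \<Longrightarrow> act W x v \<in> carrier W"
  using W unfolding supermodule_def by (elim conjE) blast

lemma act_add: "v \<in> carrier W \<Longrightarrow> w \<in> carrier W \<Longrightarrow> act W x (v \<oplus>\<^bsub>W\<^esub> w) = act W x v \<oplus>\<^bsub>W\<^esub> act W x w"
  using W unfolding supermodule_def by (elim conjE) blast

lemma act_smult: "v \<in> carrier W \<Longrightarrow> act W x (c \<odot>\<^bsub>W\<^esub> v) = c \<odot>\<^bsub>W\<^esub> act W x v"
  using W unfolding supermodule_def by (elim conjE) blast

lemma act_plus: "v \<in> carrier W \<Longrightarrow> act W (x + y) v = act W x v \<oplus>\<^bsub>W\<^esub> act W y v"
  using W unfolding supermodule_def by (elim conjE) blast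

lemma act_cscale: "v \<in> carrier W \<Longrightarrow> act W (cscale c x) v = c \<odot>\<^bsub>W\<^esub> act W x v"
  using W unfolding supermodule_def by (elim conjE) blast

lemma act_part:
  assumes "x \<in> bms_part i" "v \<in> part W j"
  shows "act W x v \<in> part W (i + j)"
proof -
  have "\<forall>i j. \<forall>x\<in>UNIV \<inter> bms_part i. \<forall>v\<in>part W j. act W x v \<in> part W (i + j)"
    using W unfolding supermodule_def by (elim conjE) assumption
  then show ?thesis using assms by blast
qed

lemma act_bracket:
  assumes "x \<in> bms_part i" "y \<in> bms_part j" "v \<in> carrier W"
  shows "act W (bms_bracket x y) v =
     act W x (act W y v) \<ominus>\<^bsub>W\<^esub> parity_sign i j \<odot>\<^bsub>W\<^esub> act W y (act W x v)"
proof -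
  have "\<forall>i j. \<forall>x\<in>UNIV \<inter> bms_part i. \<forall>y\<in>UNIV \<inter> bms_part j. \<forall>v\<in>carrier W.
        act W (bms_bracket x y) v =
          act W x (act W y v) \<ominus>\<^bsub>W\<^esub> parity_sign i j \<odot>\<^bsub>W\<^esub> act W y (act W x v)"
    using W unfolding supermodule_def by (elim conjE) assumption
  then show ?thesis using assms by blast
qed

lemma smult_simps [simp]:
  "v \<in> carrier W \<Longrightarrow> c \<odot>\<^bsub>W\<^esub> v \<in> carrier W"
  "v \<in> carrier W \<Longrightarrow> 0 \<odot>\<^bsub>W\<^esub> v = \<zero>\<^bsub>W\<^esub>"
  "v \<in> carrier W \<Longrightarrow> 1 \<odot>\<^bsub>W\<^esub> v = v"
  "c \<odot>\<^bsub>W\<^esub> \<zero>\<^bsub>W\<^esub> = \<zero>\<^bsub>W\<^esub>"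
  using W.smult_closed[of c v] W.smult_l_null[of v] W.smult_one[of v] W.smult_r_null[of c] by simp_all

lemma smult_l_distr: "v \<in> carrier W \<Longrightarrow> (c + d) \<odot>\<^bsub>W\<^esub> v = c \<odot>\<^bsub>W\<^esub> v \<oplus>\<^bsub>W\<^esub> d \<odot>\<^bsub>W\<^esub> v"
  using W.smult_l_distr[of c d v] by simp

lemma smult_r_distr:
  "v \<in> carrier W \<Longrightarrow> w \<in> carrier W \<Longrightarrow> c \<odot>\<^bsub>W\<^esub> (v \<oplus>\<^bsub>W\<^esub> w) = c \<odot>\<^bsub>W\<^esub> v \<oplus>\<^bsub>W\<^esub> c \<odot>\<^bsub>W\<^esub> w"
  using W.smult_r_distr[of c v w] by simp

lemma smult_assoc: "v \<in> carrier W \<Longrightarrow> c \<odot>\<^bsub>W\<^esub> (d \<odot>\<^bsub>W\<^esub> v) = (c * d) \<odot>\<^bsub>W\<^esub> v"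
  using W.smult_assoc1[of c d v] by simp

lemma a_inv_smult: "v \<in> carrier W \<Longrightarrow> \<ominus>\<^bsub>W\<^esub> v = (- 1) \<odot>\<^bsub>W\<^esub> v"
  using smult_l_distr[of v 1 "-1"] W.minus_equality W.a_comm by force

lemma eq_if_minus_eq_0:
  "v \<in> carrier W \<Longrightarrow> w \<in> carrier W \<Longrightarrow> v \<ominus>\<^bsub>W\<^esub> w = \<zero>\<^bsub>W\<^esub> \<Longrightarrow> v = w"
  by (metis W.a_assoc W.l_neg W.r_zero W.l_zero W.a_inv_closed a_minus_def)

lemma foldr_act_closed [simp]: "v \<in> carrier W \<Longrightarrow> foldr (act W) xs v \<in> carrier W"
  by (induction xs) auto

section \<open>Linear combinations in a module and its embedding into a vector space\<close>

definition lincomb :: "('a \<Rightarrow> 'w) \<Rightarrow> ('a \<Rightarrow>\<^sub>0 complex) \<Rightarrow> 'w" where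
  "lincomb g f = (\<Oplus>\<^bsub>W\<^esub>k\<in>Poly_Mapping.keys f. Poly_Mapping.lookup f k \<odot>\<^bsub>W\<^esub> g k)"

lemma lincomb_superset:
  assumes "finite A" "Poly_Mapping.keys f \<subseteq> A" "\<And>k. k \<in> A \<Longrightarrow> g k \<in> carrier W"
  shows "lincomb g f = (\<Oplus>\<^bsub>W\<^esub>k\<in>A. Poly_Mapping.lookup f k \<odot>\<^bsub>W\<^esub> g k)"
  unfolding lincomb_def using assms
  by (intro W.add.finprod_mono_neutral_cong_left) (auto simp: in_keys_iff)

context
  fixes g :: "'a \<Rightarrow> 'w"
  assumes g: "\<And>k. g k \<in> carrier W"
begin

lemma lincomb_closed [simp]: "lincomb g f \<in> carrier W"
  unfolding lincomb_def using g by (intro W.finsum_closed) auto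

lemma lincomb_add: "lincomb g (f + f') = lincomb g f \<oplus>\<^bsub>W\<^esub> lincomb g f'"
proof -
  let ?A = "Poly_Mapping.keys f \<union> Poly_Mapping.keys f'"
  have "lincomb g (f + f') = (\<Oplus>\<^bsub>W\<^esub>k\<in>?A. Poly_Mapping.lookup f k \<odot>\<^bsub>W\<^esub> g k \<oplus>\<^bsub>W\<^esub> Poly_Mapping.lookup f' k \<odot>\<^bsub>W\<^esub> g k)"
    using g keys_add[of f f'] by (subst lincomb_superset[of ?A]) (auto simp: lookup_add smult_l_distr)
  also have "\<dots> = lincomb g f \<oplus>\<^bsub>W\<^esub> lincomb g f'"
    using g by (subst (1 2) lincomb_superset[of ?A]) (auto intro!: W.finsum_addf)
  finally show ?thesis .
qed

lemma lincomb_single [simp]: "lincomb g (Poly_Mapping.single k c) = c \<odot>\<^bsub>W\<^esub> g k"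
  using g by (cases "c = 0") (simp_all add: lincomb_def)

lemma lincomb_pscale: "lincomb g (pscale c f) = c \<odot>\<^bsub>W\<^esub> lincomb g f"
  using g by (induction f rule: poly_mapping_induct_add)
    (simp_all add: pm.scale_right_distrib lincomb_add smult_assoc smult_r_distr)

lemma lincomb_zero [simp]: "lincomb g 0 = \<zero>\<^bsub>W\<^esub>"
  by (simp add: lincomb_def)

lemma lincomb_kernel_subspace: "pm.subspace {f. lincomb g f = \<zero>\<^bsub>W\<^esub>}"
  unfolding pm.subspace_def by (auto simp: lincomb_add lincomb_pscale)

end

text \<open>A linear section of the canonical map from the free vector space on the carrier; it transports computations
  in the module to a type carrying a vector space structure.\<close>

definition eval :: "('w \<Rightarrow>\<^sub>0 complex) \<Rightarrow> 'w" where
  "eval = lincomb (\<lambda>w. if w \<in> carrier W then w else \<zero>\<^bsub>W\<^esub>)"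

lemma eval_simps [simp]:
  "eval e \<in> carrier W" "eval (e + e') = eval e \<oplus>\<^bsub>W\<^esub> eval e'" "eval (pscale c e) = c \<odot>\<^bsub>W\<^esub> eval e" "eval 0 = \<zero>\<^bsub>W\<^esub>"
  unfolding eval_def by (rule lincomb_closed lincomb_add lincomb_pscale lincomb_zero; simp)+

lemma eval_single: "w \<in> carrier W \<Longrightarrow> eval (Poly_Mapping.single w c) = c \<odot>\<^bsub>W\<^esub> w"
  unfolding eval_def by (subst lincomb_single) auto

lemma eval_diff: "eval (e - e') = eval e \<ominus>\<^bsub>W\<^esub> eval e'"
proof -
  have "eval (- e') = \<ominus>\<^bsub>W\<^esub> eval e'"
    using eval_simps(3)[of "-1" e'] by (simp add: a_inv_smult)
  then show ?thesis using eval_simps(2)[of e "- e'"] by (simp add: a_minus_def)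
qed

text \<open>A basis of the kernel K of \<open>eval\<close>, extended to the whole space, gives a
  projection P that kills K. Since P kills K, the map w \<mapsto> P (single w 1) is linear; since P
  e - e lies in K, \<open>eval\<close> recovers w from it.\<close>

lemma ex_section:
  "\<exists>\<theta>. (\<forall>w\<in>carrier W. eval (\<theta> w) = w) \<and> (\<forall>w\<in>carrier W. \<forall>w'\<in>carrier W. \<theta> (w \<oplus>\<^bsub>W\<^esub> w') = \<theta> w + \<theta> w')
    \<and> (\<forall>c. \<forall>w\<in>carrier W. \<theta> (c \<odot>\<^bsub>W\<^esub> w) = pscale c (\<theta> w))"
proof -
  define K where "K = {e. eval e = \<zero>\<^bsub>W\<^esub>}"
  have K: "pm.subspace K" unfolding K_def eval_def by (rule lincomb_kernel_subspace) simp
  obtain B where B: "B \<subseteq> K" "pm.independent B" "K \<subseteq> pm.span B"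
    using pm.maximal_independent_subset by blast
  interpret p: vector_space_pair pscale pscale by unfold_locales
  define B' where "B' = pm.extend_basis B"
  have B': "B \<subseteq> B'" "pm.independent B'" "pm.span B' = UNIV"
    using B by (simp_all add: B'_def pm.extend_basis_superset pm.independent_extend_basis)
  define P where "P = p.construct B' (\<lambda>b. if b \<in> B then 0 else b)"
  interpret P: Vector_Spaces.linear pscale pscale P
    unfolding P_def by (rule p.linear_construct[OF B'(2)])
  have PB: "P b = (if b \<in> B then 0 else b)" if "b \<in> B'" for b
    unfolding P_def using that by (rule p.construct_basis[OF B'(2)])
  have PK: "P e = 0" if "e \<in> K" for e
  proof -
    have "pm.span B \<subseteq> P -` {0}"
      using B'(1) PB by (intro pm.span_minimal P.subspace_vimage) auto
    then show ?thesis using B(3) that by auto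
  qed
  have diff: "P e - e \<in> K" for e
  proof -
    have "pm.subspace {e. P e - e \<in> K}"
      unfolding pm.subspace_def
    proof (intro conjI ballI allI; clarsimp)
      show "0 \<in> K" by (rule pm.subspace_0[OF K])
      fix x y assume "P x - x \<in> K" "P y - y \<in> K"
      from pm.subspace_add[OF K this] show "P (x + y) - (x + y) \<in> K"
        by (simp add: P.add algebra_simps)
    next
      fix c x assume "P x - x \<in> K"
      from pm.subspace_scale[OF K this] show "P (pscale c x) - pscale c x \<in> K"
        by (simp add: P.scale pm.scale_right_diff_distrib)
    qed
    moreover have "P b - b \<in> K" if "b \<in> B'" for b
      using that PB B(1) pm.subspace_0[OF K] pm.subspace_neg[OF K] by auto
    ultimately have "pm.span B' \<subseteq> {e. P e - e \<in> K}"
      by (intro pm.span_minimal) auto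
    then show ?thesis using B'(3) by auto
  qed
  show ?thesis
  proof (intro exI[of _ "\<lambda>w. P (Poly_Mapping.single w 1)"] conjI ballI allI)
    fix w assume w: "w \<in> carrier W"
    show "eval (P (Poly_Mapping.single w 1)) = w"
    proof (rule eq_if_minus_eq_0[OF _ w])
      show "eval (P (Poly_Mapping.single w 1)) \<ominus>\<^bsub>W\<^esub> w = \<zero>\<^bsub>W\<^esub>"
        using diff[of "Poly_Mapping.single w 1"] w by (simp add: K_def eval_diff eval_single)
    qed simp
    show "P (Poly_Mapping.single (c \<odot>\<^bsub>W\<^esub> w) 1) = pscale c (P (Poly_Mapping.single w 1))" for c
    proof -
      have "Poly_Mapping.single (c \<odot>\<^bsub>W\<^esub> w) 1 - pscale c (Poly_Mapping.single w 1) \<in> K"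
        using w by (simp add: K_def eval_diff eval_single del: pscale_single) (simp add: a_minus_def W.r_neg)
      from PK[OF this] show ?thesis by (simp add: P.diff flip: P.scale)
    qed
    fix w' assume w': "w' \<in> carrier W"
    show "P (Poly_Mapping.single (w \<oplus>\<^bsub>W\<^esub> w') 1) = P (Poly_Mapping.single w 1) + P (Poly_Mapping.single w' 1)"
    proof -
      have "Poly_Mapping.single (w \<oplus>\<^bsub>W\<^esub> w') 1 - (Poly_Mapping.single w 1 + Poly_Mapping.single w' 1) \<in> K"
        using w w' by (simp add: K_def eval_diff eval_single a_minus_def W.r_neg)
      from PK[OF this] show ?thesis by (simp add: P.diff flip: P.add)
    qed
  qed
qed

definition lift :: "'w \<Rightarrow> ('w \<Rightarrow>\<^sub>0 complex)" where
  "lift = (SOME \<theta>. (\<forall>w\<in>carrier W. eval (\<theta> w) = w)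
    \<and> (\<forall>w\<in>carrier W. \<forall>w'\<in>carrier W. \<theta> (w \<oplus>\<^bsub>W\<^esub> w') = \<theta> w + \<theta> w')
    \<and> (\<forall>c. \<forall>w\<in>carrier W. \<theta> (c \<odot>\<^bsub>W\<^esub> w) = pscale c (\<theta> w)))"

lemma eval_lift [simp]: "w \<in> carrier W \<Longrightarrow> eval (lift w) = w"
  and lift_add: "w \<in> carrier W \<Longrightarrow> w' \<in> carrier W \<Longrightarrow> lift (w \<oplus>\<^bsub>W\<^esub> w') = lift w + lift w'"
  and lift_smult: "w \<in> carrier W \<Longrightarrow> lift (c \<odot>\<^bsub>W\<^esub> w) = pscale c (lift w)"
  using someI_ex[OF ex_section] unfolding lift_def[symmetric] by blast+

lemma lift_zero [simp]: "lift \<zero>\<^bsub>W\<^esub> = 0"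
  using lift_smult[of "\<zero>\<^bsub>W\<^esub>" 0] by simp

lemma lift_minus: "w \<in> carrier W \<Longrightarrow> w' \<in> carrier W \<Longrightarrow> lift (w \<ominus>\<^bsub>W\<^esub> w') = lift w - lift w'"
  by (simp add: a_minus_def a_inv_smult lift_add lift_smult)

lemma lift_eq_iff [simp]: "w \<in> carrier W \<Longrightarrow> w' \<in> carrier W \<Longrightarrow> lift w = lift w' \<longleftrightarrow> w = w'"
  by (metis eval_lift)

lemma lift_eq_0_iff [simp]: "w \<in> carrier W \<Longrightarrow> lift w = 0 \<longleftrightarrow> w = \<zero>\<^bsub>W\<^esub>"
  using lift_eq_iff[of w "\<zero>\<^bsub>W\<^esub>"] by simp

text \<open>Each operator factors through \<open>eval\<close>, so the relations of the module hold
  on the whole type. The price is that it kills the kernel of \<open>eval\<close>; the vectors that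
  represent elements of W are those in the image of \<open>lift\<close>.\<close>

definition op :: "bms \<Rightarrow> ('w \<Rightarrow>\<^sub>0 complex) \<Rightarrow> ('w \<Rightarrow>\<^sub>0 complex)" where
  "op x e = lift (act W x (eval e))"

lemma op_lift [simp]: "w \<in> carrier W \<Longrightarrow> op x (lift w) = lift (act W x w)"
  by (simp add: op_def)

lemma op_linear: "Vector_Spaces.linear pscale pscale (op x)"
  by unfold_locales (simp_all add: op_def act_add act_smult lift_add lift_smult)

lemma op_plus: "op (x + y) e = op x e + op y e"
  by (simp add: op_def act_plus lift_add)

lemma op_cscale: "op (cscale c x) e = pscale c (op x e)"
  by (simp add: op_def act_cscale lift_smult)

lemma op_0: "op 0 e = 0"
  using op_cscale[of 0 0 e] by (simp add: cscale_eq_pscale)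

lemma op_uminus: "op (- x) e = - op x e"
  using op_cscale[of "-1" x e] by (simp add: cscale_eq_pscale)

lemma op_commutator:
  "op (basis_bracket a b) e = op (basis_elt a) (op (basis_elt b) e)
     - pscale (parity_sign (basis_parity a) (basis_parity b)) (op (basis_elt b) (op (basis_elt a) e))"
  unfolding bms_bracket_basis[symmetric]
  by (simp add: op_def act_bracket[OF basis_elt_part basis_elt_part] lift_minus lift_smult)

sublocale rep: bms_rep pscale "\<lambda>n. op (bL n)" "\<lambda>n. op (bM n)" "\<lambda>n. op (bQ n)" "op bC2" "lift ` carrier W"
proof (intro bms_rep.intro bms_rep_axioms.intro op_linear)
  have op_if: "op (if b then x else y) e = (if b then op x e else op y e)" for b x y e by simp
  note ops = op_if op_plus op_cscale op_0 op_uminus parity_sign_def bL_def bM_def bQ_def bC2_def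
  fix m n :: int and e
  show "vector_space pscale" by (rule pm.vector_space_axioms)
  show "op (bL m) (op (bL n) e) = op (bL n) (op (bL m) e) + pscale (of_int (m - n)) (op (bL (m + n)) e)"
    if "m + n \<noteq> 0"
    using op_commutator[of "LB m" "LB n" e] that by (simp add: ops)
  show "op (bL m) (op (bM n) e) = op (bM n) (op (bL m) e) + pscale (of_int (m - n)) (op (bM (m + n)) e)
      + (if m + n = 0 then pscale (of_int (m ^ 3 - m) / 12) (op bC2 e) else 0)"
    using op_commutator[of "LB m" "MB n" e] by (cases "m + n = 0") (simp_all add: ops algebra_simps)
  show "op (bM m) (op (bM n) e) = op (bM n) (op (bM m) e)"
    using op_commutator[of "MB m" "MB n" e] by (simp add: ops)
  show "op (bQ m) (op (bQ n) e) = - op (bQ n) (op (bQ m) e) + pscale 2 (op (bM (m + n - 1)) e)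
      + (if m + n - 1 = 0 then pscale (1 / 3 * ((half_idx m)\<^sup>2 - 1 / 4)) (op bC2 e) else 0)"
    using op_commutator[of "QB m" "QB n" e] by (cases "m + n - 1 = 0") (simp_all add: ops algebra_simps)
  show "op (bL m) (op (bQ n) e) = op (bQ n) (op (bL m) e) + pscale (of_int m / 2 - half_idx n) (op (bQ (m + n)) e)"
    using op_commutator[of "LB m" "QB n" e] by (simp add: ops)
  show "op (bM m) (op (bQ n) e) = op (bQ n) (op (bM m) e)"
    using op_commutator[of "MB m" "QB n" e] by (simp add: ops)
  show "op bC2 (op (bL n) e) = op (bL n) (op bC2 e)" "op bC2 (op (bM n) e) = op (bM n) (op bC2 e)"
    "op bC2 (op (bQ n) e) = op (bQ n) (op bC2 e)"
    using op_commutator[of C2B "LB n" e] op_commutator[of C2B "MB n" e] op_commutator[of C2B "QB n" e]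
    by (simp_all add: ops)
  show "pm.subspace (lift ` carrier W)"
    unfolding pm.subspace_def by (auto simp flip: lift_add lift_smult lift_zero)
qed auto

end

section \<open>Enveloping algebras of the subalgebras\<close>

lemma bms_sub_closed:
  "x \<in> bms_sub q \<Longrightarrow> y \<in> bms_sub q \<Longrightarrow> x + y \<in> bms_sub q"
  "x \<in> bms_sub q \<Longrightarrow> cscale c x \<in> bms_sub q"
  using keys_add[of x y] keys_pscale[of c x] by (auto simp: bms_sub_def cscale_eq_pscale)

lemma env_relations_mono: "\<aa> \<subseteq> \<bb> \<Longrightarrow> env_relations \<aa> \<subseteq> env_relations \<bb>"
  unfolding env_relations_def by blast

lemma ideal_env_sub: "ideal (env_ideal (bms_sub q)) (free_algebra (bms_sub q))"
  by (intro env_ideal_ideal env_relations_carrier bms_sub_closed bms_sub_bracket_closed)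

text \<open>The part of \<open>env_ideal UNIV\<close> with words over the subalgebra is an ideal of
  the smaller free algebra and contains its relations, so minimality of the generated ideal applies.
  Hence a coset of the small ideal lies in one coset of the large one.\<close>

lemma env_ideal_sub_le: "env_ideal (bms_sub q) \<subseteq> env_ideal UNIV"
proof -
  let ?R = "free_algebra (bms_sub q)"
  interpret I: ideal "env_ideal UNIV" "free_algebra UNIV" by (rule ideal_env_UNIV)
  have "ideal (env_ideal UNIV \<inter> carrier ?R) ?R"
  proof (rule idealI[OF ring_free_algebra])
    show "subgroup (env_ideal UNIV \<inter> carrier ?R) (add_monoid ?R)"
    proof (rule fa.add.subgroupI)
      show "\<ominus>\<^bsub>?R\<^esub> a \<in> env_ideal UNIV \<inter> carrier ?R" if a: "a \<in> env_ideal UNIV \<inter> carrier ?R" for a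
      proof -
        have "\<ominus>\<^bsub>?R\<^esub> a = - a" by (rule fa.minus_equality) (use a in auto)
        then show ?thesis using a pm.subspace_neg[OF env_ideal_subspace] by auto
      qed
    qed (use I.zero_closed I.a_closed keys_add in \<open>fastforce+\<close>)
  next
    fix a x assume "a \<in> env_ideal UNIV \<inter> carrier ?R" "x \<in> carrier ?R"
    then show "x \<otimes>\<^bsub>?R\<^esub> a \<in> env_ideal UNIV \<inter> carrier ?R" "a \<otimes>\<^bsub>?R\<^esub> x \<in> env_ideal UNIV \<inter> carrier ?R"
      using I.I_l_closed[of a x] I.I_r_closed[of a x] fa.m_closed[of a "bms_sub q" x] fa.m_closed[of x "bms_sub q" a]
      by auto
  qed
  moreover have "env_relations (bms_sub q) \<subseteq> env_ideal UNIV \<inter> carrier ?R"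
    using env_relations_mono[of "bms_sub q" UNIV] fa.genideal_self[of "env_relations UNIV" UNIV]
      env_relations_carrier[of "bms_sub q"] bms_sub_closed bms_sub_bracket_closed
    by (auto simp: env_ideal_def)
  ultimately show ?thesis
    unfolding env_ideal_def[of "bms_sub q"] using fa.genideal_minimal by blast
qed

lemma env_class_eq: "env_class \<aa> f = {h + f | h. h \<in> env_ideal \<aa>}"
  by (auto simp: env_class_def a_r_coset_def')

lemma env_class_cong: "f - g \<in> env_ideal UNIV \<Longrightarrow> env_class UNIV f = env_class UNIV g"
proof -
  have *: "env_class UNIV f \<subseteq> env_class UNIV g" if "f - g \<in> env_ideal UNIV" for f g
  proof -
    have "\<exists>h'. h + f = h' + g \<and> h' \<in> env_ideal UNIV" if "h \<in> env_ideal UNIV" for h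
      using pm.subspace_add[OF env_ideal_subspace that \<open>f - g \<in> _\<close>]
      by (intro exI[of _ "h + (f - g)"]) simp
    then show ?thesis by (auto simp: env_class_eq)
  qed
  assume "f - g \<in> env_ideal UNIV"
  then show ?thesis
    using *[of f g] *[of g f] pm.subspace_neg[OF env_ideal_subspace, of "f - g"] by auto
qed

lemma carrier_env: "carrier (env_algebra \<aa>) = env_class \<aa> ` carrier (free_algebra \<aa>)"
  by (auto simp: env_algebra_def FactRing_def A_RCOSETS_def' env_class_def)

lemma env_mult: "env_class UNIV f \<otimes>\<^bsub>env_algebra UNIV\<^esub> env_class UNIV g = env_class UNIV (fmul f g)"
  using ideal.rcoset_mult_add[OF ideal_env_UNIV, of f g]
  by (simp add: env_algebra_def FactRing_def env_class_def)

lemma env_add: "env_class UNIV f \<oplus>\<^bsub>env_algebra UNIV\<^esub> env_class UNIV g = env_class UNIV (f + g)"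
proof -
  interpret ideal "env_ideal UNIV" "free_algebra UNIV" by (rule ideal_env_UNIV)
  show ?thesis
    using a_rcos_sum[of f g] by (simp add: env_algebra_def FactRing_def env_class_def)
qed

lemma env_map_class: "env_map UNIV (env_class (bms_sub q) f) = env_class UNIV f"
proof -
  have "\<exists>h'. h + (k + f) = h' + f \<and> h' \<in> env_ideal UNIV" if "h \<in> env_ideal UNIV" "k \<in> env_ideal (bms_sub q)" for h k
    using pm.subspace_add[OF env_ideal_subspace, of h k] that env_ideal_sub_le
    by (intro exI[of _ "h + k"]) (auto simp: add.assoc)
  moreover have "\<exists>h' k. h + f = h' + (k + f) \<and> h' \<in> env_ideal UNIV \<and> k \<in> env_ideal (bms_sub q)"
    if "h \<in> env_ideal UNIV" for h
  proof -
    interpret ideal "env_ideal (bms_sub q)" "free_algebra (bms_sub q)" by (rule ideal_env_sub)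
    show ?thesis using that zero_closed by (intro exI[of _ h] exI[of _ 0]) auto
  qed
  ultimately show ?thesis
    unfolding env_map_def set_add_def' env_class_eq by fastforce
qed

lemma complex_ring_minus_one: "Module.module complex_ring V \<Longrightarrow> \<ominus>\<^bsub>complex_ring\<^esub> 1 = -1"
proof -
  assume "Module.module complex_ring V"
  then interpret Module.module complex_ring V .
  show ?thesis by (rule R.minus_equality) auto
qed

lemma complex_module_a_inv:
  assumes "Module.module complex_ring V" "v \<in> carrier V"
  shows "\<ominus>\<^bsub>V\<^esub> v = (- 1) \<odot>\<^bsub>V\<^esub> v"
proof -
  interpret Module.module complex_ring V by (rule assms(1))
  show ?thesis
    using smult_l_minus[of 1 v] smult_one[of v] assms by (simp add: complex_ring_minus_one)
qed

lemma complex_submoduleI: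
  assumes V: "Module.module complex_ring V" and "N \<subseteq> carrier V" "\<zero>\<^bsub>V\<^esub> \<in> N"
    "\<And>a b. a \<in> N \<Longrightarrow> b \<in> N \<Longrightarrow> a \<oplus>\<^bsub>V\<^esub> b \<in> N" "\<And>c a. a \<in> N \<Longrightarrow> c \<odot>\<^bsub>V\<^esub> a \<in> N"
  shows "submodule N complex_ring V"
  using assms complex_module_a_inv[OF V] by (intro module.submoduleI[OF V]) auto

lemma complex_submoduleD:
  assumes V: "Module.module complex_ring V" and N: "submodule N complex_ring V"
  shows "N \<subseteq> carrier V" "\<zero>\<^bsub>V\<^esub> \<in> N" "\<And>a b. a \<in> N \<Longrightarrow> b \<in> N \<Longrightarrow> a \<oplus>\<^bsub>V\<^esub> b \<in> N"
    "\<And>c a. a \<in> N \<Longrightarrow> c \<odot>\<^bsub>V\<^esub> a \<in> N"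
proof -
  interpret Module.module complex_ring V by (rule V)
  note E = submoduleE[OF N]
  show "N \<subseteq> carrier V" "\<And>a b. a \<in> N \<Longrightarrow> b \<in> N \<Longrightarrow> a \<oplus>\<^bsub>V\<^esub> b \<in> N" "\<And>c a. a \<in> N \<Longrightarrow> c \<odot>\<^bsub>V\<^esub> a \<in> N"
    using E by auto
  obtain a where "a \<in> N" using E(2) by auto
  then have "\<zero>\<^bsub>complex_ring\<^esub> \<odot>\<^bsub>V\<^esub> a \<in> N" "a \<in> carrier V" using E(1,4) by auto
  then show "\<zero>\<^bsub>V\<^esub> \<in> N" using smult_l_null by simp
qed

section \<open>The action of the free algebra and of the enveloping algebra\<close>

context bms_module
begin

lemma part_facts:
  "part W i \<subseteq> carrier W" "\<zero>\<^bsub>W\<^esub> \<in> part W i"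
  "v \<in> part W i \<Longrightarrow> w \<in> part W i \<Longrightarrow> v \<oplus>\<^bsub>W\<^esub> w \<in> part W i"
  "v \<in> part W i \<Longrightarrow> c \<odot>\<^bsub>W\<^esub> v \<in> part W i"
  using complex_submoduleD[OF W.module_axioms part_submodule[of i]] by auto

lemma part_unique:
  assumes "v0 \<in> part W 0" "v1 \<in> part W 1" "w0 \<in> part W 0" "w1 \<in> part W 1" "v0 \<oplus>\<^bsub>W\<^esub> v1 = w0 \<oplus>\<^bsub>W\<^esub> w1"
  shows "v0 = w0" "v1 = w1"
proof -
  have "v0 \<oplus>\<^bsub>W\<^esub> v1 \<in> carrier W" using assms part_facts(1) by (meson W.a_closed subsetD)
  note ex1_unique = ex1E[OF part_decomp[OF this]]
  have "(v0, v1) = (w0, w1)"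
  proof (rule ex1_unique)
    fix p assume "\<forall>p'. p' \<in> part W 0 \<times> part W 1 \<and> v0 \<oplus>\<^bsub>W\<^esub> v1 = fst p' \<oplus>\<^bsub>W\<^esub> snd p' \<longrightarrow> p' = p"
    then have "(v0, v1) = p" "(w0, w1) = p" using assms by auto
    then show ?thesis by simp
  qed
  then show "v0 = w0" "v1 = w1" by simp_all
qed

lemma act_zero [simp]: "act W x \<zero>\<^bsub>W\<^esub> = \<zero>\<^bsub>W\<^esub>"
  using act_smult[of "\<zero>\<^bsub>W\<^esub>" x 0] by simp

lemma foldr_act_add:
  "v \<in> carrier W \<Longrightarrow> w \<in> carrier W \<Longrightarrow> foldr (act W) xs (v \<oplus>\<^bsub>W\<^esub> w) = foldr (act W) xs v \<oplus>\<^bsub>W\<^esub> foldr (act W) xs w"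
  by (induction xs) (simp_all add: act_add)

lemma foldr_act_smult: "v \<in> carrier W \<Longrightarrow> foldr (act W) xs (c \<odot>\<^bsub>W\<^esub> v) = c \<odot>\<^bsub>W\<^esub> foldr (act W) xs v"
  by (induction xs) (simp_all add: act_smult)

lemma free_act_lincomb: "free_act W f v = lincomb (\<lambda>xs. foldr (act W) xs v) f"
  by (simp add: free_act_def lincomb_def)

context
  fixes v assumes v: "v \<in> carrier W"
begin

lemma free_act_closed [simp]: "free_act W f v \<in> carrier W"
  using v unfolding free_act_lincomb by (intro lincomb_closed) auto

lemma free_act_add: "free_act W (f + g) v = free_act W f v \<oplus>\<^bsub>W\<^esub> free_act W g v"
  using v unfolding free_act_lincomb by (intro lincomb_add) auto

lemma free_act_single [simp]: "free_act W (Poly_Mapping.single xs c) v = c \<odot>\<^bsub>W\<^esub> foldr (act W) xs v"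
  using v unfolding free_act_lincomb by (intro lincomb_single) auto

lemma free_act_pscale: "free_act W (pscale c f) v = c \<odot>\<^bsub>W\<^esub> free_act W f v"
  using v unfolding free_act_lincomb by (intro lincomb_pscale) auto

lemma free_act_diff: "free_act W (f - g) v = free_act W f v \<ominus>\<^bsub>W\<^esub> free_act W g v"
  using free_act_add[of f "- g"] free_act_pscale[of "-1" g] by (simp add: a_minus_def a_inv_smult)

end

lemma free_act_zero [simp]: "free_act W 0 v = \<zero>\<^bsub>W\<^esub>"
  by (simp add: free_act_def)

lemma free_act_add_right:
  "v \<in> carrier W \<Longrightarrow> w \<in> carrier W \<Longrightarrow> free_act W f (v \<oplus>\<^bsub>W\<^esub> w) = free_act W f v \<oplus>\<^bsub>W\<^esub> free_act W f w"
  by (induction f rule: poly_mapping_induct_add)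
    (simp_all add: foldr_act_add smult_r_distr free_act_add W.a_ac)

lemma free_act_smult: "v \<in> carrier W \<Longrightarrow> free_act W f (c \<odot>\<^bsub>W\<^esub> v) = c \<odot>\<^bsub>W\<^esub> free_act W f v"
  by (induction f rule: poly_mapping_induct_add)
    (simp_all add: foldr_act_smult smult_r_distr free_act_add smult_assoc mult.commute)

lemma free_act_fmul: "v \<in> carrier W \<Longrightarrow> free_act W (fmul f g) v = free_act W f (free_act W g v)"
proof (induction f rule: poly_mapping_induct_add)
  case (single xs c)
  then show ?case
    by (induction g rule: poly_mapping_induct_add)
      (simp_all add: fmul_add_right free_act_add foldr_act_add foldr_act_smult smult_assoc smult_r_distr)
qed (simp add: fmul_add_left free_act_add)

lemma free_act_env_ideal:
  assumes "f \<in> env_ideal UNIV" "v \<in> carrier W"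
  shows "free_act W f v = \<zero>\<^bsub>W\<^esub>"
proof -
  \<comment> \<open>Elements that kill all of W: the condition on a single vector would not be
    stable under multiplication from the right.\<close>
  let ?K = "{f. \<forall>v\<in>carrier W. free_act W f v = \<zero>\<^bsub>W\<^esub>}" and ?R = "free_algebra UNIV :: (bms list \<Rightarrow>\<^sub>0 complex) ring"
  have "ideal ?K ?R"
  proof (rule idealI[OF ring_free_algebra])
    show "subgroup ?K (add_monoid ?R)"
    proof (rule fa.add.subgroupI)
      show "\<ominus>\<^bsub>?R\<^esub> a \<in> ?K" if a: "a \<in> ?K" for a
      proof -
        have "\<ominus>\<^bsub>?R\<^esub> a = - a" by (rule fa.minus_equality) auto
        then show ?thesis using a free_act_pscale[of _ "-1" a] by auto
      qed
      show "?K \<noteq> {}" by (auto intro!: exI[of _ 0])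
    qed (auto simp: free_act_add)
  next
    have z: "free_act W x \<zero>\<^bsub>W\<^esub> = \<zero>\<^bsub>W\<^esub>" for x
      using free_act_smult[of "\<zero>\<^bsub>W\<^esub>" x 0] by simp
    fix a x :: "bms list \<Rightarrow>\<^sub>0 complex" assume "a \<in> ?K" "x \<in> carrier ?R"
    then show "x \<otimes>\<^bsub>?R\<^esub> a \<in> ?K" "a \<otimes>\<^bsub>?R\<^esub> x \<in> ?K" by (auto simp: free_act_fmul z)
  qed
  moreover have "env_relations UNIV \<subseteq> ?K"
  proof (intro subsetI CollectI ballI)
    fix f v assume "f \<in> env_relations UNIV" and v: "v \<in> carrier W"
    then consider x y where "f = word [x + y] - word [x] - word [y]"
      | c x where "f = word [cscale c x] - Poly_Mapping.single [x] c"
      | x y i j where "f = word [x, y] - Poly_Mapping.single [y, x] (parity_sign i j) - word [bms_bracket x y]"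
        "x \<in> bms_part i" "y \<in> bms_part j"
      unfolding env_relations_def by blast
    then show "free_act W f v = \<zero>\<^bsub>W\<^esub>"
    proof cases
      case 1
      then show ?thesis using v by (simp flip: lift_eq_0_iff add: free_act_diff act_plus lift_minus lift_add)
    next
      case 2
      then show ?thesis using v by (simp flip: lift_eq_0_iff add: free_act_diff act_cscale lift_minus)
    next
      case 3
      then show ?thesis using v by (simp flip: lift_eq_0_iff add: free_act_diff act_bracket lift_minus)
    qed
  qed
  ultimately have "env_ideal UNIV \<subseteq> ?K"
    unfolding env_ideal_def using fa.genideal_minimal by blast
  then show ?thesis using assms by blast
qed

lemma env_act_class:
  assumes "v \<in> carrier W"
  shows "env_act W (env_class UNIV f) v = free_act W f v"
proof -
  have *: "free_act W g v = free_act W f v" if "g \<in> env_class UNIV f" for g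
    using that assms by (auto simp: env_class_eq free_act_add free_act_env_ideal)
  have "f \<in> env_class UNIV f"
    using pm.subspace_0[OF env_ideal_subspace] by (auto simp: env_class_eq)
  then have "(\<lambda>g. free_act W g v) ` env_class UNIV f = {free_act W f v}"
    by (subst image_cong[OF refl *]) auto
  then show ?thesis by (simp add: env_act_def)
qed

lemma stable_bms_sub:
  assumes N: "submodule N complex_ring W" and "\<And>a v. a \<in> sub_basis q \<Longrightarrow> v \<in> N \<Longrightarrow> act W (basis_elt a) v \<in> N"
    and x: "x \<in> bms_sub q" and v: "v \<in> N"
  shows "act W x v \<in> N"
proof -
  note D = complex_submoduleD[OF W.module_axioms N]
  have vc: "v \<in> carrier W" using D v by auto
  have "Poly_Mapping.keys x \<subseteq> sub_basis q" using x by (simp add: bms_sub_def)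
  then show ?thesis
  proof (induction x rule: poly_mapping_induct_keys)
    case zero
    show ?case using act_cscale[OF vc, of 0 0] D(2) vc by (simp add: cscale_eq_pscale)
  next
    case (single k c)
    then show ?case using act_cscale[OF vc, of c "basis_elt k"] D(4) assms(2) v by (simp add: cscale_eq_pscale)
  next
    case (add f g)
    then show ?case using D(3) by (simp add: act_plus vc)
  qed
qed

end

section \<open>Graded subspaces stable under the subalgebra\<close>

locale bms_submodule = bms_module +
  fixes q :: nat and N :: "'a set"
  assumes N: "submodule N complex_ring W"
    and N_graded: "v \<in> N \<Longrightarrow> \<exists>v0\<in>N \<inter> part W 0. \<exists>v1\<in>N \<inter> part W 1. v = v0 \<oplus>\<^bsub>W\<^esub> v1"
    and N_act: "x \<in> bms_sub q \<Longrightarrow> v \<in> N \<Longrightarrow> act W x v \<in> N"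
begin

definition V :: "'a supermod" where
  "V = W\<lparr>carrier := N, part := \<lambda>i. part W i \<inter> N\<rparr>"

lemma V_simps [simp]:
  "carrier V = N" "part V i = part W i \<inter> N" "act V = act W" "\<zero>\<^bsub>V\<^esub> = \<zero>\<^bsub>W\<^esub>" "add V = add W" "smult V = smult W"
  by (simp_all add: V_def)

lemma N_facts:
  "N \<subseteq> carrier W" "\<zero>\<^bsub>W\<^esub> \<in> N" "v \<in> N \<Longrightarrow> w \<in> N \<Longrightarrow> v \<oplus>\<^bsub>W\<^esub> w \<in> N" "v \<in> N \<Longrightarrow> c \<odot>\<^bsub>W\<^esub> v \<in> N"
  using complex_submoduleD[OF W.module_axioms N] by auto

lemma N_carrier [simp]: "v \<in> N \<Longrightarrow> v \<in> carrier W"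
  using N_facts(1) by blast

lemma module_V: "Module.module complex_ring V"
proof (rule moduleI)
  show "cring complex_ring" by (rule W.R.is_cring)
  show "abelian_group V"
  proof (rule abelian_groupI)
    show "\<exists>y\<in>carrier V. y \<oplus>\<^bsub>V\<^esub> x = \<zero>\<^bsub>V\<^esub>" if "x \<in> carrier V" for x
      using that N_facts(4)[of x "-1"] W.l_neg[of x] by (intro bexI[of _ "(-1) \<odot>\<^bsub>W\<^esub> x"]) (auto simp: a_inv_smult)
  qed (auto simp: N_facts W.a_ac)
qed (auto simp: N_facts smult_l_distr smult_r_distr smult_assoc)

lemma V_minus: "v \<in> N \<Longrightarrow> w \<in> N \<Longrightarrow> v \<ominus>\<^bsub>V\<^esub> w = v \<ominus>\<^bsub>W\<^esub> w"
  using complex_module_a_inv[OF module_V, of w] by (simp add: a_minus_def a_inv_smult)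

theorem supermodule_V: "supermodule (bms_sub q) V"
  unfolding supermodule_def
proof (intro conjI allI ballI module_V)
  show "submodule (part V i) complex_ring V" for i
    by (rule complex_submoduleI[OF module_V]) (auto simp: part_facts N_facts)
  show "\<exists>!p. p \<in> part V 0 \<times> part V 1 \<and> v = fst p \<oplus>\<^bsub>V\<^esub> snd p" if v: "v \<in> carrier V" for v
  proof -
    obtain v0 v1 where v01: "v0 \<in> N \<inter> part W 0" "v1 \<in> N \<inter> part W 1" "v = v0 \<oplus>\<^bsub>W\<^esub> v1"
      using N_graded[of v] v unfolding V_simps by blast
    show ?thesis
    proof (rule ex1I[of _ "(v0, v1)"])
      fix p assume "p \<in> part V 0 \<times> part V 1 \<and> v = fst p \<oplus>\<^bsub>V\<^esub> snd p"
      then show "p = (v0, v1)"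
        using v01 part_unique[of "fst p" "snd p" v0 v1] by (auto simp: prod_eq_iff)
    qed (use v01 in auto)
  qed
  show "act V (bms_bracket x y) v = act V x (act V y v) \<ominus>\<^bsub>V\<^esub> parity_sign i j \<odot>\<^bsub>V\<^esub> act V y (act V x v)"
    if "x \<in> bms_sub q \<inter> bms_part i" "y \<in> bms_sub q \<inter> bms_part j" "v \<in> carrier V" for i j x y v
    using that by (auto simp: V_minus act_bracket N_act N_facts)
qed (auto simp: N_act act_add act_smult act_plus act_cscale act_part simp del: add_bit_eq_xor)

lemma finsum_V:
  assumes "finite A" "g \<in> A \<rightarrow> N"
  shows "finsum V g A = finsum W g A"
proof -
  interpret V: Module.module complex_ring V by (rule module_V)
  from assms show ?thesis
  proof (induction A)
    case (insert x A)
    then show ?case by (simp add: V.finsum_insert W.finsum_insert Pi_def)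
  qed simp
qed

lemma foldr_act_N: "set xs \<subseteq> bms_sub q \<Longrightarrow> v \<in> N \<Longrightarrow> foldr (act W) xs v \<in> N"
  by (induction xs) (auto simp: N_act)

lemma free_act_V:
  assumes "f \<in> carrier (free_algebra (bms_sub q))" "v \<in> N"
  shows "free_act V f v = free_act W f v" "free_act W f v \<in> N"
proof -
  show *: "free_act V f v = free_act W f v"
    unfolding free_act_def V_simps using assms foldr_act_N
    by (intro finsum_V) (auto simp: subset_iff intro!: N_facts)
  interpret V: Module.module complex_ring V by (rule module_V)
  have "free_act V f v \<in> carrier V"
    unfolding free_act_def using assms foldr_act_N
    by (intro V.finsum_closed) (auto simp: subset_iff intro!: N_facts)
  then show "free_act W f v \<in> N" by (simp add: *)
qed

lemma env_act_V:
  assumes f: "f \<in> carrier (free_algebra (bms_sub q))" and v: "v \<in> N"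
  shows "env_act V (env_class (bms_sub q) f) v = free_act W f v"
proof -
  interpret ideal "env_ideal (bms_sub q)" "free_algebra (bms_sub q)" by (rule ideal_env_sub)
  have *: "free_act V g v = free_act W f v" if g: "g \<in> env_class (bms_sub q) f" for g
  proof -
    obtain h where h: "h \<in> env_ideal (bms_sub q)" "g = h + f" using g by (auto simp: env_class_eq)
    then have "h + f \<in> carrier (free_algebra (bms_sub q))"
      using fa.a_closed[of h "bms_sub q" f] a_Hcarr[OF h(1)] f by simp
    then show ?thesis
      using free_act_V(1)[of "h + f" v] h v free_act_env_ideal[of h v] env_ideal_sub_le
      by (auto simp: free_act_add)
  qed
  have "f \<in> env_class (bms_sub q) f"
    using zero_closed by (auto simp: env_class_eq)
  then have "(\<lambda>g. free_act V g v) ` env_class (bms_sub q) f = {free_act W f v}"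
    by (subst image_cong[OF refl *]) auto
  then show ?thesis by (simp add: env_act_def)
qed

end

section \<open>The induced module\<close>

definition word_parity :: "bms_basis list \<Rightarrow> bit" where
  "word_parity w = sum_list (map basis_parity w)"

lemma env_class_bword_part: "env_class UNIV (bword w) \<in> env_part UNIV (word_parity w)"
proof -
  have "list_all2 (\<lambda>x j. x \<in> bms_part j) (map basis_elt w) (map basis_parity w)"
    by (auto simp: list_all2_conv_all_nth basis_elt_part)
  then show ?thesis
    unfolding env_part_def by (auto simp: word_parity_def intro!: exI[of _ "bword w"])
qed

context bms_module
begin

lemma foldr_act_part:
  "list_all2 (\<lambda>x j. x \<in> bms_part j) xs js \<Longrightarrow> v \<in> part W j \<Longrightarrow> foldr (act W) xs v \<in> part W (sum_list js + j)"
proof (induction rule: list_all2_induct)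
  case (Cons x xs i js)
  then show ?case using act_part[of x i] by (simp add: add.assoc del: add_bit_eq_xor)
qed (simp del: add_bit_eq_xor)

lemma free_act_part:
  assumes "\<And>xs. xs \<in> Poly_Mapping.keys f \<Longrightarrow> \<exists>js. list_all2 (\<lambda>x j. x \<in> bms_part j) xs js \<and> sum_list js = i"
    and v: "v \<in> part W j"
  shows "free_act W f v \<in> part W (i + j)"
proof -
  have vc: "v \<in> carrier W" using v part_facts(1) by auto
  have "Poly_Mapping.keys f \<subseteq> {xs. \<exists>js. list_all2 (\<lambda>x j. x \<in> bms_part j) xs js \<and> sum_list js = i}"
    using assms(1) by blast
  then show ?thesis
  proof (induction f rule: poly_mapping_induct_keys)
    case (single xs c)
    then obtain js where "list_all2 (\<lambda>x j. x \<in> bms_part j) xs js" "sum_list js = i" by blast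
    then have "foldr (act W) xs v \<in> part W (i + j)" using foldr_act_part[OF _ v] by blast
    from part_facts(4)[OF this] show ?case using vc by simp
  qed (use vc part_facts in \<open>auto simp: free_act_add simp del: add_bit_eq_xor\<close>)
qed

lemma subspace_lift_part: "pm.subspace (lift ` part W i)"
proof -
  have c: "v \<in> part W i \<Longrightarrow> v \<in> carrier W" for v using part_facts(1) by auto
  show ?thesis
  proof (rule pm.subspaceI)
    show "0 \<in> lift ` part W i" by (rule image_eqI[of _ _ "\<zero>\<^bsub>W\<^esub>"]) (simp_all add: part_facts)
    fix x assume "x \<in> lift ` part W i"
    then obtain v where v: "x = lift v" "v \<in> part W i" by blast
    show "pscale a x \<in> lift ` part W i" for a
      by (rule image_eqI[of _ _ "a \<odot>\<^bsub>W\<^esub> v"]) (simp_all add: v c lift_smult part_facts)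
    fix y assume "y \<in> lift ` part W i"
    then obtain w where w: "y = lift w" "w \<in> part W i" by blast
    show "x + y \<in> lift ` part W i"
      by (rule image_eqI[of _ _ "v \<oplus>\<^bsub>W\<^esub> w"]) (simp_all add: v w c lift_add part_facts)
  qed
qed

lemma lift_part_unique:
  assumes "e0 \<in> lift ` part W 0" "e1 \<in> lift ` part W 1" "w \<in> part W k" "lift w = e0 + e1"
  shows "k = 0 \<Longrightarrow> e1 = 0" "k = 1 \<Longrightarrow> e0 = 0"
proof -
  obtain w0 w1 where w: "w0 \<in> part W 0" "w1 \<in> part W 1" "e0 = lift w0" "e1 = lift w1" using assms by auto
  have c: "w \<in> carrier W" "w0 \<in> carrier W" "w1 \<in> carrier W" using w assms part_facts(1) by auto
  have "w = w0 \<oplus>\<^bsub>W\<^esub> w1" using assms(4) w c by (simp flip: lift_add)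
  then have eq: "w0 \<oplus>\<^bsub>W\<^esub> w1 = w \<oplus>\<^bsub>W\<^esub> \<zero>\<^bsub>W\<^esub>" "w0 \<oplus>\<^bsub>W\<^esub> w1 = \<zero>\<^bsub>W\<^esub> \<oplus>\<^bsub>W\<^esub> w"
    using c(1) by simp_all
  show "e1 = 0" if "k = 0"
    using part_unique(2)[OF w(1,2) _ part_facts(2) eq(1)] assms(3) that w(4) by simp
  show "e0 = 0" if "k = 1"
    using part_unique(1)[OF w(1,2) part_facts(2) _ eq(2)] assms(3) that w(3) by simp
qed

end

section \<open>Normal forms in the tensor product\<close>

context bms_submodule
begin

abbreviation pairs :: "((bms list \<Rightarrow>\<^sub>0 complex) set \<times> 'a) set" where
  "pairs \<equiv> carrier (env_algebra UNIV) \<times> N"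

abbreviation F :: "((bms list \<Rightarrow>\<^sub>0 complex) set \<times> 'a \<Rightarrow>\<^sub>0 int) monoid" where
  "F \<equiv> free_Abelian_group pairs"

abbreviation R :: "((bms list \<Rightarrow>\<^sub>0 complex) set \<times> 'a \<Rightarrow>\<^sub>0 int) set" where
  "R \<equiv> ind_relations (bms_sub q) V"

abbreviation tens :: "(bms list \<Rightarrow>\<^sub>0 complex) \<Rightarrow> 'a \<Rightarrow> ((bms list \<Rightarrow>\<^sub>0 complex) set \<times> 'a \<Rightarrow>\<^sub>0 int)" where
  "tens f v \<equiv> frag_of (env_class UNIV f, v)"

lemma env_class_carrier [simp]: "env_class UNIV f \<in> carrier (env_algebra UNIV)"
  by (simp add: carrier_env)

lemma pairs_cases:
  assumes "k \<in> pairs" obtains f v where "k = (env_class UNIV f, v)" "v \<in> N"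
  using assms by (auto simp: carrier_env)

text \<open>The tensor relations, with elements of the free algebra in place of cosets and with the
  subalgebra acting on vectors through W.\<close>

definition relators :: "((bms list \<Rightarrow>\<^sub>0 complex) set \<times> 'a \<Rightarrow>\<^sub>0 int) set" where
  "relators = {tens (f + g) v - tens f v - tens g v | f g v. v \<in> N}
     \<union> {tens f (v \<oplus>\<^bsub>W\<^esub> w) - tens f v - tens f w | f v w. v \<in> N \<and> w \<in> N}
     \<union> {tens (fmul f b) v - tens f (free_act W b v) | f b v. b \<in> carrier (free_algebra (bms_sub q)) \<and> v \<in> N}"

lemma R_eq: "R = generate F relators"
proof -
  have "{frag_of (m \<oplus>\<^bsub>env_algebra UNIV\<^esub> m', n) - frag_of (m, n) - frag_of (m', n)
          | m m' n. m \<in> carrier (env_algebra UNIV) \<and> m' \<in> carrier (env_algebra UNIV) \<and> n \<in> carrier V}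
     = {tens (f + g) v - tens f v - tens g v | f g v. v \<in> N}"
    (is "?A = ?B")
  proof
    show "?A \<subseteq> ?B" by (auto simp: carrier_env env_add) blast
    show "?B \<subseteq> ?A"
    proof clarify
      fix f g v assume "v \<in> N"
      then show "\<exists>m m' n. tens (f + g) v - tens f v - tens g v
          = frag_of (m \<oplus>\<^bsub>env_algebra UNIV\<^esub> m', n) - frag_of (m, n) - frag_of (m', n)
          \<and> m \<in> carrier (env_algebra UNIV) \<and> m' \<in> carrier (env_algebra UNIV) \<and> n \<in> carrier V"
        by (intro exI[of _ "env_class UNIV f"] exI[of _ "env_class UNIV g"] exI[of _ v]) (simp add: env_add)
    qed
  qed
  moreover have "{frag_of (m, n \<oplus>\<^bsub>V\<^esub> n') - frag_of (m, n) - frag_of (m, n')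
          | m n n'. m \<in> carrier (env_algebra UNIV) \<and> n \<in> carrier V \<and> n' \<in> carrier V}
     = {tens f (v \<oplus>\<^bsub>W\<^esub> w) - tens f v - tens f w | f v w. v \<in> N \<and> w \<in> N}"
    by (auto simp: carrier_env) blast
  moreover have "{frag_of (m \<otimes>\<^bsub>env_algebra UNIV\<^esub> env_map UNIV r, n) - frag_of (m, env_act V r n)
          | m r n. m \<in> carrier (env_algebra UNIV) \<and> r \<in> carrier (env_algebra (bms_sub q)) \<and> n \<in> carrier V}
     = {tens (fmul f b) v - tens f (free_act W b v) | f b v. b \<in> carrier (free_algebra (bms_sub q)) \<and> v \<in> N}"
    (is "?A = ?B")
  proof
    show "?A \<subseteq> ?B"
    proof clarify
      fix m r n assume "m \<in> carrier (env_algebra UNIV)" "r \<in> carrier (env_algebra (bms_sub q))" "n \<in> carrier V"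
      then obtain f b where "m = env_class UNIV f" "r = env_class (bms_sub q) b" "b \<in> carrier (free_algebra (bms_sub q))" "n \<in> N"
        by (auto simp: carrier_env)
      then show "\<exists>f b v. frag_of (m \<otimes>\<^bsub>env_algebra UNIV\<^esub> env_map UNIV r, n) - frag_of (m, env_act V r n)
          = tens (fmul f b) v - tens f (free_act W b v) \<and> b \<in> carrier (free_algebra (bms_sub q)) \<and> v \<in> N"
        by (intro exI[of _ f] exI[of _ b] exI[of _ n]) (simp add: env_map_class env_mult env_act_V)
    qed
    show "?B \<subseteq> ?A"
    proof clarify
      fix f b v assume "b \<in> carrier (free_algebra (bms_sub q))" "v \<in> N"
      then show "\<exists>m r n. tens (fmul f b) v - tens f (free_act W b v)
          = frag_of (m \<otimes>\<^bsub>env_algebra UNIV\<^esub> env_map UNIV r, n) - frag_of (m, env_act V r n)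
          \<and> m \<in> carrier (env_algebra UNIV) \<and> r \<in> carrier (env_algebra (bms_sub q)) \<and> n \<in> carrier V"
        by (intro exI[of _ "env_class UNIV f"] exI[of _ "env_class (bms_sub q) b"] exI[of _ v])
          (simp add: env_map_class env_mult env_act_V carrier_env)
    qed
  qed
  ultimately show ?thesis
    unfolding ind_relations_def tensor_relations_def relators_def V_simps(1) by simp
qed

lemma relators_carrier: "relators \<subseteq> carrier F"
  unfolding relators_def
  using N_facts free_act_V(2) by (auto dest!: subsetD[OF keys_diff] split: if_splits)

lemma R_subgroup: "subgroup R F"
  unfolding R_eq by (rule group.generate_is_subgroup[OF group_free_Abelian_group relators_carrier])

lemma R_closed:
  "x \<in> R \<Longrightarrow> Poly_Mapping.keys x \<subseteq> pairs" "0 \<in> R" "x \<in> R \<Longrightarrow> y \<in> R \<Longrightarrow> x + y \<in> R"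
  "x \<in> R \<Longrightarrow> - x \<in> R" "x \<in> R \<Longrightarrow> y \<in> R \<Longrightarrow> x - y \<in> R"
proof -
  show k: "Poly_Mapping.keys x \<subseteq> pairs" if "x \<in> R" for x
  proof -
    have "x \<in> carrier F" using subgroup.subset[OF R_subgroup] that by blast
    then show ?thesis by simp
  qed
  show "0 \<in> R" using subgroup.one_closed[OF R_subgroup] by simp
  show a: "x + y \<in> R" if "x \<in> R" "y \<in> R" for x y
    using subgroup.m_closed[OF R_subgroup that] by simp
  show m: "- x \<in> R" if "x \<in> R" for x
    using subgroup.m_inv_closed[OF R_subgroup that] k[OF that] by simp
  show "x - y \<in> R" if "x \<in> R" "y \<in> R" for x y
    using a[OF that(1) m[OF that(2)]] by simp
qed

lemma tens_relations:
  "v \<in> N \<Longrightarrow> tens (f + g) v - tens f v - tens g v \<in> R"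
  "v \<in> N \<Longrightarrow> w \<in> N \<Longrightarrow> tens f (v \<oplus>\<^bsub>W\<^esub> w) - tens f v - tens f w \<in> R"
  "b \<in> carrier (free_algebra (bms_sub q)) \<Longrightarrow> v \<in> N \<Longrightarrow> tens (fmul f b) v - tens f (free_act W b v) \<in> R"
  unfolding R_eq relators_def by (rule generate.incl; blast)+

lemma tens_zero: "tens f \<zero>\<^bsub>W\<^esub> \<in> R" "v \<in> N \<Longrightarrow> tens 0 v \<in> R"
  using R_closed(4)[OF tens_relations(2)[of "\<zero>\<^bsub>W\<^esub>" "\<zero>\<^bsub>W\<^esub>" f]] R_closed(4)[OF tens_relations(1)[of v 0 0]] N_facts(2)
  by simp_all

lemma N_minus: "v \<in> N \<Longrightarrow> w \<in> N \<Longrightarrow> v \<ominus>\<^bsub>W\<^esub> w \<in> N"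
  by (simp add: a_minus_def a_inv_smult N_facts)

lemma tens_diff: "v \<in> N \<Longrightarrow> w \<in> N \<Longrightarrow> tens f v - tens f w - tens f (v \<ominus>\<^bsub>W\<^esub> w) \<in> R"
proof -
  assume v: "v \<in> N" "w \<in> N"
  have "(v \<ominus>\<^bsub>W\<^esub> w) \<oplus>\<^bsub>W\<^esub> w = v"
    using v by (simp add: a_minus_def W.a_assoc W.l_neg)
  then show ?thesis
    using tens_relations(2)[OF N_minus[OF v] v(2), of f] by (simp add: algebra_simps)
qed

text \<open>One vector per monomial suffices: additivity of the tensor merges terms with the same
  monomial, and complex scalars are moved onto the vector.\<close>

definition pbw_span :: "((bms list \<Rightarrow>\<^sub>0 complex) set \<times> 'a \<Rightarrow>\<^sub>0 int) set" where
  "pbw_span = {x. \<exists>A v. finite A \<and> A \<subseteq> pbw_index \<and> (\<forall>p. v p \<in> N)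
     \<and> x - (\<Sum>p\<in>A. tens (bword (pbw_word q p)) (v p)) \<in> R}"

lemma R_sum: "(\<And>b. b \<in> B \<Longrightarrow> f b \<in> R) \<Longrightarrow> sum f B \<in> R"
  by (induction B rule: infinite_finite_induct) (auto intro: R_closed)

lemma pbw_span_diff:
  assumes "x \<in> pbw_span" "y \<in> pbw_span" shows "x - y \<in> pbw_span"
proof -
  let ?T = "\<lambda>p. tens (bword (pbw_word q p))"
  \<comment> \<open>Zero vectors are inserted to bring the two sums to a common index set.\<close>
  have pad: "\<exists>v'. (\<forall>p. v' p \<in> N) \<and> x - (\<Sum>p\<in>B. ?T p (v' p)) \<in> R"
    if "finite B" "A \<subseteq> B" "\<forall>p. v p \<in> N" "x - (\<Sum>p\<in>A. ?T p (v p)) \<in> R" for A B v x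
  proof -
    define v' where "v' p = (if p \<in> A then v p else \<zero>\<^bsub>W\<^esub>)" for p
    have "(\<Sum>p\<in>B. ?T p (v' p)) = (\<Sum>p\<in>B - A. ?T p (v' p)) + (\<Sum>p\<in>A. ?T p (v' p))"
      using that by (intro sum.subset_diff)
    moreover have "(\<Sum>p\<in>B - A. ?T p (v' p)) \<in> R"
      by (rule R_sum) (simp add: v'_def tens_zero)
    moreover have "(\<Sum>p\<in>A. ?T p (v' p)) = (\<Sum>p\<in>A. ?T p (v p))" by (simp add: v'_def)
    ultimately have "x - (\<Sum>p\<in>B. ?T p (v' p)) \<in> R"
      using R_closed(5)[OF that(4), of "\<Sum>p\<in>B - A. ?T p (v' p)"] by (simp add: algebra_simps)
    then show ?thesis using that(3) N_facts(2) by (intro exI[of _ v']) (simp add: v'_def)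
  qed
  obtain A v where A: "finite A" "A \<subseteq> pbw_index" "\<forall>p. v p \<in> N" "x - (\<Sum>p\<in>A. ?T p (v p)) \<in> R"
    using assms(1) unfolding pbw_span_def by blast
  obtain B w where B: "finite B" "B \<subseteq> pbw_index" "\<forall>p. w p \<in> N" "y - (\<Sum>p\<in>B. ?T p (w p)) \<in> R"
    using assms(2) unfolding pbw_span_def by blast
  obtain v' where v': "\<forall>p. v' p \<in> N" "x - (\<Sum>p\<in>A \<union> B. ?T p (v' p)) \<in> R"
    using pad[of "A \<union> B" A v x] A B by auto
  obtain w' where w': "\<forall>p. w' p \<in> N" "y - (\<Sum>p\<in>A \<union> B. ?T p (w' p)) \<in> R"
    using pad[of "A \<union> B" B w y] A B by auto
  define a b d where "a = (\<Sum>p\<in>A \<union> B. ?T p (v' p))" and "b = (\<Sum>p\<in>A \<union> B. ?T p (w' p))"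
    and "d = (\<Sum>p\<in>A \<union> B. ?T p (v' p \<ominus>\<^bsub>W\<^esub> w' p))"
  have "(\<Sum>p\<in>A \<union> B. ?T p (v' p) - ?T p (w' p) - ?T p (v' p \<ominus>\<^bsub>W\<^esub> w' p)) \<in> R"
    using v' w' by (intro R_sum tens_diff) auto
  then have "a - b - d \<in> R" by (simp add: sum_subtractf a_def b_def d_def)
  moreover have "x - a - (y - b) \<in> R" using R_closed(5)[OF v'(2) w'(2)] by (simp add: a_def b_def)
  ultimately have "x - a - (y - b) + (a - b - d) \<in> R" by (rule R_closed(3)[rotated])
  moreover have "x - a - (y - b) + (a - b - d) = x - y - d" by simp
  ultimately show ?thesis
    unfolding pbw_span_def using A B v' w' N_minus
    by (intro CollectI exI[of _ "A \<union> B"] exI[of _ "\<lambda>p. v' p \<ominus>\<^bsub>W\<^esub> w' p"]) (simp add: d_def)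
qed

lemma pbw_span_R: "x \<in> R \<Longrightarrow> x \<in> pbw_span"
  unfolding pbw_span_def using N_facts(2) by (intro CollectI exI[of _ "{}"] exI[of _ "\<lambda>_. \<zero>\<^bsub>W\<^esub>"]) simp

lemma pbw_span_0: "0 \<in> pbw_span"
  by (intro pbw_span_R R_closed)

lemma pbw_span_uminus: "x \<in> pbw_span \<Longrightarrow> - x \<in> pbw_span"
  using pbw_span_diff[OF pbw_span_0] by simp

lemma pbw_span_add: "x \<in> pbw_span \<Longrightarrow> y \<in> pbw_span \<Longrightarrow> x + y \<in> pbw_span"
  using pbw_span_diff[OF _ pbw_span_uminus] by simp

lemma pbw_span_cong: "x - y \<in> R \<Longrightarrow> y \<in> pbw_span \<Longrightarrow> x \<in> pbw_span"
  using pbw_span_add[OF pbw_span_R, of "x - y" y] by simp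

lemma tens_pbw_span:
  assumes "v \<in> N" shows "tens f v \<in> pbw_span"
proof -
  \<comment> \<open>All vectors of N at once, so that the set is stable under right multiplication
    by the subalgebra: the new letter crosses the tensor sign and changes the vector.\<close>
  let ?G = "{f. \<forall>v\<in>N. tens f v \<in> pbw_span}"
  have sc: "Poly_Mapping.single [] c \<in> carrier (free_algebra (bms_sub q))" for c by simp
  have bw: "word [basis_elt y] \<in> carrier (free_algebra (bms_sub q))" if "y \<in> sub_basis q" for y
    using that by (simp add: bms_sub_def)
  interpret pbw_closed ?G q
  proof
    show "pm.subspace ?G"
    proof (rule pm.subspaceI)
      show "0 \<in> ?G" using tens_zero(2) pbw_span_R by blast
      show "f + g \<in> ?G" if "f \<in> ?G" "g \<in> ?G" for f g
      proof (intro CollectI ballI)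
        fix v assume v: "v \<in> N"
        then have "tens (f + g) v - (tens f v + tens g v) \<in> R" using tens_relations(1) by (simp add: diff_diff_add)
        then show "tens (f + g) v \<in> pbw_span" by (rule pbw_span_cong) (use that v pbw_span_add in auto)
      qed
      show "pscale c f \<in> ?G" if "f \<in> ?G" for c f
      proof (intro CollectI ballI)
        fix v assume v: "v \<in> N"
        \<comment> \<open>A scalar is a multiple of the empty word, hence an element of the
          enveloping algebra of the subalgebra, and crosses the tensor sign as such.\<close>
        then have "tens (pscale c f) v - tens f (c \<odot>\<^bsub>W\<^esub> v) \<in> R" using tens_relations(3)[OF sc v, of f c] by simp
        then show "tens (pscale c f) v \<in> pbw_span" by (rule pbw_span_cong) (use that v N_facts in auto)
      qed
    qed
    show "env_ideal UNIV \<subseteq> ?G"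
    proof (intro subsetI CollectI ballI)
      fix f v assume "f \<in> env_ideal UNIV" "v \<in> N"
      then show "tens f v \<in> pbw_span"
        using env_class_cong[of f 0] tens_zero(2) pbw_span_R by simp
    qed
    show "fmul f (word [basis_elt y]) \<in> ?G" if "f \<in> ?G" "y \<in> sub_basis q" for f y
    proof (intro CollectI ballI)
      fix v assume v: "v \<in> N"
      show "tens (fmul f (word [basis_elt y])) v \<in> pbw_span"
        by (rule pbw_span_cong[OF tens_relations(3)[OF bw[OF that(2)] v]])
           (use that free_act_V(2)[OF bw[OF that(2)] v] in auto)
    qed
    show "bword (pbw_word q p) \<in> ?G" if "p \<in> pbw_index" for p
    proof (intro CollectI ballI)
      fix v assume "v \<in> N"
      then show "tens (bword (pbw_word q p)) v \<in> pbw_span"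
        unfolding pbw_span_def using that R_closed(2) by (intro CollectI exI[of _ "{p}"] exI[of _ "\<lambda>_. v"]) simp
    qed
  qed
  show ?thesis using G_eq_UNIV assms by blast
qed

theorem pbw_span_UNIV:
  assumes "x \<in> carrier F" shows "x \<in> pbw_span"
proof -
  have "Poly_Mapping.keys x \<subseteq> pairs" using assms by simp
  then show ?thesis
  proof (induction x rule: frag_induction)
    case (one k)
    then show ?case using tens_pbw_span by (elim pairs_cases) auto
  qed (auto intro: pbw_span_0 pbw_span_diff)
qed

text \<open>The canonical map u \<otimes> v \<mapsto> uv before passage to the quotient. Its values
  are transported by \<open>lift\<close>, so that integer multiples and sums are those of a
  type.\<close>

definition H :: "((bms list \<Rightarrow>\<^sub>0 complex) set \<times> 'a \<Rightarrow>\<^sub>0 int) \<Rightarrow> ('a \<Rightarrow>\<^sub>0 complex)" where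
  "H x = (\<Sum>k\<in>Poly_Mapping.keys x. pscale (of_int (Poly_Mapping.lookup x k)) (lift (env_act W (fst k) (snd k))))"

lemma H_add: "H (x + y) = H x + H y"
  unfolding H_def
  by (rule setsum_keys_plus_distrib[where f = "\<lambda>k c. pscale (of_int c) (lift (env_act W (fst k) (snd k)))"])
    (simp_all add: pm.scale_left_distrib)

lemma H_0 [simp]: "H 0 = 0" by (simp add: H_def)

lemma H_uminus: "H (- x) = - H x"
  using H_add[of x "- x"] by (simp add: eq_neg_iff_add_eq_0 add.commute)

lemma H_diff: "H (x - y) = H x - H y"
  using H_add[of x "- y"] by (simp add: H_uminus)

lemma H_sum: "H (sum f B) = (\<Sum>b\<in>B. H (f b))"
  by (induction B rule: infinite_finite_induct) (simp_all add: H_add)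

lemma H_tens [simp]: "v \<in> N \<Longrightarrow> H (tens f v) = lift (free_act W f v)"
  by (simp add: H_def env_act_class)

lemma H_R: "x \<in> R \<Longrightarrow> H x = 0"
proof -
  have "relators \<subseteq> {x \<in> carrier F. H x = 0}"
  proof
    fix x assume x: "x \<in> relators"
    then have "H x = 0"
      unfolding relators_def using free_act_V(2)
      by (auto simp: H_diff N_facts free_act_add free_act_add_right free_act_fmul lift_add)
    then show "x \<in> {x \<in> carrier F. H x = 0}" using x relators_carrier by blast
  qed
  moreover have "subgroup {x \<in> carrier F. H x = 0} F"
    by (rule group.subgroupI[OF group_free_Abelian_group])
      (auto simp: H_add H_uminus dest!: subsetD[OF keys_add])
  ultimately have "R \<subseteq> {x \<in> carrier F. H x = 0}"
    unfolding R_eq by (rule group.generate_subgroup_incl[OF group_free_Abelian_group])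
  then show "x \<in> R \<Longrightarrow> H x = 0" by blast
qed

lemma H_lift: "x \<in> carrier F \<Longrightarrow> H x = lift (eval (H x))"
proof -
  assume "x \<in> carrier F"
  then have "Poly_Mapping.keys x \<subseteq> pairs" by simp
  then have "H x \<in> lift ` carrier W"
  proof (induction x rule: frag_induction)
    case zero
    then show ?case using rep.subspace_U pm.subspace_0 by auto
  next
    case (one k)
    then show ?case by (elim pairs_cases) auto
  next
    case (diff a b)
    then show ?case using pm.subspace_diff[OF rep.subspace_U] by (auto simp: H_diff)
  qed
  then show ?thesis by auto
qed

definition lmul :: "(bms list \<Rightarrow>\<^sub>0 complex) \<Rightarrow> ((bms list \<Rightarrow>\<^sub>0 complex) set \<times> 'a \<Rightarrow>\<^sub>0 int)
    \<Rightarrow> ((bms list \<Rightarrow>\<^sub>0 complex) set \<times> 'a \<Rightarrow>\<^sub>0 int)" where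
  "lmul f = frag_extend (\<lambda>(u, v). frag_of (env_class UNIV f \<otimes>\<^bsub>env_algebra UNIV\<^esub> u, v))"

lemma lmul_facts:
  assumes "x \<in> carrier F"
  shows "lmul f x \<in> carrier F \<and> H (lmul f x) = lift (free_act W f (eval (H x)))"
proof -
  have "Poly_Mapping.keys x \<subseteq> pairs" using assms by simp
  then show ?thesis
  proof (induction x rule: frag_induction)
    case zero
    then show ?case using free_act_smult[of "\<zero>\<^bsub>W\<^esub>" f 0] by (simp add: lmul_def)
  next
    case (one k)
    then show ?case by (elim pairs_cases) (simp add: lmul_def env_mult free_act_fmul)
  next
    case (diff a b)
    have k: "Poly_Mapping.keys (lmul f a - lmul f b) \<subseteq> pairs"
      using diff keys_diff[of "lmul f a" "lmul f b"] by auto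
    have "free_act W f (eval (H a) \<ominus>\<^bsub>W\<^esub> eval (H b)) = free_act W f (eval (H a)) \<ominus>\<^bsub>W\<^esub> free_act W f (eval (H b))"
      by (simp add: a_minus_def a_inv_smult free_act_add_right free_act_smult)
    then show ?case
      using diff k by (simp add: lmul_def frag_extend_diff H_diff eval_diff lift_minus)
  qed
qed

section \<open>The grading of the induced module and the image of the canonical map\<close>

definition homog :: "bit \<Rightarrow> ((bms list \<Rightarrow>\<^sub>0 complex) set \<times> 'a \<Rightarrow>\<^sub>0 int) set" where
  "homog k = generate F {frag_of (u, v) | u v i j. u \<in> env_part UNIV i \<and> v \<in> part V j \<and> i + j = k}"

lemma homog_gens_carrier: "{frag_of (u, v) | u v i j. u \<in> env_part UNIV i \<and> v \<in> part V j \<and> i + j = k} \<subseteq> carrier F"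
  by (auto simp: env_part_def)

lemma homog_subgroup: "subgroup (homog k) F"
  unfolding homog_def by (rule group.generate_is_subgroup[OF group_free_Abelian_group homog_gens_carrier])

lemma homog_closed:
  "x \<in> homog k \<Longrightarrow> x \<in> carrier F" "0 \<in> homog k" "x \<in> homog k \<Longrightarrow> y \<in> homog k \<Longrightarrow> x + y \<in> homog k"
proof -
  show "x \<in> homog k \<Longrightarrow> x \<in> carrier F" using subgroup.subset[OF homog_subgroup] by blast
  show "0 \<in> homog k" using subgroup.one_closed[OF homog_subgroup] by simp
  show "x \<in> homog k \<Longrightarrow> y \<in> homog k \<Longrightarrow> x + y \<in> homog k"
    using subgroup.m_closed[OF homog_subgroup] by fastforce
qed

lemma H_homog: "x \<in> homog k \<Longrightarrow> H x \<in> lift ` part W k"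
proof -
  let ?S = "{x \<in> carrier F. H x \<in> lift ` part W k}"
  note sp = subspace_lift_part[of k]
  have "subgroup ?S F"
    using pm.subspace_0[OF sp] pm.subspace_add[OF sp] pm.subspace_neg[OF sp]
    by (intro group.subgroupI[OF group_free_Abelian_group])
      (auto simp: H_add H_uminus dest!: subsetD[OF keys_add])
  moreover have "{frag_of (u, v) | u v i j. u \<in> env_part UNIV i \<and> v \<in> part V j \<and> i + j = k} \<subseteq> ?S"
  proof clarify
    fix u v i j assume u: "u \<in> env_part UNIV i" and v: "v \<in> part V j" and k: "k = i + j"
    obtain f where f: "u = env_class UNIV f"
      "\<forall>xs\<in>Poly_Mapping.keys f. \<exists>js. list_all2 (\<lambda>x j. x \<in> bms_part j) xs js \<and> sum_list js = i"
      using u unfolding env_part_def by blast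
    have "free_act W f v \<in> part W (i + j)"
      using v f(2) by (intro free_act_part) auto
    then show "frag_of (u, v) \<in> carrier F \<and> H (frag_of (u, v)) \<in> lift ` part W (i + j)"
      using v f(1) by auto
  qed
  ultimately have "homog k \<subseteq> ?S"
    unfolding homog_def by (intro group.generate_subgroup_incl[OF group_free_Abelian_group])
  then show "x \<in> homog k \<Longrightarrow> H x \<in> lift ` part W k" by blast
qed

lemma tens_homog:
  assumes "v \<in> N \<inter> part W j" shows "tens (bword w) v \<in> homog (word_parity w + j)"
  unfolding homog_def using env_class_bword_part[of w] assms by (intro generate.incl) auto

text \<open>Ordered monomials are words in basis vectors and therefore homogeneous, and their
  coefficients split because N is graded. So the normal form modulo R provides the
  decomposition.\<close>

lemma homog_decomp:
  assumes "x \<in> carrier F"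
  shows "\<exists>x0\<in>homog 0. \<exists>x1\<in>homog 1. x - x0 - x1 \<in> R"
proof -
  define D where "D = {x. \<exists>x0\<in>homog 0. \<exists>x1\<in>homog 1. x - x0 - x1 \<in> R}"
  have D_R: "x \<in> D" if "x \<in> R" for x
    using that homog_closed(2) unfolding D_def by (intro CollectI bexI[of _ 0]) auto
  have D_add: "x + y \<in> D" if x: "x \<in> D" and y: "y \<in> D" for x y
  proof -
    obtain x0 x1 y0 y1 where *: "x0 \<in> homog 0" "x1 \<in> homog 1" "y0 \<in> homog 0" "y1 \<in> homog 1"
      "x - x0 - x1 \<in> R" "y - y0 - y1 \<in> R" using x y unfolding D_def by blast
    have eq: "x - x0 - x1 + (y - y0 - y1) = x + y - (x0 + y0) - (x1 + y1)" by simp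
    have "x + y - (x0 + y0) - (x1 + y1) \<in> R" using R_closed(3)[OF *(5,6)] unfolding eq .
    then show ?thesis unfolding D_def using * homog_closed(3) by blast
  qed
  have D_sum: "sum f B \<in> D" if "\<And>b. f b \<in> D" for f and B :: "(nat list \<times> nat list \<times> nat list) set"
    using that D_add D_R[OF R_closed(2)] by (induction B rule: infinite_finite_induct) auto
  have D_homog: "x \<in> D" if "x \<in> homog k" for x k
  proof -
    consider "k = 0" | "k = 1" by (cases k) auto
    then show ?thesis
    proof cases
      case 1
      then show ?thesis using that R_closed(2) homog_closed(2) unfolding D_def
        by (intro CollectI bexI[of _ x] bexI[of _ 0]) auto
    next
      case 2
      then show ?thesis using that R_closed(2) homog_closed(2) unfolding D_def
        by (intro CollectI bexI[of _ 0] bexI[of _ x]) auto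
    qed
  qed
  have D_tens: "tens (bword w) v \<in> D" if v: "v \<in> N" for w v
  proof -
    obtain v0 v1 where v01: "v0 \<in> N \<inter> part W 0" "v1 \<in> N \<inter> part W 1" "v = v0 \<oplus>\<^bsub>W\<^esub> v1"
      using N_graded[OF v] by blast
    have "tens (bword w) v - tens (bword w) v0 - tens (bword w) v1 \<in> D"
      using tens_relations(2)[of v0 v1 "bword w"] v01 D_R by auto
    from D_add[OF this D_add[OF D_homog[OF tens_homog[OF v01(1)]] D_homog[OF tens_homog[OF v01(2)]]], of w w]
    show ?thesis by simp
  qed
  obtain A v where A: "finite A" "A \<subseteq> pbw_index" "\<forall>p. v p \<in> N" "x - (\<Sum>p\<in>A. tens (bword (pbw_word q p)) (v p)) \<in> R"
    using pbw_span_UNIV[OF assms] unfolding pbw_span_def by blast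
  have "(\<Sum>p\<in>A. tens (bword (pbw_word q p)) (v p)) \<in> D"
    using A(3) by (intro D_sum D_tens) auto
  from D_add[OF D_R[OF A(4)] this] have "x \<in> D" by simp
  then show ?thesis by (simp add: D_def)
qed

text \<open>The image of the canonical map, that is U(g)N.\<close>

definition generated :: "'a set" where
  "generated = {w \<in> carrier W. lift w \<in> H ` carrier F}"

lemma generatedI: "x \<in> carrier F \<Longrightarrow> H x = lift w \<Longrightarrow> w \<in> carrier W \<Longrightarrow> w \<in> generated"
  unfolding generated_def by (metis (mono_tags, lifting) image_eqI mem_Collect_eq)

lemma N_generated: "N \<subseteq> generated"
proof
  fix v assume "v \<in> N"
  then show "v \<in> generated"
    by (intro generatedI[of "tens (word []) v"]) auto
qed

lemma generated_free_act: "w \<in> generated \<Longrightarrow> free_act W f w \<in> generated"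
proof -
  assume "w \<in> generated"
  then obtain x where x: "w \<in> carrier W" "x \<in> carrier F" "H x = lift w" by (force simp: generated_def)
  then show ?thesis using lmul_facts[OF x(2), of f] by (intro generatedI[of "lmul f x"]) auto
qed

theorem generated_submodule: "sub_supermodule UNIV W generated"
  unfolding sub_supermodule_def
proof (intro conjI ballI)
  have c: "w \<in> carrier W" if "w \<in> generated" for w using that by (simp add: generated_def)
  show "submodule generated complex_ring W"
  proof (rule complex_submoduleI[OF W.module_axioms])
    show "\<zero>\<^bsub>W\<^esub> \<in> generated" using N_generated N_facts(2) by blast
    show "c \<odot>\<^bsub>W\<^esub> w \<in> generated" if "w \<in> generated" for c w
      using generated_free_act[OF that, of "Poly_Mapping.single [] c"] c[OF that] by simp
    show "v \<oplus>\<^bsub>W\<^esub> w \<in> generated" if "v \<in> generated" "w \<in> generated" for v w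
    proof -
      obtain x y where x: "v \<in> carrier W" "x \<in> carrier F" "H x = lift v" "w \<in> carrier W" "y \<in> carrier F" "H y = lift w"
        using \<open>v \<in> generated\<close> \<open>w \<in> generated\<close> by (force simp: generated_def)
      then show ?thesis
        using keys_add[of x y] by (intro generatedI[of "x + y"]) (auto simp: H_add lift_add)
    qed
  qed (use c in auto)
  show "act W x w \<in> generated" if "w \<in> generated" for x w
    using generated_free_act[OF that, of "word [x]"] c[OF that] by simp
  fix w assume w: "w \<in> generated"
  then obtain x where x: "w \<in> carrier W" "x \<in> carrier F" "H x = lift w" by (force simp: generated_def)
  obtain x0 x1 where x01: "x0 \<in> homog 0" "x1 \<in> homog 1" "x - x0 - x1 \<in> R" using homog_decomp[OF x(2)] by blast
  obtain w0 w1 where w01: "w0 \<in> part W 0" "w1 \<in> part W 1" "H x0 = lift w0" "H x1 = lift w1"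
    using H_homog x01 by blast
  have c01: "w0 \<in> carrier W" "w1 \<in> carrier W" using w01 part_facts(1) by auto
  have "lift w = lift (w0 \<oplus>\<^bsub>W\<^esub> w1)"
    using H_R[OF x01(3)] x w01 c01 by (simp add: H_diff H_add lift_add algebra_simps)
  then have "w = w0 \<oplus>\<^bsub>W\<^esub> w1" using x c01 by simp
  moreover have "w0 \<in> generated" "w1 \<in> generated"
    using generatedI[OF homog_closed(1)[OF x01(1)]] generatedI[OF homog_closed(1)[OF x01(2)]] w01 c01 by auto
  ultimately show "\<exists>v0\<in>generated \<inter> part W 0. \<exists>v1\<in>generated \<inter> part W 1. w = v0 \<oplus>\<^bsub>W\<^esub> v1"
    using w01 by blast
qed

lemma generated_pbw:
  assumes "w \<in> generated"
  shows "\<exists>A v. finite A \<and> A \<subseteq> pbw_index \<and> (\<forall>p. v p \<in> N)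
    \<and> lift w = (\<Sum>p\<in>A. lift (foldr (act W) (map basis_elt (pbw_word q p)) (v p)))"
proof -
  obtain x where x: "w \<in> carrier W" "x \<in> carrier F" "H x = lift w" using assms by (force simp: generated_def)
  obtain A v where A: "finite A" "A \<subseteq> pbw_index" "\<forall>p. v p \<in> N" "x - (\<Sum>p\<in>A. tens (bword (pbw_word q p)) (v p)) \<in> R"
    using pbw_span_UNIV[OF x(2)] unfolding pbw_span_def by blast
  have "lift w = (\<Sum>p\<in>A. lift (foldr (act W) (map basis_elt (pbw_word q p)) (v p)))"
    using H_R[OF A(4)] x(3) A(3) by (simp add: H_diff H_sum)
  then show ?thesis using A by blast
qed

end

text \<open>The assumptions amount to injectivity and surjectivity of the canonical map: the first
  through the monomial normal form, the second directly.\<close>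

locale bms_induction = bms_submodule +
  assumes independent: "finite A \<Longrightarrow> A \<subseteq> pbw_index \<Longrightarrow> \<forall>p\<in>A. v p \<in> N \<Longrightarrow>
      (\<Sum>p\<in>A. lift (foldr (act W) (map basis_elt (pbw_word q p)) (v p))) = 0 \<Longrightarrow> \<forall>p\<in>A. v p = \<zero>\<^bsub>W\<^esub>"
    and generated_all: "generated = carrier W"
begin

text \<open>The normal form of an element of the kernel has zero coefficients by independence, so
  the element is itself a relation.\<close>

lemma R_eq_kernel: "R = {x \<in> carrier F. H x = 0}"
proof
  show "R \<subseteq> {x \<in> carrier F. H x = 0}" using R_closed(1) H_R by auto
  show "{x \<in> carrier F. H x = 0} \<subseteq> R"
  proof clarify
    fix x assume x: "x \<in> carrier F" "H x = 0"
    obtain A v where A: "finite A" "A \<subseteq> pbw_index" "\<forall>p. v p \<in> N" "x - (\<Sum>p\<in>A. tens (bword (pbw_word q p)) (v p)) \<in> R"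
      using pbw_span_UNIV[OF x(1)] unfolding pbw_span_def by blast
    have "(\<Sum>p\<in>A. lift (foldr (act W) (map basis_elt (pbw_word q p)) (v p))) = 0"
      using H_R[OF A(4)] x(2) A(3) by (simp add: H_diff H_sum)
    then have "\<forall>p\<in>A. v p = \<zero>\<^bsub>W\<^esub>" using A by (intro independent) auto
    then have "(\<Sum>p\<in>A. tens (bword (pbw_word q p)) (v p)) \<in> R"
      by (intro R_sum) (simp add: tens_zero)
    from R_closed(3)[OF A(4) this] show "x \<in> R" by simp
  qed
qed

text \<open>The preimage of w under the canonical map. It is a coset of the relations, that is, an
  element of the induced module, so \<open>fibre\<close> is the inverse of the canonical
  map.\<close>

definition fibre :: "'a \<Rightarrow> ((bms list \<Rightarrow>\<^sub>0 complex) set \<times> 'a \<Rightarrow>\<^sub>0 int) set" where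
  "fibre w = {x \<in> carrier F. H x = lift w}"

lemma fibre_coset:
  assumes "x \<in> fibre w" shows "R #>\<^bsub>F\<^esub> x = fibre w"
proof
  show "R #>\<^bsub>F\<^esub> x \<subseteq> fibre w"
    using assms keys_add[of _ x] by (auto simp: r_coset_def R_eq_kernel fibre_def H_add)
  show "fibre w \<subseteq> R #>\<^bsub>F\<^esub> x"
  proof
    fix y assume y: "y \<in> fibre w"
    then have "y - x \<in> R"
      using assms keys_diff[of y x] by (auto simp: R_eq_kernel fibre_def H_diff)
    then show "y \<in> R #>\<^bsub>F\<^esub> x" unfolding r_coset_def by (auto intro!: bexI[of _ "y - x"])
  qed
qed

lemma ex_fibre: "w \<in> carrier W \<Longrightarrow> \<exists>x. x \<in> fibre w"
proof -
  assume "w \<in> carrier W"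
  then have "lift w \<in> H ` carrier F" using generated_all unfolding generated_def by blast
  then obtain x where "x \<in> carrier F" "lift w = H x" by blast
  then show ?thesis by (intro exI[of _ x]) (simp add: fibre_def)
qed

lemma in_fibre: "x \<in> carrier F \<Longrightarrow> x \<in> fibre (eval (H x))"
  using H_lift[of x] by (simp add: fibre_def)

lemma R_normal: "R \<lhd> F"
  using comm_group.normal_iff_subgroup[OF abelian_free_Abelian_group] R_subgroup by blast

lemma ind_group_eq: "ind_group (bms_sub q) V = F Mod R"
  by (simp add: ind_group_def tensor_product_def ind_relations_def)

text \<open>Left multiplication carries a fibre into a fibre, which is a full coset of R; adding R
  to the image fills that coset.\<close>

lemma ind_env_act_fibre:
  assumes "w \<in> carrier W"
  shows "ind_env_act (bms_sub q) V (env_class UNIV f) (fibre w) = fibre (free_act W f w)"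
proof -
  have l: "lmul f x \<in> fibre (free_act W f w)" if "x \<in> fibre w" for x
    using that lmul_facts[of x f] assms by (auto simp: fibre_def)
  obtain x where x: "x \<in> fibre w" using ex_fibre[OF assms] by blast
  have "R <#>\<^bsub>F\<^esub> lmul f ` fibre w = fibre (free_act W f w)"
  proof
    show "R <#>\<^bsub>F\<^esub> lmul f ` fibre w \<subseteq> fibre (free_act W f w)"
    proof
      fix z assume "z \<in> R <#>\<^bsub>F\<^esub> lmul f ` fibre w"
      then obtain y where "y \<in> fibre w" "z \<in> R #>\<^bsub>F\<^esub> lmul f y"
        by (auto simp: set_mult_def r_coset_def)
      then show "z \<in> fibre (free_act W f w)" using fibre_coset[OF l] by blast
    qed
    show "fibre (free_act W f w) \<subseteq> R <#>\<^bsub>F\<^esub> lmul f ` fibre w"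
      unfolding fibre_coset[OF l[OF x], symmetric] using x by (auto simp: set_mult_def r_coset_def)
  qed
  then show ?thesis by (simp add: ind_env_act_def lmul_def)
qed

lemma Ind_simps:
  "carrier (Ind q V) = rcosets\<^bsub>F\<^esub> R" "add (Ind q V) S T = S <#>\<^bsub>F\<^esub> T"
  "smult (Ind q V) c T = ind_env_act (bms_sub q) V (env_class UNIV (Poly_Mapping.single [] c)) T"
  "act (Ind q V) x T = ind_env_act (bms_sub q) V (env_class UNIV (word [x])) T"
  by (simp_all add: Ind_def induced_def ind_group_eq FactGroup_def)

lemma part_Ind: "part (Ind q V) k = (\<lambda>x. R #>\<^bsub>F\<^esub> x) ` homog k"
proof -
  interpret normal R F by (rule R_normal)
  interpret gh: group_hom F "F Mod R" "\<lambda>x. R #>\<^bsub>F\<^esub> x"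
    using r_coset_hom_Mod factorgroup_is_group by (simp add: group_hom_def group_hom_axioms_def)
  have "{ind_tensor (bms_sub q) V u v | u v i j. u \<in> env_part UNIV i \<and> v \<in> part V j \<and> i + j = k}
    = (\<lambda>x. R #>\<^bsub>F\<^esub> x) ` {frag_of (u, v) | u v i j. u \<in> env_part UNIV i \<and> v \<in> part V j \<and> i + j = k}"
    unfolding ind_tensor_def V_simps(1) by blast
  then show ?thesis
    using gh.generate_img[OF homog_gens_carrier[of k]]
    by (simp add: Ind_def induced_def ind_group_eq homog_def)
qed

theorem iso_Ind: "supermodule_iso UNIV W (Ind q V) fibre"
  unfolding supermodule_iso_def
proof (intro conjI allI ballI)
  show "bij_betw fibre (carrier W) (carrier (Ind q V))"
  proof (intro bij_betw_imageI inj_onI)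
    fix v w assume vw: "v \<in> carrier W" "w \<in> carrier W" "fibre v = fibre w"
    then obtain x where "x \<in> fibre v" "x \<in> fibre w" using ex_fibre[of v] by auto
    then have "lift v = lift w" by (simp add: fibre_def)
    then show "v = w" using vw by simp
  next
    show "fibre ` carrier W = carrier (Ind q V)"
    proof
      show "fibre ` carrier W \<subseteq> carrier (Ind q V)"
      proof clarify
        fix w assume "w \<in> carrier W"
        then obtain x where "x \<in> fibre w" using ex_fibre by blast
        then show "fibre w \<in> carrier (Ind q V)"
          using fibre_coset[of x w] unfolding Ind_simps RCOSETS_def fibre_def by blast
      qed
      show "carrier (Ind q V) \<subseteq> fibre ` carrier W"
      proof
        fix T assume "T \<in> carrier (Ind q V)"
        then obtain x where "x \<in> carrier F" "T = R #>\<^bsub>F\<^esub> x" unfolding Ind_simps RCOSETS_def by blast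
        then show "T \<in> fibre ` carrier W" using fibre_coset[OF in_fibre] by auto
      qed
    qed
  qed
  show "fibre (v \<oplus>\<^bsub>W\<^esub> w) = fibre v \<oplus>\<^bsub>Ind q V\<^esub> fibre w" if v: "v \<in> carrier W" and w: "w \<in> carrier W" for v w
  proof -
    obtain x y where x: "x \<in> fibre v" and y: "y \<in> fibre w" using ex_fibre v w by blast
    have "x + y \<in> fibre (v \<oplus>\<^bsub>W\<^esub> w)"
      using x y v w keys_add[of x y] by (auto simp: fibre_def H_add lift_add)
    then show ?thesis
      using normal.rcos_sum[OF R_normal, of x y] x y fibre_coset by (auto simp: Ind_simps fibre_def)
  qed
  show "fibre (c \<odot>\<^bsub>W\<^esub> v) = c \<odot>\<^bsub>Ind q V\<^esub> fibre v" if "v \<in> carrier W" for c v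
    using that by (simp add: Ind_simps ind_env_act_fibre)
  show "fibre (act W x v) = act (Ind q V) x (fibre v)" if "v \<in> carrier W" for x v
    using that by (simp add: Ind_simps ind_env_act_fibre)
  show "fibre ` part W k = part (Ind q V) k" for k
  proof
    show "fibre ` part W k \<subseteq> part (Ind q V) k"
    proof clarify
      fix w assume w: "w \<in> part W k"
      then have wc: "w \<in> carrier W" using part_facts(1) by auto
      then obtain x where x: "x \<in> fibre w" using ex_fibre by blast
      then have xF: "x \<in> carrier F" "H x = lift w" by (simp_all add: fibre_def)
      obtain x0 x1 where x01: "x0 \<in> homog 0" "x1 \<in> homog 1" "x - x0 - x1 \<in> R"
        using homog_decomp[OF xF(1)] by blast
      have eq: "lift w = H x0 + H x1" using H_R[OF x01(3)] xF by (simp add: H_diff H_add algebra_simps)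
      \<comment> \<open>Of the two homogeneous parts of x, the one of the wrong parity maps to zero,
        so the other one alone represents w.\<close>
      note u = lift_part_unique[OF H_homog[OF x01(1)] H_homog[OF x01(2)] w eq]
      consider "k = 0" | "k = 1" by (cases k) auto
      then have "\<exists>y\<in>homog k. y \<in> fibre w"
      proof cases
        case 1
        then show ?thesis using u(1) eq x01 homog_closed(1) by (intro bexI[of _ x0]) (auto simp: fibre_def)
      next
        case 2
        then show ?thesis using u(2) eq x01 homog_closed(1) by (intro bexI[of _ x1]) (auto simp: fibre_def)
      qed
      then show "fibre w \<in> part (Ind q V) k" using fibre_coset unfolding part_Ind by blast
    qed
    show "part (Ind q V) k \<subseteq> fibre ` part W k"
    proof
      fix T assume "T \<in> part (Ind q V) k"
      then obtain x where x: "x \<in> homog k" "T = R #>\<^bsub>F\<^esub> x" unfolding part_Ind by blast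
      obtain w where "w \<in> part W k" "H x = lift w" using H_homog[OF x(1)] by blast
      then show "T \<in> fibre ` part W k"
        using fibre_coset[of x w] homog_closed(1)[OF x(1)] x(2) by (auto simp: fibre_def)
    qed
  qed
qed

end

section \<open>Annihilated vectors of a simple smooth module\<close>

context bms_rep
begin

text \<open>n bounds the number of operators still to be dealt with. If the highest of them does not
  kill e, its image replaces e: that vector is nonzero, is killed by this operator too, and stays
  killed by the higher ones.\<close>

lemma ex_level2:
  assumes "e \<in> level1 t" "e \<noteq> 0" "\<And>k. k > int t + int n \<Longrightarrow> Q k e = 0"
  shows "\<exists>e'\<in>level2 t. e' \<noteq> 0"
  using assms
proof (induction n arbitrary: e)
  case 0
  then show ?case by (auto simp: level2_def)
next
  case (Suc n)
  let ?m = "int t + int (Suc n)"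
  have M0: "M i e = 0" if "i > int t" for i using Suc.prems(1) that by (simp add: level1_def)
  show ?case
  proof (cases "Q ?m e = 0")
    case True
    then have "Q k e = 0" if "k > int t + int n" for k
      using that Suc.prems(3)[of k] by (cases "k = ?m") auto
    then show ?thesis using Suc by blast
  next
    case False
    have "Q k (Q ?m e) = 0" if k: "k > int t + int n" for k
    proof (cases "k = ?m")
      case True
      \<comment> \<open>The square equals its own negative, because M with index ?m + ?m - 1 > t
        kills e.\<close>
      have "Q ?m (Q ?m e) = - Q ?m (Q ?m e)" using QQ[of ?m ?m e] M0[of "?m + ?m - 1"] by simp
      then have "2 *s Q ?m (Q ?m e) = 0"
        using scale_left_distrib[of 1 1 "Q ?m (Q ?m e)"] by (simp add: eq_neg_iff_add_eq_0)
      then show ?thesis using True by simp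
    next
      case False
      then show ?thesis using k QQ[of k ?m e] Suc.prems(3)[of k] M0[of "k + ?m - 1"] by (simp add: lin_simps)
    qed
    then show ?thesis using Suc.IH[of "Q ?m e"] False level1_closed(2)[OF Suc.prems(1)] by blast
  qed
qed

end

section \<open>The space V inside W\<close>

locale bms_annihilated = bms_module +
  fixes t q :: nat and c1 :: complex
  assumes charge: "w \<in> carrier W \<Longrightarrow> act W bC1 w = c1 \<odot>\<^bsub>W\<^esub> w"
    and top_inj: "n \<noteq> 0 \<Longrightarrow> e \<in> rep.level1 t \<Longrightarrow> rep.top_M t n e = 0 \<Longrightarrow> e = 0"
begin

sublocale lev: bms_rep_level pscale "\<lambda>n. op (bL n)" "\<lambda>n. op (bM n)" "\<lambda>n. op (bQ n)" "op bC2" "lift ` carrier W" t q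
  by unfold_locales (rule top_inj)

definition annihilated :: "'a set" where
  "annihilated = {w \<in> carrier W. lift w \<in> rep.level3 t q}"

lemma annihilated_iff:
  "w \<in> annihilated \<longleftrightarrow> w \<in> carrier W \<and> (\<forall>i > int t. act W (bM i) w = \<zero>\<^bsub>W\<^esub>)
    \<and> (\<forall>k > int t. act W (bQ k) w = \<zero>\<^bsub>W\<^esub>) \<and> (\<forall>j > int t + int q. act W (bL j) w = \<zero>\<^bsub>W\<^esub>)"
  by (auto simp: annihilated_def rep.level3_def rep.level2_def rep.level1_def)

text \<open>A homogeneous x either preserves or exchanges the two parts of W, so the images of v0
  and v1 lie in different parts and cannot cancel. This is why V is graded.\<close>

lemma graded_kernel:
  assumes x: "x \<in> bms_part i" and v: "v0 \<in> part W 0" "v1 \<in> part W 1" and 0: "act W x (v0 \<oplus>\<^bsub>W\<^esub> v1) = \<zero>\<^bsub>W\<^esub>"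
  shows "act W x v0 = \<zero>\<^bsub>W\<^esub> \<and> act W x v1 = \<zero>\<^bsub>W\<^esub>"
proof -
  have c: "v0 \<in> carrier W" "v1 \<in> carrier W" using v part_facts(1) by auto
  then have eq: "act W x v0 \<oplus>\<^bsub>W\<^esub> act W x v1 = \<zero>\<^bsub>W\<^esub> \<oplus>\<^bsub>W\<^esub> \<zero>\<^bsub>W\<^esub>" "act W x v1 \<oplus>\<^bsub>W\<^esub> act W x v0 = \<zero>\<^bsub>W\<^esub> \<oplus>\<^bsub>W\<^esub> \<zero>\<^bsub>W\<^esub>"
    using 0 act_add[of v0 v1 x] W.a_comm[of "act W x v0" "act W x v1"] by simp_all
  note p = act_part[OF x v(1)] act_part[OF x v(2)]
  consider "i = 0" | "i = 1" by (cases i) auto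
  then show ?thesis
  proof cases
    case 1
    then show ?thesis using part_unique[OF _ _ part_facts(2) part_facts(2) eq(1)] p by auto
  next
    case 2
    then show ?thesis using part_unique[OF _ _ part_facts(2) part_facts(2) eq(2)] p by auto
  qed
qed

lemma basis_part: "bM n \<in> bms_part 0" "bL n \<in> bms_part 0" "bQ n \<in> bms_part 1"
  by (simp_all add: bms_part_def bM_def bL_def bQ_def)

lemma annihilated_submodule: "submodule annihilated complex_ring W"
  by (rule complex_submoduleI[OF W.module_axioms]) (auto simp: annihilated_iff act_add act_smult)

lemma annihilated_stable:
  assumes "a \<in> sub_basis q" "w \<in> annihilated"
  shows "act W (basis_elt a) w \<in> annihilated"
proof -
  have w: "w \<in> carrier W" "lift w \<in> rep.level3 t q" using assms by (simp_all add: annihilated_def)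
  note cl = rep.level3_closed[OF w(2)]
  have "op (basis_elt a) (lift w) \<in> rep.level3 t q"
  proof (cases a)
    case C1B
    then show ?thesis
      using w charge[OF w(1)] pm.subspace_scale[OF rep.subspace_levels(3)] by (simp add: bC1_def lift_smult)
  qed (use assms cl in \<open>auto simp: sub_basis_def bL_def bM_def bQ_def bC2_def simp del: op_lift\<close>)
  then show ?thesis using w by (simp add: annihilated_def)
qed

sublocale sub: bms_submodule W q annihilated
proof (intro bms_submodule.intro bms_submodule_axioms.intro bms_module_axioms)
  fix v assume v: "v \<in> annihilated"
  then have "v \<in> carrier W" by (simp add: annihilated_def)
  then obtain v0 v1 where d: "v0 \<in> part W 0" "v1 \<in> part W 1" "v = v0 \<oplus>\<^bsub>W\<^esub> v1"
    using ex1_implies_ex[OF part_decomp] by force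
  then have "v0 \<in> carrier W" "v1 \<in> carrier W" using part_facts(1) by auto
  then have "v0 \<in> annihilated" "v1 \<in> annihilated"
    using v graded_kernel[OF basis_part(1) d(1,2)] graded_kernel[OF basis_part(2) d(1,2)]
      graded_kernel[OF basis_part(3) d(1,2)] d(3) by (auto simp: annihilated_iff)
  then show "\<exists>v0\<in>annihilated \<inter> part W 0. \<exists>v1\<in>annihilated \<inter> part W 1. v = v0 \<oplus>\<^bsub>W\<^esub> v1"
    using d by blast
next
  show "act W x v \<in> annihilated" if "x \<in> bms_sub q" "v \<in> annihilated" for x v
    using stable_bms_sub[OF annihilated_submodule annihilated_stable that] .
qed (rule annihilated_submodule)

lemma foldr_op_lift: "v \<in> carrier W \<Longrightarrow> foldr (\<lambda>i. op (f i)) c (lift v) = lift (foldr (act W) (map f c) v)"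
  by (induction c) simp_all

lemma annihilated_independent:
  assumes A: "finite A" "A \<subseteq> pbw_index" and v: "\<forall>p\<in>A. v p \<in> annihilated"
    and sum: "(\<Sum>p\<in>A. lift (foldr (act W) (map basis_elt (pbw_word q p)) (v p))) = 0"
  shows "\<forall>p\<in>A. v p = \<zero>\<^bsub>W\<^esub>"
proof -
  have *: "map basis_elt (pbw_word q (c, b, a)) = map (\<lambda>i. bL (- int i - 1)) c @ map (\<lambda>i. bQ (- int i)) b
     @ map (\<lambda>i. bM (- int q - int i - 1)) a" for c b a
    by (simp add: bL_def bM_def bQ_def)
  have op: "lev.pbw_op p (lift w) = lift (foldr (act W) (map basis_elt (pbw_word q p)) w)" if "w \<in> carrier W" for p w
  proof (cases p)
    case (fields c b a)
    show ?thesis using that unfolding fields * by (simp add: foldr_op_lift)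
  qed
  have vc: "v p \<in> carrier W" "lift (v p) \<in> rep.level3 t q" if "p \<in> A" for p
    using bspec[OF v that] unfolding annihilated_def by blast+
  have "(\<Sum>p\<in>A. lev.pbw_op p (lift (v p))) = 0"
    unfolding sum[symmetric] by (rule sum.cong[OF refl]) (rule op[OF vc(1)])
  from lev.pbw_independent[OF A _ this] show ?thesis using vc by (metis lift_eq_0_iff)
qed

lemma generated_if_simple:
  assumes "simple_supermodule UNIV W" "bms_submodule W q K" "K \<noteq> {\<zero>\<^bsub>W\<^esub>}"
  shows "bms_submodule.generated W K = carrier W"
proof -
  interpret K: bms_submodule W q K by (rule assms(2))
  have "K.generated \<noteq> {\<zero>\<^bsub>W\<^esub>}" using K.N_generated K.N_facts(2) assms(3) by blast
  then show ?thesis using assms(1) K.generated_submodule unfolding simple_supermodule_def by blast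
qed

text \<open>A vector v of V has an expansion in ordered monomials over a nonzero submodule K. It is
  also the empty monomial applied to v, so independence over V identifies v with the coefficient of
  the empty monomial, which lies in K.\<close>

lemma simple_V:
  assumes "simple_supermodule UNIV W" "annihilated \<noteq> {\<zero>\<^bsub>W\<^esub>}"
  shows "simple_supermodule (bms_sub q) sub.V"
  unfolding simple_supermodule_def
proof (intro conjI allI impI)
  show "supermodule (bms_sub q) sub.V" by (rule sub.supermodule_V)
  show "carrier sub.V \<noteq> {\<zero>\<^bsub>sub.V\<^esub>}" using assms(2) by simp
  fix K assume K: "sub_supermodule (bms_sub q) sub.V K"
  then have "submodule K complex_ring sub.V" by (simp add: sub_supermodule_def)
  note D = complex_submoduleD[OF sub.module_V this, unfolded sub.V_simps]
  interpret K: bms_submodule W q K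
  proof (intro bms_submodule.intro bms_submodule_axioms.intro bms_module_axioms)
    show "submodule K complex_ring W"
      using D sub.N_facts(1) by (intro complex_submoduleI[OF W.module_axioms]) auto
    show "\<exists>v0\<in>K \<inter> part W 0. \<exists>v1\<in>K \<inter> part W 1. v = v0 \<oplus>\<^bsub>W\<^esub> v1" if "v \<in> K" for v
      using K that unfolding sub_supermodule_def sub.V_simps by blast
  qed (use K in \<open>simp add: sub_supermodule_def\<close>)
  have "annihilated \<subseteq> K" if "K \<noteq> {\<zero>\<^bsub>W\<^esub>}"
  proof
    fix v assume v: "v \<in> annihilated"
    have vc: "v \<in> carrier W" using v by (rule sub.N_carrier)
    have "v \<in> K.generated"
      using generated_if_simple[OF assms(1) K.bms_submodule_axioms that] vc by simp
    from K.generated_pbw[OF this] obtain A v' where A: "finite A" "A \<subseteq> pbw_index" "\<forall>p. v' p \<in> K"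
      "lift v = (\<Sum>p\<in>A. lift (foldr (act W) (map basis_elt (pbw_word q p)) (v' p)))"
      by (elim exE conjE)
    define one :: "nat list \<times> nat list \<times> nat list" where "one = ([], [], [])"
    \<comment> \<open>The empty monomial may be missing from A; its coefficient is then
      zero.\<close>
    define u where "u p = (if p \<in> A then v' p else \<zero>\<^bsub>W\<^esub>)" for p
    have one: "one \<in> pbw_index" "pbw_word q one = []" by (simp_all add: one_def pbw_index_def)
    have u: "u p \<in> K" "u p \<in> annihilated" "u p \<in> carrier W" for p
    proof -
      show "u p \<in> K" unfolding u_def using A(3) D(2) by presburger
      then show "u p \<in> annihilated" using D(1) by blast
      then show "u p \<in> carrier W" by (rule sub.N_carrier)
    qed
    define T where "T p w = lift (foldr (act W) (map basis_elt (pbw_word q p)) w)" for p w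
    have Tz: "T p \<zero>\<^bsub>W\<^esub> = 0" for p using foldr_act_smult[of "\<zero>\<^bsub>W\<^esub>" _ 0] by (simp add: T_def)
    have "(\<Sum>p\<in>insert one A. T p (u p)) = (\<Sum>p\<in>A. T p (v' p))"
      using A(1) by (intro sum.mono_neutral_cong_right) (auto simp: u_def Tz)
    then have su: "(\<Sum>p\<in>insert one A. T p (u p)) = lift v" using A(4) by (simp add: T_def)
    have T1: "T one w = lift w" for w by (simp add: T_def one)
    \<comment> \<open>Subtracting v from the coefficient of the empty monomial turns the expansion
      of v into a vanishing sum over V.\<close>
    define d where "d p = (if p = one then u p \<ominus>\<^bsub>W\<^esub> v else u p)" for p
    have "(\<Sum>p\<in>insert one A. T p (d p)) = T one (d one) + (\<Sum>p\<in>A - {one}. T p (d p))"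
      using A(1) by (rule sum.insert_remove)
    also have "\<dots> = T one (u one) - lift v + (\<Sum>p\<in>A - {one}. T p (u p))"
      using vc u by (simp add: d_def T1 lift_minus)
    also have "\<dots> = (\<Sum>p\<in>insert one A. T p (u p)) - lift v"
      using sum.insert_remove[OF A(1), of "\<lambda>p. T p (u p)" one] by simp
    finally have "(\<Sum>p\<in>insert one A. T p (d p)) = 0" using su by simp
    then have "\<forall>p\<in>insert one A. d p = \<zero>\<^bsub>W\<^esub>"
      using A one u v sub.N_minus unfolding T_def by (intro annihilated_independent) (auto simp: d_def)
    then have "u one \<ominus>\<^bsub>W\<^esub> v = \<zero>\<^bsub>W\<^esub>" by (simp add: d_def)
    then have "u one = v" using u(3) vc by (rule eq_if_minus_eq_0[rotated 2])
    then show "v \<in> K" using u(1) by metis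
  qed
  then show "K = {\<zero>\<^bsub>sub.V\<^esub>} \<or> K = carrier sub.V" using D(1) by auto
qed

end

section \<open>Choice of t, q and V\<close>

theorem theorem4p5:
  fixes c1 c2 :: complex
    and W :: "'w supermod"
  assumes "W \<in> smooth_modules c1 c2"
    and "simple_supermodule UNIV W"
    and "\<And>n :: int. n \<noteq> 0 \<Longrightarrow> inj_on (act W (shiftM0 n)) (carrier W)"
  shows "\<exists>(q :: nat) (V :: 'w supermod).
    simple_supermodule (bms_sub q) V \<and>
    central_charge c1 c2 V \<and>
    (\<exists>\<phi>. supermodule_iso UNIV W (Ind q V) \<phi>) \<and>
    (\<exists>t :: nat.
       (if t > 0 then inj_on (act V (bM (int t))) (carrier V)
        else (\<forall>n :: int. n \<noteq> 0 \<longrightarrow> inj_on (act V (shiftM0 n)) (carrier V))) \<and>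
       (\<forall>i > int t. \<forall>v\<in>carrier V. act V (bM i) v = \<zero>\<^bsub>V\<^esub>) \<and>
       (\<forall>j > int t + int q. \<forall>v\<in>carrier V. act V (bL j) v = \<zero>\<^bsub>V\<^esub>))"
proof -
  interpret bms_module W
    using assms(1) by unfold_locales (simp add: smooth_modules_def)
  have sm: "\<exists>K. \<forall>i\<ge>K. act W (bL i) w = \<zero>\<^bsub>W\<^esub> \<and> act W (bM i) w = \<zero>\<^bsub>W\<^esub> \<and> act W (bQ i) w = \<zero>\<^bsub>W\<^esub>"
    if "w \<in> carrier W" for w
    using assms(1) that by (simp add: smooth_modules_def smooth_def)
  have cc: "act W bC1 w = c1 \<odot>\<^bsub>W\<^esub> w" "act W bC2 w = c2 \<odot>\<^bsub>W\<^esub> w" if "w \<in> carrier W" for w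
    using assms(1) that by (simp_all add: smooth_modules_def central_charge_def)
  define P where "P t \<longleftrightarrow> (\<exists>w\<in>carrier W. w \<noteq> \<zero>\<^bsub>W\<^esub> \<and> (\<forall>i > int t. act W (bM i) w = \<zero>\<^bsub>W\<^esub>))" for t :: nat
  define t where "t = (LEAST t. P t)"
  have "\<exists>t. P t"
  proof -
    have "carrier W \<noteq> {\<zero>\<^bsub>W\<^esub>}" using assms(2) by (simp add: simple_supermodule_def)
    then obtain w where w: "w \<in> carrier W" "w \<noteq> \<zero>\<^bsub>W\<^esub>" using W.zero_closed by blast
    obtain K where "\<forall>i\<ge>K. act W (bM i) w = \<zero>\<^bsub>W\<^esub>" using sm[OF w(1)] by blast
    then have "P (nat K)" unfolding P_def using w by (intro bexI[of _ w]) auto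
    then show ?thesis by blast
  qed
  then have Pt: "P t" unfolding t_def by (rule LeastI_ex)
  \<comment> \<open>A counterexample would witness \<open>P (t - 1)\<close>. The conclusion holds
    for all vectors killed by the higher M, not just for those in V.\<close>
  have min: "w = \<zero>\<^bsub>W\<^esub>" if "t > 0" "w \<in> carrier W" "act W (bM (int t)) w = \<zero>\<^bsub>W\<^esub>" "\<forall>i > int t. act W (bM i) w = \<zero>\<^bsub>W\<^esub>" for w
  proof (rule ccontr)
    assume "w \<noteq> \<zero>\<^bsub>W\<^esub>"
    have "act W (bM i) w = \<zero>\<^bsub>W\<^esub>" if "i > int (t - 1)" for i
      using that \<open>t > 0\<close> \<open>act W (bM (int t)) w = _\<close> \<open>\<forall>i > int t. _\<close> by (cases "i = int t") auto
    then have "P (t - 1)" using \<open>w \<noteq> _\<close> \<open>w \<in> _\<close> unfolding P_def by blast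
    then show False using not_less_Least[of "t - 1" P] \<open>t > 0\<close> by (simp add: t_def)
  qed
  \<comment> \<open>For t = 0 this is the hypothesis on M_0, for t > 0 it is the minimality of
    t.\<close>
  have inj: "e = 0" if n: "n \<noteq> 0" and e: "e \<in> rep.level1 t" "rep.top_M t n e = 0" for n e
  proof -
    obtain w where w: "w \<in> carrier W" "e = lift w" using e(1) by (auto simp: rep.level1_def)
    have M: "\<forall>i > int t. act W (bM i) w = \<zero>\<^bsub>W\<^esub>" using e(1) w by (auto simp: rep.level1_def)
    have "w = \<zero>\<^bsub>W\<^esub>"
    proof (cases "t = 0")
      case True
      have "lift (act W (shiftM0 n) w) = rep.top_M t n e"
        using w True by (simp add: shiftM0_def rep.top_M_def act_plus act_cscale lift_add lift_smult)
      then have "act W (shiftM0 n) w = act W (shiftM0 n) \<zero>\<^bsub>W\<^esub>" using e(2) w by simp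
      then show ?thesis using assms(3)[OF n] w by (simp add: inj_on_def)
    next
      case False
      show ?thesis by (rule min) (use False e(2) w M in \<open>auto simp: rep.top_M_def\<close>)
    qed
    then show ?thesis using w by simp
  qed
  obtain w where w: "w \<in> carrier W" "w \<noteq> \<zero>\<^bsub>W\<^esub>" "\<forall>i > int t. act W (bM i) w = \<zero>\<^bsub>W\<^esub>"
    using Pt unfolding P_def by blast
  obtain K where K: "\<forall>i\<ge>K. act W (bQ i) w = \<zero>\<^bsub>W\<^esub>" using sm[OF w(1)] by blast
  have "\<exists>e'\<in>rep.level2 t. e' \<noteq> 0"
  proof (rule rep.ex_level2[of "lift w" t "nat K"])
    show "op (bQ k) (lift w) = 0" if "k > int t + int (nat K)" for k
    proof -
      have "k \<ge> K" using that by linarith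
      then show ?thesis using K w by simp
    qed
  qed (use w in \<open>auto simp: rep.level1_def\<close>)
  then obtain w' where w': "w' \<in> carrier W" "lift w' \<in> rep.level2 t" "w' \<noteq> \<zero>\<^bsub>W\<^esub>"
    by (auto simp: rep.level2_def rep.level1_def)
  obtain K' where K': "\<forall>i\<ge>K'. act W (bL i) w' = \<zero>\<^bsub>W\<^esub>" using sm[OF w'(1)] by blast
  \<comment> \<open>\<open>nat\<close> turns a negative bound into 0; in either case j > t + q
    implies j \<ge> K'.\<close>
  define q where "q = nat K'"
  interpret bms_annihilated W t q c1
    by unfold_locales (use cc inj in auto)
  have "w' \<in> annihilated"
    unfolding annihilated_def rep.level3_def using w'
  proof (intro CollectI conjI allI impI)
    fix j assume "int t + int q < j"
    then have "j \<ge> K'" unfolding q_def by linarith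
    then show "op (bL j) (lift w') = 0" using K' w' by simp
  qed
  then have nz: "annihilated \<noteq> {\<zero>\<^bsub>W\<^esub>}" using w'(3) by blast
  interpret ind: bms_induction W q annihilated
    by unfold_locales
      (rule annihilated_independent generated_if_simple[OF assms(2) sub.bms_submodule_axioms nz]; assumption)+
  have ann: "v \<in> carrier W" "\<forall>i > int t. act W (bM i) v = \<zero>\<^bsub>W\<^esub>" "\<forall>j > int t + int q. act W (bL j) v = \<zero>\<^bsub>W\<^esub>"
    if "v \<in> annihilated" for v
    using that unfolding annihilated_iff by blast+
  have inj_t: "inj_on (act W (bM (int t))) annihilated" if "t > 0"
  proof (rule inj_onI)
    fix v w assume v: "v \<in> annihilated" and w: "w \<in> annihilated" and eq: "act W (bM (int t)) v = act W (bM (int t)) w"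
    have vw: "v \<ominus>\<^bsub>W\<^esub> w \<in> annihilated" using v w by (rule sub.N_minus)
    have "lift (act W (bM (int t)) (v \<ominus>\<^bsub>W\<^esub> w)) = 0"
      using eq ann(1)[OF v] ann(1)[OF w] by (simp add: a_minus_def a_inv_smult act_add act_smult lift_add lift_smult)
    then have "act W (bM (int t)) (v \<ominus>\<^bsub>W\<^esub> w) = \<zero>\<^bsub>W\<^esub>" using ann(1)[OF vw] by simp
    then have "v \<ominus>\<^bsub>W\<^esub> w = \<zero>\<^bsub>W\<^esub>" by (rule min[OF that ann(1)[OF vw] _ ann(2)[OF vw]])
    then show "v = w" using ann(1)[OF v] ann(1)[OF w] by (rule eq_if_minus_eq_0[rotated 2])
  qed
  show ?thesis
  proof (rule exI[of _ q], rule exI[of _ sub.V], intro conjI)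
    show "simple_supermodule (bms_sub q) sub.V" by (rule simple_V[OF assms(2) nz])
    show "central_charge c1 c2 sub.V" using cc ann(1) by (simp add: central_charge_def)
    show "\<exists>\<phi>. supermodule_iso UNIV W (Ind q sub.V) \<phi>" using ind.iso_Ind by blast
    show "\<exists>t :: nat.
       (if t > 0 then inj_on (act sub.V (bM (int t))) (carrier sub.V)
        else (\<forall>n :: int. n \<noteq> 0 \<longrightarrow> inj_on (act sub.V (shiftM0 n)) (carrier sub.V))) \<and>
       (\<forall>i > int t. \<forall>v\<in>carrier sub.V. act sub.V (bM i) v = \<zero>\<^bsub>sub.V\<^esub>) \<and>
       (\<forall>j > int t + int q. \<forall>v\<in>carrier sub.V. act sub.V (bL j) v = \<zero>\<^bsub>sub.V\<^esub>)"
      unfolding sub.V_simps using inj_t ann inj_on_subset[OF assms(3) sub.N_facts(1)]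
      unfolding if_bool_eq_conj by blast
  qed
qed

end
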